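(* (Without assuming Dickson's conjecture.) The theory $T_{+,\Pr}=\mathrm{Th}(\mathbb{Z},+,0,1,\Pr)$ has the independence property, and moreover for every $n\ge1$ it has the $n$-independence property. Hence the same holds for $T^*_{+,\Pr}$.
   Context: $\Pr$ is the set of prime numbers together with their negations. $T^*_{+,\Pr}$ is the complete theory of the structure with universe $\mathbb{Z}$ in the language $\{+,-,0,1,\Pr,\Pr_n,P_n:2\le n<\omega\}$, where $-$ is unary negation, $P_n(x)$ holds iff $x\equiv0\pmod n$, and $\Pr_n(x)$ holds iff $P_n(x)$ and $\Pr(x/n)$. A complete theory $T$ has the $n$-independence property if there is a formula $\varphi(x,y_1,\dots,y_n)$ such that for every $k<\omega$ there are, in some model $M\models T$, tuples $a_{i,j}$ ($i<n$, $j<k$) such that for every subset $s\subseteq k^n$ there is $b_s\in M$ with $M\models\varphi(b_s,a_{0,j_0},\dots,a_{n-1,j_{n-1}})$ iff $(j_0,\dots,j_{n-1})\in s$. The independence property is the case $n=1$. *)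

theory Defs
  imports Complex_Main "HOL-Computational_Algebra.Primes" "HOL-Library.Countable"
begin

section \<open>First-order logic with equality\<close>

datatype 'f tm = Var nat | Fun 'f "'f tm list"

datatype ('f, 'r) fm =
    Eq "'f tm" "'f tm"
  | Rel 'r "'f tm list"
  | Neg "('f, 'r) fm"
  | Conj "('f, 'r) fm" "('f, 'r) fm"
  | Exists nat "('f, 'r) fm"

text \<open>A language assigns arities to its symbols; \<^const>\<open>None\<close> means that the symbol does
  not belong to the language.\<close>

record ('f, 'r) lang =
  fun_arity :: "'f \<Rightarrow> nat option"
  rel_arity :: "'r \<Rightarrow> nat option"

fun tm_in :: "('f, 'r) lang \<Rightarrow> 'f tm \<Rightarrow> bool" where
  "tm_in L (Var x) \<longleftrightarrow> True"
| "tm_in L (Fun f ts) \<longleftrightarrow> fun_arity L f = Some (length ts) \<and> (\<forall>t\<in>set ts. tm_in L t)"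

fun fm_in :: "('f, 'r) lang \<Rightarrow> ('f, 'r) fm \<Rightarrow> bool" where
  "fm_in L (Eq s t) \<longleftrightarrow> tm_in L s \<and> tm_in L t"
| "fm_in L (Rel r ts) \<longleftrightarrow> rel_arity L r = Some (length ts) \<and> (\<forall>t\<in>set ts. tm_in L t)"
| "fm_in L (Neg p) \<longleftrightarrow> fm_in L p"
| "fm_in L (Conj p q) \<longleftrightarrow> fm_in L p \<and> fm_in L q"
| "fm_in L (Exists x p) \<longleftrightarrow> fm_in L p"

fun tm_vars :: "'f tm \<Rightarrow> nat set" where
  "tm_vars (Var x) = {x}"
| "tm_vars (Fun f ts) = (\<Union>t\<in>set ts. tm_vars t)"

fun free_vars :: "('f, 'r) fm \<Rightarrow> nat set" where
  "free_vars (Eq s t) = tm_vars s \<union> tm_vars t"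
| "free_vars (Rel r ts) = (\<Union>t\<in>set ts. tm_vars t)"
| "free_vars (Neg p) = free_vars p"
| "free_vars (Conj p q) = free_vars p \<union> free_vars q"
| "free_vars (Exists x p) = free_vars p - {x}"

definition sentence :: "('f, 'r) lang \<Rightarrow> ('f, 'r) fm \<Rightarrow> bool" where
  "sentence L p \<longleftrightarrow> fm_in L p \<and> free_vars p = {}"

text \<open>Symbols outside the language at hand, and argument lists of the wrong length, are
  interpreted too, but no formula of the language refers to these values. Thus the same record
  also serves as each of its reducts.\<close>

record ('f, 'r, 'a) fo_struct =
  universe :: "'a set"
  fun_interp :: "'f \<Rightarrow> 'a list \<Rightarrow> 'a"
  rel_interp :: "'r \<Rightarrow> 'a list \<Rightarrow> bool"

definition is_struct :: "('f, 'r) lang \<Rightarrow> ('f, 'r, 'a) fo_struct \<Rightarrow> bool" where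
  "is_struct L M \<longleftrightarrow> universe M \<noteq> {} \<and>
     (\<forall>f xs. fun_arity L f = Some (length xs) \<longrightarrow> set xs \<subseteq> universe M \<longrightarrow>
        fun_interp M f xs \<in> universe M)"

fun tm_val :: "('f, 'r, 'a) fo_struct \<Rightarrow> (nat \<Rightarrow> 'a) \<Rightarrow> 'f tm \<Rightarrow> 'a" where
  "tm_val M e (Var x) = e x"
| "tm_val M e (Fun f ts) = fun_interp M f (map (tm_val M e) ts)"

fun sat :: "('f, 'r, 'a) fo_struct \<Rightarrow> (nat \<Rightarrow> 'a) \<Rightarrow> ('f, 'r) fm \<Rightarrow> bool" where
  "sat M e (Eq s t) \<longleftrightarrow> tm_val M e s = tm_val M e t"
| "sat M e (Rel r ts) \<longleftrightarrow> rel_interp M r (map (tm_val M e) ts)"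
| "sat M e (Neg p) \<longleftrightarrow> \<not> sat M e p"
| "sat M e (Conj p q) \<longleftrightarrow> sat M e p \<and> sat M e q"
| "sat M e (Exists x p) \<longleftrightarrow> (\<exists>a\<in>universe M. sat M (e(x := a)) p)"

definition holds :: "('f, 'r, 'a) fo_struct \<Rightarrow> ('f, 'r) fm \<Rightarrow> bool" where
  "holds M p \<longleftrightarrow> (\<forall>e. range e \<subseteq> universe M \<longrightarrow> sat M e p)"

definition Th :: "('f, 'r) lang \<Rightarrow> ('f, 'r, 'a) fo_struct \<Rightarrow> ('f, 'r) fm set" where
  "Th L M = {p. sentence L p \<and> holds M p}"

definition is_model ::
  "('f, 'r) lang \<Rightarrow> ('f, 'r) fm set \<Rightarrow> ('f, 'r, 'a) fo_struct \<Rightarrow> bool" where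
  "is_model L T M \<longleftrightarrow> is_struct L M \<and> (\<forall>p\<in>T. holds M p)"

section \<open>The independence properties\<close>

text \<open>
  In \<open>\<phi>(x, y\<^sub>1, \<dots>, y\<^sub>n)\<close> the variable \<open>x\<close> is \<open>Var 0\<close>, and the
  tuples \<open>y\<^sub>1, \<dots>, y\<^sub>n\<close>, of lengths \<open>l 0, \<dots>, l (n - 1)\<close>, are the blocks of
  variables that follow it.  An element of \<open>k\<^sup>n\<close> is a list \<open>js\<close> of length \<open>n\<close>
  with entries below \<open>k\<close>.

  HOL cannot quantify over all types, so the models range over the structures whose universe is a
  subset of \<^typ>\<open>int\<close>, that is, up to isomorphism, over all countable (or finite) ones.  For
  a countable language this is no restriction: for a given \<open>k\<close> only finitely many elements of
  the model are involved, and by the downward Loewenheim-Skolem theorem they lie in a countable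
  elementary submodel.
\<close>

definition n_indep_property ::
  "nat \<Rightarrow> ('f::countable, 'r::countable) lang \<Rightarrow> ('f, 'r) fm set \<Rightarrow> bool" where
  "n_indep_property n L T \<longleftrightarrow>
    (\<exists>\<phi> l. fm_in L \<phi> \<and> free_vars \<phi> \<subseteq> {..<1 + (\<Sum>i<n. l i)} \<and>
      (\<forall>k::nat. \<exists>(M :: ('f, 'r, int) fo_struct) a.
         is_model L T M \<and>
         (\<forall>i<n. \<forall>j<k. length (a i j) = l i \<and> set (a i j) \<subseteq> universe M) \<and>
         (\<forall>s \<subseteq> {js. length js = n \<and> set js \<subseteq> {..<k}}.
            \<exists>b\<in>universe M. \<forall>js. length js = n \<and> set js \<subseteq> {..<k} \<longrightarrow>
              (sat M ((!) (b # concat (map (\<lambda>i. a i (js ! i)) [0..<n]))) \<phi> \<longleftrightarrow> js \<in> s))))"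

definition indep_property ::
  "('f::countable, 'r::countable) lang \<Rightarrow> ('f, 'r) fm set \<Rightarrow> bool" where
  "indep_property L T \<longleftrightarrow> n_indep_property 1 L T"

section \<open>The integers with addition and a predicate for the primes\<close>

datatype fsym = Plus | Minus | Zero | One

datatype rsym = Pr | Pr_div nat | P_div nat

instance fsym :: countable by countable_datatype
instance rsym :: countable by countable_datatype

definition pm_primes :: "int set" where
  "pm_primes = {p. prime p \<or> prime (- p)}"

fun Z_fun :: "fsym \<Rightarrow> int list \<Rightarrow> int" where
  "Z_fun Plus [x, y] = x + y"
| "Z_fun Minus [x] = - x"
| "Z_fun Zero [] = 0"
| "Z_fun One [] = 1"
| "Z_fun _ _ = 0"

fun Z_rel :: "rsym \<Rightarrow> int list \<Rightarrow> bool" where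
  "Z_rel Pr [x] \<longleftrightarrow> x \<in> pm_primes"
| "Z_rel (Pr_div n) [x] \<longleftrightarrow> x mod int n = 0 \<and> x div int n \<in> pm_primes"
| "Z_rel (P_div n) [x] \<longleftrightarrow> x mod int n = 0"
| "Z_rel _ _ \<longleftrightarrow> False"

definition Z_struct :: "(fsym, rsym, int) fo_struct" where
  "Z_struct = \<lparr>universe = UNIV, fun_interp = Z_fun, rel_interp = Z_rel\<rparr>"

definition L_plus_Pr :: "(fsym, rsym) lang" where
  "L_plus_Pr = \<lparr>fun_arity = [Plus \<mapsto> 2, Zero \<mapsto> 0, One \<mapsto> 0], rel_arity = [Pr \<mapsto> 1]\<rparr>"

definition L_plus_Pr_star :: "(fsym, rsym) lang" where
  "L_plus_Pr_star =
    \<lparr>fun_arity = [Plus \<mapsto> 2, Minus \<mapsto> 1, Zero \<mapsto> 0, One \<mapsto> 0],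
     rel_arity = (\<lambda>r. case r of
         Pr \<Rightarrow> Some 1
       | Pr_div n \<Rightarrow> (if 2 \<le> n then Some 1 else None)
       | P_div n \<Rightarrow> (if 2 \<le> n then Some 1 else None))\<rparr>"

definition T_plus_Pr :: "(fsym, rsym) fm set" where
  "T_plus_Pr = Th L_plus_Pr Z_struct"

definition T_plus_Pr_star :: "(fsym, rsym) fm set" where
  "T_plus_Pr_star = Th L_plus_Pr_star Z_struct"

end

theory Submission
  imports Defs "HOL-Analysis.Analysis" "HOL-Number_Theory.Number_Theory" "HOL-Real_Asymp.Real_Asymp"
begin

text \<open>
  The witnessing formula is \<open>\<phi>(x, y\<^sub>1, \<dots>, y\<^sub>n) = (x + y\<^sub>1 + \<dots> + y\<^sub>n \<in> Pr)\<close>.  It suffices to realise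
  every \<open>(n + 1)\<close>-partite hypergraph \<open>H\<close> on finite vertex classes: to assign numbers to the vertices
  such that the sum over a potential edge is prime exactly for the edges of \<open>H\<close>.

  Restrict to a progression \<open>t + W y\<close>, where \<open>W\<close> is divisible by all small primes.  There the primes
  have relative density \<open>\<sigma>\<close> in the numbers without prime factors up to
  \<open>z = X powr (1 / O(ln (ln X)))\<close>, whose density is \<open>\<rho>\<close>, and \<open>\<sigma>\<close> tends to \<open>0\<close> far more slowly than
  \<open>\<rho>\<close>.  Brun's pure sieve gives a majorant \<open>\<nu>\<close> of the normalised primes \<open>F\<close> all of whose correlations
  along distinct edge sums are \<open>1 + \<eta>\<close> with \<open>\<eta>\<close> smaller than any fixed power of \<open>\<sigma>\<close>.  By
  convexity the weight of all complete hypergraphs under \<open>F\<close> is at least a fixed power of \<open>\<sigma>\<close>, and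
  the Gowers-Cauchy-Schwarz inequality allows \<open>F\<close> to be replaced by \<open>\<nu>\<close>, that is by \<open>1\<close>, on the
  edges outside \<open>H\<close>; so \<open>H\<close> itself has at least that weight.  Requiring one more prime sum costs a
  factor \<open>\<rho>\<close>, by the upper bound for correlations of \<open>\<nu>\<close>.  Hence most copies of \<open>H\<close> are induced.
\<close>

section \<open>Averages over boxes\<close>

text \<open>The only lower bound for primes that enters is Chebyshev's, for a single form; it gives
  \<open>\<sigma>\<close>. Everything about several forms is an upper bound through the majorant.
  This shapes the argument: \<open>H\<close> is reached from the complete hypergraph, whose weight
  follows from that of one edge, by deleting factors. The price of Brun's sieve is that
  \<open>z\<close> stays below every fixed power of \<open>X\<close>, so \<open>\<sigma>\<close> is
  only of order \<open>1 / g\<close>, where \<open>g\<close> is of order ln ln X. It is compensated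
  by the quality of the pseudorandomness: with \<open>w = 2 ^ g\<close> both \<open>\<eta>\<close>
  and \<open>\<rho>\<close> are of order at most \<open>1 / 2 ^ g\<close>, so that losing a fixed
  power in every use of Cauchy-Schwarz and of convexity is harmless. The progression makes
  \<open>\<eta>\<close> small: the local factor at \<open>p\<close> of a product of \<open>k\<close>
  forms differs from \<open>(1 - 1 / p) ^ k\<close> by at most \<open>(k / p)\<^sup>2\<close>, and
  over the primes beyond \<open>w\<close> these errors add up to order \<open>1 / w\<close>. Such
  local factors follow from pairwise independence of the forms modulo \<open>p\<close>, which holds
  because different edges differ in some vertex.\<close>

definition avg :: "('v \<Rightarrow> nat) \<Rightarrow> 'v set \<Rightarrow> (('v \<Rightarrow> nat) \<Rightarrow> real) \<Rightarrow> real" where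
  "avg len I f = (\<Sum>x\<in>PiE I (\<lambda>v. {..<len v}). f x) / (\<Prod>v\<in>I. real (len v))"

text \<open>The average over one coordinate remains a function of all of them, so it can stand under
  \<open>avg\<close> over the same box.\<close>

definition avg1 :: "nat \<Rightarrow> 'v \<Rightarrow> (('v \<Rightarrow> nat) \<Rightarrow> real) \<Rightarrow> ('v \<Rightarrow> nat) \<Rightarrow> real" where
  "avg1 l v f x = (\<Sum>t<l. f (x(v := t))) / real l"

lemma avg_empty [simp]: "avg len {} f = f (\<lambda>_. undefined)"
  by (simp add: avg_def)

lemma avg_insert:
  assumes "finite I" "v \<notin> I"
  shows "avg len (insert v I) f = avg len I (avg1 (len v) v f)"
proof -
  have inj: "inj_on (\<lambda>(y, g). g(v := y)) ({..<len v} \<times> Pi\<^sub>E I (\<lambda>v. {..<len v}))"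
    using assms(2) by (rule inj_combinator)
  have "(\<Sum>x\<in>PiE (insert v I) (\<lambda>v. {..<len v}). f x) =
        (\<Sum>(y, g)\<in>{..<len v} \<times> PiE I (\<lambda>v. {..<len v}). f (g(v := y)))"
    unfolding PiE_insert_eq by (subst sum.reindex[OF inj]) (simp add: o_def case_prod_unfold)
  also have "\<dots> = (\<Sum>y<len v. \<Sum>g\<in>PiE I (\<lambda>v. {..<len v}). f (g(v := y)))"
    by (simp add: sum.cartesian_product)
  also have "\<dots> = (\<Sum>g\<in>PiE I (\<lambda>v. {..<len v}). \<Sum>y<len v. f (g(v := y)))"
    by (rule sum.swap)
  finally have eq: "(\<Sum>x\<in>PiE (insert v I) (\<lambda>v. {..<len v}). f x) =
    (\<Sum>g\<in>PiE I (\<lambda>v. {..<len v}). \<Sum>y<len v. f (g(v := y)))" .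
  show ?thesis
    unfolding avg_def avg1_def eq sum_divide_distrib[symmetric] using assms by simp
qed

lemma avg1_idem:
  assumes "l > 0"
  shows "avg1 l v (avg1 l v f) = avg1 l v f"
  using assms by (auto simp: avg1_def fun_eq_iff)

text \<open>Coordinate \<open>v\<close> is averaged in any case, so averaging it beforehand changes
  nothing. This is how single variables are integrated out below.\<close>

lemma avg_resample:
  assumes "finite I" "v \<in> I" "len v > 0"
  shows "avg len I (avg1 (len v) v f) = avg len I f"
proof -
  obtain J where J: "I = insert v J" "v \<notin> J"
    using assms(2) by (metis mk_disjoint_insert)
  with assms(1) have "finite J" by simp
  with J show ?thesis by (simp add: avg_insert avg1_idem[OF assms(3)])
qed

lemma avg_mono:
  assumes "\<And>x. x \<in> PiE I (\<lambda>v. {..<len v}) \<Longrightarrow> f x \<le> g x"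
  shows "avg len I f \<le> avg len I g"
  unfolding avg_def by (intro divide_right_mono sum_mono assms prod_nonneg) auto

lemma avg_cong:
  assumes "\<And>x. x \<in> PiE I (\<lambda>v. {..<len v}) \<Longrightarrow> f x = g x"
  shows "avg len I f = avg len I g"
  unfolding avg_def by (intro arg_cong2[where f = divide] sum.cong refl assms)

lemma avg_nonneg:
  assumes "\<And>x. x \<in> PiE I (\<lambda>v. {..<len v}) \<Longrightarrow> 0 \<le> f x"
  shows "0 \<le> avg len I f"
  unfolding avg_def by (intro divide_nonneg_nonneg sum_nonneg assms prod_nonneg) auto

lemma avg_add: "avg len I (\<lambda>x. f x + g x) = avg len I f + avg len I g"
  by (simp add: avg_def sum.distrib add_divide_distrib)

lemma avg_diff: "avg len I (\<lambda>x. f x - g x) = avg len I f - avg len I g"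
  by (simp add: avg_def sum_subtractf diff_divide_distrib)

lemma avg_cmult: "avg len I (\<lambda>x. c * f x) = c * avg len I f"
  by (simp add: avg_def flip: sum_distrib_left)

lemma avg_sum: "avg len I (\<lambda>x. \<Sum>a\<in>A. f a x) = (\<Sum>a\<in>A. avg len I (f a))"
  unfolding avg_def by (subst sum.swap) (simp add: sum_divide_distrib)

lemma avg_abs_le: "\<bar>avg len I f\<bar> \<le> avg len I (\<lambda>x. \<bar>f x\<bar>)"
proof -
  have "\<bar>\<Sum>x\<in>PiE I (\<lambda>v. {..<len v}). f x\<bar> \<le> (\<Sum>x\<in>PiE I (\<lambda>v. {..<len v}). \<bar>f x\<bar>)"
    by (rule sum_abs)
  moreover have "0 \<le> (\<Prod>v\<in>I. real (len v))" by (simp add: prod_nonneg)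
  ultimately show ?thesis unfolding avg_def by (simp add: divide_right_mono)
qed

lemma avg_const:
  assumes "finite I" "\<And>v. v \<in> I \<Longrightarrow> len v > 0"
  shows "avg len I (\<lambda>_. c) = c"
proof -
  have "(\<Prod>v\<in>I. real (len v)) \<noteq> 0" using assms by auto
  then show ?thesis by (simp add: avg_def card_PiE assms(1))
qed

lemma avg_Cauchy_Schwarz:
  assumes "\<And>x. x \<in> PiE I (\<lambda>v. {..<len v}) \<Longrightarrow> 0 \<le> a x"
  shows "(avg len I (\<lambda>x. a x * q x))\<^sup>2 \<le> avg len I a * avg len I (\<lambda>x. a x * (q x)\<^sup>2)"
proof -
  let ?X = "PiE I (\<lambda>v. {..<len v})"
  have 1: "(\<Sum>x\<in>?X. a x * q x) = (\<Sum>x\<in>?X. sqrt (a x) * (sqrt (a x) * q x))"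
    using assms by (intro sum.cong refl) (simp add: mult.assoc[symmetric])
  have 2: "(\<Sum>x\<in>?X. a x) = (\<Sum>x\<in>?X. (sqrt (a x))\<^sup>2)"
    using assms by (intro sum.cong refl) simp
  have 3: "(\<Sum>x\<in>?X. a x * (q x)\<^sup>2) = (\<Sum>x\<in>?X. (sqrt (a x) * q x)\<^sup>2)"
    using assms by (intro sum.cong refl) (simp add: power_mult_distrib)
  have "(\<Sum>x\<in>?X. a x * q x)\<^sup>2 \<le> (\<Sum>x\<in>?X. a x) * (\<Sum>x\<in>?X. a x * (q x)\<^sup>2)"
    unfolding 1 2 3 by (rule Cauchy_Schwarz_ineq_sum)
  then show ?thesis
    unfolding avg_def by (simp add: power_divide power2_eq_square divide_right_mono)
qed

text \<open>Bernoulli's inequality at \<open>(q - a) / a\<close>, scaled by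
  \<open>a ^ n\<close>.\<close>

lemma power_tangent:
  fixes a q :: real
  assumes "0 \<le> a" "0 \<le> q"
  shows "a ^ n + real n * a ^ (n - 1) * (q - a) \<le> q ^ n"
proof (cases "a = 0 \<or> n = 0")
  case True
  show ?thesis
  proof (cases "n \<le> 1")
    case True
    then have "n = 0 \<or> n = 1" by auto
    then show ?thesis by auto
  next
    case False
    then have "a = 0" "n \<noteq> 0" "n - 1 \<noteq> 0" using \<open>a = 0 \<or> n = 0\<close> by auto
    then show ?thesis using assms by (simp add: power_0_left)
  qed
next
  case False
  then obtain m where n: "n = Suc m" and a: "a > 0" using assms by (cases n) auto
  have "1 + real n * ((q - a) / a) \<le> (1 + (q - a) / a) ^ n"
    using assms a by (intro Bernoulli_inequality) (auto simp: field_simps)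
  then have "a ^ n * (1 + real n * ((q - a) / a)) \<le> a ^ n * (1 + (q - a) / a) ^ n"
    using a by (intro mult_left_mono) auto
  also have "\<dots> = (a * (1 + (q - a) / a)) ^ n"
    by (rule power_mult_distrib[symmetric])
  also have "a * (1 + (q - a) / a) = q"
    using a by (simp add: field_simps)
  finally have "a ^ n + real n * (a ^ n * ((q - a) / a)) \<le> q ^ n"
    by (simp add: distrib_left mult.left_commute)
  moreover have "a ^ n * ((q - a) / a) = a ^ (n - 1) * (q - a)"
    using a by (simp add: n)
  ultimately show ?thesis by (simp only: mult.assoc)
qed

text \<open>Jensen's inequality: the power lies above its tangent at the mean, whose linear term
  averages to zero.\<close>

lemma avg_power_ge:
  assumes I: "finite I" "\<And>v. v \<in> I \<Longrightarrow> len v > 0"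
    and q: "\<And>x. 0 \<le> q x"
  shows "avg len I q ^ n \<le> avg len I (\<lambda>x. q x ^ n)"
proof -
  let ?a = "avg len I q"
  have a: "0 \<le> ?a" by (rule avg_nonneg) (rule q)
  have "?a ^ n = avg len I (\<lambda>x. ?a ^ n + real n * ?a ^ (n - 1) * (q x - ?a))"
    by (simp add: avg_add avg_cmult avg_diff avg_const[OF I])
  also have "\<dots> \<le> avg len I (\<lambda>x. q x ^ n)"
    by (intro avg_mono power_tangent a q)
  finally show ?thesis .
qed

text \<open>The side lengths are exchanged one coordinate at a time.\<close>

lemma avg_hybrid:
  assumes "finite I" "\<delta> \<ge> 0" "\<And>v. v \<in> I \<Longrightarrow> len v > 0 \<and> len' v > 0"
    and "\<And>v x. v \<in> I \<Longrightarrow> \<bar>avg1 (len v) v f x - avg1 (len' v) v f x\<bar> \<le> \<delta>"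
  shows "\<bar>avg len I f - avg len' I f\<bar> \<le> real (card I) * \<delta>"
  using assms
proof (induction I arbitrary: f rule: finite_induct)
  case empty
  then show ?case by simp
next
  case (insert v I)
  have pos: "len u > 0" "len' u > 0" if "u \<in> insert v I" for u
    using insert.prems(2)[OF that] by auto
  have step: "\<bar>avg1 (len u) u (avg1 (len' v) v f) x - avg1 (len' u) u (avg1 (len' v) v f) x\<bar> \<le> \<delta>"
    if u: "u \<in> I" for u x
  proof -
    have ne: "u \<noteq> v" using u insert.hyps by auto
    have sw: "avg1 l u (avg1 (len' v) v f) x = (\<Sum>t<len' v. avg1 l u f (x(v := t))) / len' v" for l
      using ne unfolding avg1_def sum_divide_distrib
      by (subst sum.swap) (simp add: fun_upd_twist mult.commute)
    have "\<bar>avg1 (len u) u (avg1 (len' v) v f) x - avg1 (len' u) u (avg1 (len' v) v f) x\<bar>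
      = \<bar>(\<Sum>t<len' v. avg1 (len u) u f (x(v := t)) - avg1 (len' u) u f (x(v := t)))\<bar> / len' v"
      unfolding sw by (simp add: diff_divide_distrib[symmetric] sum_subtractf)
    also have "\<dots> \<le> (\<Sum>t<len' v. \<delta>) / len' v"
      using insert.prems(3) u
      by (intro divide_right_mono order.trans[OF sum_abs] sum_mono) auto
    also have "\<dots> = \<delta>" using pos(2)[of v] by simp
    finally show ?thesis .
  qed
  have "\<bar>avg len I (avg1 (len v) v f) - avg len I (avg1 (len' v) v f)\<bar>
     \<le> avg len I (\<lambda>x. \<bar>avg1 (len v) v f x - avg1 (len' v) v f x\<bar>)"
    unfolding avg_diff[symmetric] by (rule avg_abs_le)
  also have "\<dots> \<le> avg len I (\<lambda>_. \<delta>)"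
    using insert.prems(3) by (intro avg_mono) auto
  also have "\<dots> = \<delta>" using insert.hyps pos by (intro avg_const) auto
  finally have 1: "\<bar>avg len I (avg1 (len v) v f) - avg len I (avg1 (len' v) v f)\<bar> \<le> \<delta>" .
  have 2: "\<bar>avg len I (avg1 (len' v) v f) - avg len' I (avg1 (len' v) v f)\<bar> \<le> real (card I) * \<delta>"
    by (rule insert.IH) (use insert.prems step in auto)
  have 3: "avg l (insert v I) f = avg l I (avg1 (l v) v f)" for l
    using insert.hyps by (intro avg_insert) auto
  have 4: "real (card (insert v I)) * \<delta> = \<delta> + real (card I) * \<delta>"
    using insert.hyps by (simp add: distrib_right)
  show ?case unfolding 3 4 using 1 2 by linarith
qed

section \<open>Relative counting in multipartite hypergraphs\<close>

text \<open>Cauchy-Schwarz in the coordinate \<open>v\<close>. The square of the average of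
  \<open>Q\<close> over \<open>v\<close> is written with the spare coordinate \<open>v'\<close> as
  the second copy of \<open>v\<close>. The weight \<open>a\<close>, constant in \<open>v\<close>,
  may be replaced by its majorant \<open>b\<close> because it then multiplies a square.\<close>

lemma avg_double:
  assumes I: "finite I" "v \<in> I" "v' \<in> I" "v \<noteq> v'" and len: "len v > 0" "len v' = len v"
    and a: "\<And>x. 0 \<le> a x" "\<And>x. a x \<le> b x"
    and a_indep: "\<And>x t. a (x(v := t)) = a x" 
    and b_indep: "\<And>x t. b (x(v := t)) = b x" "\<And>x t. b (x(v' := t)) = b x"
    and Q_indep: "\<And>x t. Q (x(v' := t)) = Q x"
    and c: "avg len I b \<le> c"
  shows "(avg len I (\<lambda>x. a x * Q x))\<^sup>2 \<le>
    c * avg len I (\<lambda>x. b x * (Q x * Q (x(v := x v'))))"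
proof -
  define q where "q = avg1 (len v) v Q"
  have q_indep: "q (x(v := t)) = q x" for x t by (simp add: q_def avg1_def)
  have 1: "avg1 (len v) v (\<lambda>x. a x * Q x) = (\<lambda>x. a x * q x)"
    by (simp add: fun_eq_iff avg1_def q_def a_indep flip: sum_distrib_left)
  have "avg1 (len v) v' (\<lambda>x. b x * (Q x * Q (x(v := x v')))) = (\<lambda>x. b x * (Q x * q x))"
  proof
    fix x
    have "Q ((x(v' := t))(v := t)) = Q (x(v := t))" for t
      using Q_indep[of "x(v := t)" t] I(4) by (simp add: fun_upd_twist)
    then show "avg1 (len v) v' (\<lambda>x. b x * (Q x * Q (x(v := x v')))) x = b x * (Q x * q x)"
      by (simp add: avg1_def q_def b_indep Q_indep flip: sum_distrib_left)
  qed
  moreover have "avg1 (len v) v (\<lambda>x. b x * (Q x * q x)) = (\<lambda>x. b x * (q x)\<^sup>2)"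
  proof
    fix x
    have "avg1 (len v) v (\<lambda>x. b x * (Q x * q x)) x = (\<Sum>t<len v. b x * q x * Q (x(v := t))) / len v"
      unfolding avg1_def by (simp add: b_indep q_indep mult_ac)
    also have "\<dots> = b x * q x * ((\<Sum>t<len v. Q (x(v := t))) / len v)"
      by (simp flip: sum_distrib_left)
    also have "(\<Sum>t<len v. Q (x(v := t))) / len v = q x"
      by (simp add: q_def avg1_def)
    finally show "avg1 (len v) v (\<lambda>x. b x * (Q x * q x)) x = b x * (q x)\<^sup>2"
      by (simp add: power2_eq_square mult_ac)
  qed
  ultimately have 2: "avg len I (\<lambda>x. b x * (Q x * Q (x(v := x v')))) = avg len I (\<lambda>x. b x * (q x)\<^sup>2)"
    using avg_resample[of I v' len "\<lambda>x. b x * (Q x * Q (x(v := x v')))"]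
      avg_resample[of I v len "\<lambda>x. b x * (Q x * q x)"] I len by simp
  have "(avg len I (\<lambda>x. a x * Q x))\<^sup>2 = (avg len I (\<lambda>x. a x * q x))\<^sup>2"
    using avg_resample[of I v len "\<lambda>x. a x * Q x"] I len 1 by simp
  also have "\<dots> \<le> avg len I a * avg len I (\<lambda>x. a x * (q x)\<^sup>2)"
    by (rule avg_Cauchy_Schwarz) (rule a)
  also have "\<dots> \<le> c * avg len I (\<lambda>x. b x * (q x)\<^sup>2)"
  proof (rule mult_mono)
    show "avg len I a \<le> c" using avg_mono[of I len a b] a(2) c by fastforce
    then show "0 \<le> c" using avg_nonneg[of I len a] a(1) by fastforce
  qed (use a in \<open>auto intro!: avg_mono avg_nonneg mult_right_mono mult_nonneg_nonneg\<close>)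
  finally show ?thesis unfolding 2 .
qed

text \<open>The linear form of an edge: \<open>e i\<close> is the vertex chosen in class
  \<open>i\<close>, and \<open>x (i, r)\<close> the number at vertex \<open>r\<close> of that
  class.\<close>

definition psi :: "nat \<Rightarrow> (nat \<Rightarrow> nat) \<Rightarrow> (nat \<times> nat \<Rightarrow> nat) \<Rightarrow> nat" where
  "psi N e x = (\<Sum>i<N. x (i, e i))"

definition edges :: "nat \<Rightarrow> nat \<Rightarrow> (nat \<Rightarrow> nat) set" where
  "edges N R = PiE {..<N} (\<lambda>_. {..<R})"

text \<open>Averages run over \<open>Suc R\<close> vertices per class: the patterns live on the
  vertices below \<open>R\<close>, and \<open>R\<close> is a spare vertex for copies.\<close>

definition verts :: "nat \<Rightarrow> nat \<Rightarrow> (nat \<times> nat) set" where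
  "verts N R = {..<N} \<times> {..<R}"

lemma finite_verts [simp]: "finite (verts N R)"
  by (simp add: verts_def)

lemma finite_edges [simp]: "finite (edges N R)"
  by (simp add: edges_def finite_PiE)

lemma card_edges: "card (edges N R) = R ^ N"
  by (simp add: edges_def card_PiE)

lemma edges_mono: "R \<le> R' \<Longrightarrow> edges N R \<subseteq> edges N R'"
  unfolding edges_def by (intro PiE_mono) auto

lemma edges_lt: "e \<in> edges N R \<Longrightarrow> i < N \<Longrightarrow> e i < R"
  by (auto simp: edges_def)

lemma edges_eqI: "e \<in> edges N R \<Longrightarrow> e' \<in> edges N R' \<Longrightarrow> (\<And>i. i < N \<Longrightarrow> e i = e' i) \<Longrightarrow> e = e'"
  by (auto simp: edges_def intro: PiE_ext)

lemma psi_upd_other: "(i < N \<Longrightarrow> e i \<noteq> r) \<Longrightarrow> psi N e (x((i, r) := t)) = psi N e x"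
  unfolding psi_def by (intro sum.cong) auto

lemma psi_upd_edge: "i < N \<Longrightarrow> psi N (e(i := r)) x = psi N e (x((i, e i) := x (i, r)))"
  unfolding psi_def by (intro sum.cong) auto

lemma prod_minus_one:
  fixes f :: "'a \<Rightarrow> real"
  assumes "finite D"
  shows "(\<Prod>e\<in>D. f e - 1) = (\<Sum>S\<in>Pow D. (-1) ^ card (D - S) * (\<Prod>e\<in>S. f e))"
  using prod_add[OF assms, of f "\<lambda>_. -1"] by (simp add: mult.commute)

section \<open>The Gowers-Cauchy-Schwarz inequality relative to a pseudorandom majorant\<close>

text \<open>\<open>linear_forms\<close> covers every set of edges on \<open>Suc R\<close> vertices
  per class, hence also the doubled configurations that Cauchy-Schwarz produces.\<close>

locale pseudorandom =
  fixes N R L :: nat and \<nu> F :: "nat \<Rightarrow> real" and \<eta> :: real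
  assumes L_pos: "L > 0"
    and F_nonneg: "\<And>y. 0 \<le> F y"
    and F_le: "\<And>y. F y \<le> \<nu> y"
    and \<eta>_le: "\<eta> \<le> 1"
    and linear_forms: "\<And>E. E \<subseteq> edges N (Suc R) \<Longrightarrow>
      \<bar>avg (\<lambda>_. L) (verts N (Suc R)) (\<lambda>x. \<Prod>e\<in>E. \<nu> (psi N e x)) - 1\<bar> \<le> \<eta>"
begin

abbreviation A :: "((nat \<times> nat \<Rightarrow> nat) \<Rightarrow> real) \<Rightarrow> real" where
  "A \<equiv> avg (\<lambda>_. L) (verts N (Suc R))"

lemma \<nu>_nonneg: "0 \<le> \<nu> y"
  using F_nonneg F_le order.trans by blast

lemma \<eta>_nonneg: "0 \<le> \<eta>"
  using linear_forms[of "{}"] by simp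

lemma A_nu_le: "E \<subseteq> edges N (Suc R) \<Longrightarrow> A (\<lambda>x. \<Prod>e\<in>E. \<nu> (psi N e x)) \<le> 2"
  using linear_forms[of E] \<eta>_le by linarith

text \<open>Expanding the product over \<open>D\<close> gives correlations of \<open>\<nu>\<close>
  whose signs cancel because \<open>D\<close> is nonempty. Each correlation may therefore be
  diminished by \<open>1\<close>, which leaves \<open>2 ^ card D\<close> errors of at most
  \<open>\<eta>\<close>.\<close>

lemma balanced_bound:
  assumes D: "D \<subseteq> edges N (Suc R)" "D \<noteq> {}" and B: "B \<subseteq> edges N (Suc R)" "D \<inter> B = {}"
  shows "\<bar>A (\<lambda>x. (\<Prod>e\<in>D. \<nu> (psi N e x) - 1) * (\<Prod>e\<in>B. \<nu> (psi N e x)))\<bar> \<le> 2 ^ card D * \<eta>"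
proof -
  have fin: "finite D" "finite B"
    using D(1) B(1) finite_subset[OF _ finite_edges] by blast+
  let ?s = "\<lambda>S. (-1) ^ card (D - S) :: real"
  let ?E = "\<lambda>S. A (\<lambda>x. \<Prod>e\<in>S \<union> B. \<nu> (psi N e x))"
  have prod_Un: "(\<Prod>e\<in>S. \<nu> (psi N e x)) * (\<Prod>e\<in>B. \<nu> (psi N e x)) = (\<Prod>e\<in>S \<union> B. \<nu> (psi N e x))"
    if "S \<subseteq> D" for S x
    using that fin B(2) by (subst prod.union_disjoint) (auto intro: finite_subset)
  have "A (\<lambda>x. (\<Prod>e\<in>D. \<nu> (psi N e x) - 1) * (\<Prod>e\<in>B. \<nu> (psi N e x)))
      = A (\<lambda>x. \<Sum>S\<in>Pow D. ?s S * (\<Prod>e\<in>S \<union> B. \<nu> (psi N e x)))"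
    unfolding prod_minus_one[OF fin(1)] sum_distrib_right
    by (intro avg_cong sum.cong refl) (simp add: mult.assoc prod_Un)
  also have "\<dots> = (\<Sum>S\<in>Pow D. ?s S * ?E S)"
    by (simp add: avg_sum avg_cmult)
  finally have 1: "A (\<lambda>x. (\<Prod>e\<in>D. \<nu> (psi N e x) - 1) * (\<Prod>e\<in>B. \<nu> (psi N e x))) = (\<Sum>S\<in>Pow D. ?s S * ?E S)" .
  have "(\<Sum>S\<in>Pow D. ?s S) = 0"
    using prod_minus_one[OF fin(1), of "\<lambda>_. 1"] D(2) fin(1) by (simp add: card_eq_0_iff power_0_left)
  then have 2: "(\<Sum>S\<in>Pow D. ?s S * ?E S) = (\<Sum>S\<in>Pow D. ?s S * (?E S - 1))"
    by (simp add: right_diff_distrib sum_subtractf)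
  have "\<bar>\<Sum>S\<in>Pow D. ?s S * (?E S - 1)\<bar> \<le> (\<Sum>S\<in>Pow D. \<eta>)"
    using linear_forms D(1) B(1)
    by (intro order.trans[OF sum_abs] sum_mono) (auto simp: abs_mult)
  also have "\<dots> = 2 ^ card D * \<eta>"
    using fin by (simp add: card_Pow)
  finally show ?thesis unfolding 1 2 .
qed

text \<open>One use of Cauchy-Schwarz at the vertex \<open>(i, e0 i)\<close> with
  \<open>(i, R)\<close> as its copy. Edges through the vertex are doubled. Edges avoiding it form
  the weight in front of the square, where \<open>F\<close> is replaced by \<open>\<nu>\<close>; so
  \<open>F\<close> survives only on edges that agree with \<open>e0\<close> in class
  \<open>i\<close>.\<close>

lemma von_Neumann_step:
  assumes i: "i < N" and e0: "e0 \<in> edges N R"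
    and sub: "D \<union> B \<union> G \<subseteq> edges N (Suc R)"
    and disj: "D \<inter> B = {}" "D \<inter> G = {}" "B \<inter> G = {}"
    and D: "\<And>e. e \<in> D \<Longrightarrow> e i = e0 i"
    and fresh: "\<And>e. e \<in> D \<union> B \<union> G \<Longrightarrow> e i < R"
  defines "dup \<equiv> (\<lambda>e :: nat \<Rightarrow> nat. e(i := R))"
  defines "B1 \<equiv> {e \<in> B. e i = e0 i}" and "G1 \<equiv> {e \<in> G. e i = e0 i}"
  shows "(A (\<lambda>x. (\<Prod>e\<in>D. \<nu> (psi N e x) - 1) * (\<Prod>e\<in>B. \<nu> (psi N e x)) * (\<Prod>e\<in>G. F (psi N e x))))\<^sup>2
    \<le> 2 * A (\<lambda>x. (\<Prod>e\<in>D \<union> dup ` D. \<nu> (psi N e x) - 1) *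
         (\<Prod>e\<in>B \<union> (G - G1) \<union> dup ` B1. \<nu> (psi N e x)) * (\<Prod>e\<in>G1 \<union> dup ` G1. F (psi N e x)))"
proof -
  have fin: "finite D" "finite B" "finite G"
    using sub finite_subset[OF _ finite_edges] by (metis Un_subset_iff)+
  have fin1: "finite B1" "finite G1" using fin by (simp_all add: B1_def G1_def)
  let ?v = "(i, e0 i)" and ?v' = "(i, R)"
  define B0 where "B0 = B - B1"
  define G0 where "G0 = G - G1"
  define a where "a x = (\<Prod>e\<in>B0. \<nu> (psi N e x)) * (\<Prod>e\<in>G0. F (psi N e x))" for x
  define b where "b x = (\<Prod>e\<in>B0 \<union> G0. \<nu> (psi N e x))" for x
  define Q where "Q x = (\<Prod>e\<in>D. \<nu> (psi N e x) - 1) * (\<Prod>e\<in>B1. \<nu> (psi N e x)) * (\<Prod>e\<in>G1. F (psi N e x))" for x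
  have b_eq: "b x = (\<Prod>e\<in>B0. \<nu> (psi N e x)) * (\<Prod>e\<in>G0. \<nu> (psi N e x))" for x
    unfolding b_def B0_def G0_def using fin disj by (subst prod.union_disjoint) auto
  have ne: "?v \<noteq> ?v'" using edges_lt[OF e0 i] by simp
  have v0: "psi N e (x(?v := t)) = psi N e x" if "e \<in> B0 \<union> G0" for e x t
    using that by (intro psi_upd_other) (auto simp: B0_def B1_def G0_def G1_def)
  have v'0: "psi N e (x(?v' := t)) = psi N e x" if "e \<in> D \<union> B \<union> G" for e x t
    using fresh[OF that] by (intro psi_upd_other) auto
  have dup_psi: "psi N (dup e) x = psi N e (x(?v := x ?v'))" if "e i = e0 i" for e x
    using psi_upd_edge[OF i, of e R x] that by (simp add: dup_def)
  have inj: "inj_on dup S" if "\<And>e. e \<in> S \<Longrightarrow> e i = e0 i" for S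
  proof (rule inj_onI)
    fix e e' assume *: "e \<in> S" "e' \<in> S" "dup e = dup e'"
    show "e = e'"
    proof
      fix j show "e j = e' j"
        using fun_cong[OF *(3), of j] that[OF *(1)] that[OF *(2)] by (cases "j = i") (auto simp: dup_def)
    qed
  qed
  have dupR: "dup e i = R" for e by (simp add: dup_def)
  have no_dup: "S \<inter> dup ` T = {}" if "S \<subseteq> D \<union> B \<union> G" for S T
    using fresh that dupR by fastforce
  have split: "(\<Prod>e\<in>S \<union> dup ` S. h (psi N e x)) = (\<Prod>e\<in>S. h (psi N e x)) * (\<Prod>e\<in>S. h (psi N e (x(?v := x ?v'))))"
    if S: "S \<subseteq> D \<union> B \<union> G" "\<And>e. e \<in> S \<Longrightarrow> e i = e0 i" "finite S" for S and h :: "nat \<Rightarrow> real" and x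
  proof -
    have "(\<Prod>e\<in>S \<union> dup ` S. h (psi N e x)) = (\<Prod>e\<in>S. h (psi N e x)) * (\<Prod>e\<in>dup ` S. h (psi N e x))"
      using S no_dup[of S S] by (intro prod.union_disjoint) auto
    also have "(\<Prod>e\<in>dup ` S. h (psi N e x)) = (\<Prod>e\<in>S. h (psi N (dup e) x))"
      using inj[of S] S(2) by (simp add: prod.reindex o_def)
    also have "\<dots> = (\<Prod>e\<in>S. h (psi N e (x(?v := x ?v'))))"
      using S(2) by (intro prod.cong refl) (simp add: dup_psi)
    finally show ?thesis .
  qed
  have "(A (\<lambda>x. a x * Q x))\<^sup>2 \<le> 2 * A (\<lambda>x. b x * (Q x * Q (x(?v := x ?v'))))"
  proof (rule avg_double)
    show "?v \<in> verts N (Suc R)" "?v' \<in> verts N (Suc R)"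
      using i edges_lt[OF e0 i] by (auto simp: verts_def)
    show "0 \<le> a x" for x
      unfolding a_def by (intro mult_nonneg_nonneg prod_nonneg) (auto simp: F_nonneg \<nu>_nonneg)
    show "a x \<le> b x" for x
      unfolding a_def b_eq
      by (intro mult_left_mono prod_mono prod_nonneg) (auto simp: F_nonneg \<nu>_nonneg F_le)
    show "a (x(?v := t)) = a x" for x t
      unfolding a_def by (simp add: v0)
    show "b (x(?v := t)) = b x" for x t
      unfolding b_def by (simp add: v0)
    show "b (x(?v' := t)) = b x" for x t
      unfolding b_def by (intro prod.cong refl arg_cong[where f = \<nu>] v'0) (auto simp: B0_def G0_def)
    show "Q (x(?v' := t)) = Q x" for x t
      unfolding Q_def
      by (intro arg_cong2[where f = "(*)"] prod.cong refl arg_cong[where f = \<nu>] arg_cong[where f = F]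
          arg_cong2[where f = "(-)"] v'0) (auto simp: B1_def G1_def)
    show "A b \<le> 2"
      unfolding b_def by (rule A_nu_le) (use sub in \<open>auto simp: B0_def G0_def\<close>)
  qed (use ne L_pos in auto)
  also have "(\<lambda>x. a x * Q x) = (\<lambda>x. (\<Prod>e\<in>D. \<nu> (psi N e x) - 1) * (\<Prod>e\<in>B. \<nu> (psi N e x)) * (\<Prod>e\<in>G. F (psi N e x)))"
  proof
    fix x
    have "(\<Prod>e\<in>B. \<nu> (psi N e x)) = (\<Prod>e\<in>B0. \<nu> (psi N e x)) * (\<Prod>e\<in>B1. \<nu> (psi N e x))"
      unfolding B0_def using fin by (intro prod.subset_diff) (auto simp: B1_def)
    moreover have "(\<Prod>e\<in>G. F (psi N e x)) = (\<Prod>e\<in>G0. F (psi N e x)) * (\<Prod>e\<in>G1. F (psi N e x))"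
      unfolding G0_def using fin by (intro prod.subset_diff) (auto simp: G1_def)
    ultimately show "a x * Q x = (\<Prod>e\<in>D. \<nu> (psi N e x) - 1) * (\<Prod>e\<in>B. \<nu> (psi N e x)) * (\<Prod>e\<in>G. F (psi N e x))"
      by (simp add: a_def Q_def mult_ac)
  qed
  also have "(\<lambda>x. b x * (Q x * Q (x(?v := x ?v')))) = (\<lambda>x. (\<Prod>e\<in>D \<union> dup ` D. \<nu> (psi N e x) - 1) *
         (\<Prod>e\<in>B \<union> (G - G1) \<union> dup ` B1. \<nu> (psi N e x)) * (\<Prod>e\<in>G1 \<union> dup ` G1. F (psi N e x)))"
  proof
    fix x
    have 1: "(\<Prod>e\<in>D \<union> dup ` D. \<nu> (psi N e x) - 1) = (\<Prod>e\<in>D. \<nu> (psi N e x) - 1) * (\<Prod>e\<in>D. \<nu> (psi N e (x(?v := x ?v'))) - 1)"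
      by (rule split[where h = "\<lambda>y. \<nu> y - 1"]) (use D fin in auto)
    have 2: "(\<Prod>e\<in>G1 \<union> dup ` G1. F (psi N e x)) = (\<Prod>e\<in>G1. F (psi N e x)) * (\<Prod>e\<in>G1. F (psi N e (x(?v := x ?v'))))"
      by (rule split[where h = F]) (use fin1 in \<open>auto simp: G1_def\<close>)
    have 3: "(\<Prod>e\<in>B1 \<union> dup ` B1. \<nu> (psi N e x)) = (\<Prod>e\<in>B1. \<nu> (psi N e x)) * (\<Prod>e\<in>B1. \<nu> (psi N e (x(?v := x ?v'))))"
      by (rule split[where h = \<nu>]) (use fin1 in \<open>auto simp: B1_def\<close>)
    have "B \<union> (G - G1) \<union> dup ` B1 = (B0 \<union> G0) \<union> (B1 \<union> dup ` B1)"
      by (auto simp: B0_def G0_def B1_def)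
    moreover have "(B0 \<union> G0) \<inter> (B1 \<union> dup ` B1) = {}"
    proof -
      have "(B0 \<union> G0) \<inter> dup ` B1 = {}"
        by (rule no_dup) (auto simp: B0_def G0_def)
      moreover have "(B0 \<union> G0) \<inter> B1 = {}"
        using disj by (auto simp: B0_def G0_def B1_def)
      ultimately show ?thesis by blast
    qed
    moreover have "finite (B0 \<union> G0)" "finite (B1 \<union> dup ` B1)"
      using fin fin1 by (auto simp: B0_def G0_def)
    ultimately have 4: "(\<Prod>e\<in>B \<union> (G - G1) \<union> dup ` B1. \<nu> (psi N e x)) = b x * (\<Prod>e\<in>B1 \<union> dup ` B1. \<nu> (psi N e x))"
      unfolding b_def by (simp only: prod.union_disjoint)
    show "b x * (Q x * Q (x(?v := x ?v'))) = (\<Prod>e\<in>D \<union> dup ` D. \<nu> (psi N e x) - 1) *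
         (\<Prod>e\<in>B \<union> (G - G1) \<union> dup ` B1. \<nu> (psi N e x)) * (\<Prod>e\<in>G1 \<union> dup ` G1. F (psi N e x))"
      unfolding 1 2 3 4 Q_def by (simp add: mult_ac)
  qed
  finally show ?thesis .
qed

text \<open>The state after the classes below \<open>i\<close> have been treated. Edges of
  \<open>D\<close> still agree with \<open>e0\<close> in the remaining classes, and every edge of
  \<open>G\<close> still differs from it in one of them; so for \<open>i = N\<close> no
  \<open>F\<close> is left and \<open>balanced_bound\<close> applies with \<open>2 ^ N\<close>
  balanced factors. The factor \<open>2 ^ (2 ^ (N - i) - 1)\<close> collects the \<open>2\<close> of
  each remaining step under repeated squaring.\<close>

lemma von_Neumann_iterate:
  assumes e0: "e0 \<in> edges N R" and "i \<le> N"
    and "D \<union> B \<union> G \<subseteq> edges N (Suc R)"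
    and "D \<inter> B = {}" "D \<inter> G = {}" "B \<inter> G = {}"
    and "\<And>e j. e \<in> D \<Longrightarrow> i \<le> j \<Longrightarrow> j < N \<Longrightarrow> e j = e0 j"
    and "\<And>e. e \<in> G \<Longrightarrow> \<exists>j. i \<le> j \<and> j < N \<and> e j \<noteq> e0 j"
    and "\<And>e j. e \<in> D \<union> B \<union> G \<Longrightarrow> i \<le> j \<Longrightarrow> j < N \<Longrightarrow> e j < R"
    and "card D = 2 ^ i"
  shows "\<bar>A (\<lambda>x. (\<Prod>e\<in>D. \<nu> (psi N e x) - 1) * (\<Prod>e\<in>B. \<nu> (psi N e x)) * (\<Prod>e\<in>G. F (psi N e x)))\<bar> ^ 2 ^ (N - i)
    \<le> 2 ^ (2 ^ (N - i) - 1) * (2 ^ 2 ^ N * \<eta>)"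
  using assms(2-)
proof (induction "N - i" arbitrary: i D B G)
  case 0
  then have [simp]: "i = N" by simp
  have [simp]: "G = {}" using "0.prems"(7) by force
  have "D \<noteq> {}" using "0.prems"(9) by auto
  then have "\<bar>A (\<lambda>x. (\<Prod>e\<in>D. \<nu> (psi N e x) - 1) * (\<Prod>e\<in>B. \<nu> (psi N e x)))\<bar> \<le> 2 ^ card D * \<eta>"
    using "0.prems"(2,3) by (intro balanced_bound) auto
  then show ?case using "0.prems"(9) by simp
next
  case (Suc m)
  then have i: "i < N" and m: "m = N - Suc i" by auto
  let ?dup = "\<lambda>e :: nat \<Rightarrow> nat. e(i := R)"
  let ?B1 = "{e \<in> B. e i = e0 i}" and ?G1 = "{e \<in> G. e i = e0 i}"
  let ?D' = "D \<union> ?dup ` D" and ?B' = "B \<union> (G - ?G1) \<union> ?dup ` ?B1" and ?G' = "?G1 \<union> ?dup ` ?G1"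
  let ?T = "A (\<lambda>x. (\<Prod>e\<in>D. \<nu> (psi N e x) - 1) * (\<Prod>e\<in>B. \<nu> (psi N e x)) * (\<Prod>e\<in>G. F (psi N e x)))"
  let ?T' = "A (\<lambda>x. (\<Prod>e\<in>?D'. \<nu> (psi N e x) - 1) * (\<Prod>e\<in>?B'. \<nu> (psi N e x)) * (\<Prod>e\<in>?G'. F (psi N e x)))"
  have Di: "e i = e0 i" if "e \<in> D" for e using Suc.prems(6) i that by auto
  have lt: "e i < R" if "e \<in> D \<union> B \<union> G" for e using Suc.prems(8) i that by auto
  have step: "?T\<^sup>2 \<le> 2 * ?T'"
    by (rule von_Neumann_step[OF i e0]) (use Suc.prems(2-5) Di lt in auto)
  have dup_inj: "e = e'" if "?dup e = ?dup e'" "e i = e0 i" "e' i = e0 i" for e e'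
  proof
    fix j show "e j = e' j" using fun_cong[OF that(1), of j] that(2,3) by (cases "j = i") auto
  qed
  have dup_edges: "?dup e \<in> edges N (Suc R)" if "e \<in> edges N (Suc R)" for e
    using that i by (auto simp: edges_def PiE_iff extensional_def)
  have not_dup: "e \<noteq> ?dup e'" if "e \<in> D \<union> B \<union> G" for e e'
    using lt[OF that] by (metis fun_upd_same less_irrefl)
  have IH: "\<bar>?T'\<bar> ^ 2 ^ (N - Suc i) \<le> 2 ^ (2 ^ (N - Suc i) - 1) * (2 ^ 2 ^ N * \<eta>)"
  proof (rule Suc.hyps(1)[OF m])
    show "?D' \<union> ?B' \<union> ?G' \<subseteq> edges N (Suc R)"
      using Suc.prems(2) dup_edges by auto
    have disj: "(S \<union> ?dup ` S') \<inter> (T \<union> ?dup ` T') = {}"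
      if "S \<subseteq> D \<union> B \<union> G" "T \<subseteq> D \<union> B \<union> G" "S \<inter> T = {}" "S' \<inter> T' = {}"
        "\<And>e. e \<in> S' \<union> T' \<Longrightarrow> e i = e0 i" for S S' T T'
    proof -
      have "S \<inter> ?dup ` T' = {}" "?dup ` S' \<inter> T = {}"
        using not_dup that(1,2) by blast+
      moreover have "?dup ` S' \<inter> ?dup ` T' = {}"
        using dup_inj that(4,5) by blast
      ultimately show ?thesis using that(3) by blast
    qed
    show "?D' \<inter> ?B' = {}"
      by (rule disj) (use Suc.prems(3,4) Di in auto)
    show "?D' \<inter> ?G' = {}"
      by (rule disj) (use Suc.prems(4) Di in auto)
    show "?B' \<inter> ?G' = {}"
      by (rule disj) (use Suc.prems(5) in auto)
    show "e j = e0 j" if "e \<in> ?D'" "Suc i \<le> j" "j < N" for e j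
      using that Suc.prems(6) by auto
    \<comment> \<open>Edges of \<open>?G1\<close> agree with \<open>e0\<close> in class
      \<open>i\<close>, so they differ from it in a later class, which doubling leaves
      alone.\<close>
    show "\<exists>j. Suc i \<le> j \<and> j < N \<and> e j \<noteq> e0 j" if e: "e \<in> ?G'" for e
    proof -
      obtain e' where e': "e' \<in> G" "e' i = e0 i" "e = e' \<or> e = ?dup e'" using e by auto
      then obtain j where "i \<le> j" "j < N" "e' j \<noteq> e0 j" using Suc.prems(7) by blast
      with e' show ?thesis by (intro exI[of _ j]) (cases "j = i", auto)
    qed
    show "e j < R" if "e \<in> ?D' \<union> ?B' \<union> ?G'" "Suc i \<le> j" "j < N" for e j
      using that Suc.prems(8) by auto
    have "finite D" using Suc.prems(9) by (simp add: card_ge_0_finite)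
    moreover have "inj_on ?dup D" using dup_inj Di by (auto intro: inj_onI)
    moreover have "D \<inter> ?dup ` D = {}" using not_dup by blast
    ultimately show "card ?D' = 2 ^ Suc i"
      using Suc.prems(9) by (simp add: card_Un_disjoint card_image)
  qed (use i in auto)
  have Ni: "(2::nat) ^ (N - i) = 2 * 2 ^ (N - Suc i)"
    using i by (metis Suc_diff_Suc power_Suc)
  have "\<bar>?T\<bar> ^ 2 ^ (N - i) = (\<bar>?T\<bar>\<^sup>2) ^ 2 ^ (N - Suc i)"
    unfolding Ni by (rule power_mult)
  also have "\<bar>?T\<bar>\<^sup>2 = ?T\<^sup>2"
    by (rule power2_abs)
  also have "(?T\<^sup>2) ^ 2 ^ (N - Suc i) \<le> (2 * \<bar>?T'\<bar>) ^ 2 ^ (N - Suc i)"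
    using step by (intro power_mono) auto
  also have "\<dots> = 2 ^ 2 ^ (N - Suc i) * \<bar>?T'\<bar> ^ 2 ^ (N - Suc i)"
    by (simp add: power_mult_distrib)
  also have "\<dots> \<le> 2 ^ 2 ^ (N - Suc i) * (2 ^ (2 ^ (N - Suc i) - 1) * (2 ^ 2 ^ N * \<eta>))"
    using IH by (intro mult_left_mono) auto
  also have "\<dots> = 2 ^ (2 ^ (N - i) - 1) * (2 ^ 2 ^ N * \<eta>)"
  proof -
    define q where "q = (2::nat) ^ (N - Suc i)"
    have q: "(2::nat) ^ (N - i) = 2 * q" "q \<ge> 1"
      by (simp_all add: q_def Ni)
    have "(2::real) ^ (2 * q - 1) = 2 ^ q * 2 ^ (q - 1)"
      using q(2) by (simp flip: power_add)
    then show ?thesis unfolding q_def[symmetric] q(1) by simp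
  qed
  finally show ?case .
qed

text \<open>The start \<open>i = 0\<close> with \<open>D = {e0}\<close>: every edge of
  \<open>H\<close> differs from \<open>e0\<close> in some class, so all factors \<open>F\<close> get
  eliminated. The bound depends on \<open>F\<close> only through \<open>\<nu>\<close>.\<close>

lemma von_Neumann:
  assumes e0: "e0 \<in> edges N R" "e0 \<notin> H" "e0 \<notin> B"
    and sub: "H \<subseteq> edges N R" "B \<subseteq> edges N R" and disj: "B \<inter> H = {}"
  shows "\<bar>A (\<lambda>x. (\<nu> (psi N e0 x) - 1) * (\<Prod>e\<in>B. \<nu> (psi N e x)) * (\<Prod>e\<in>H. F (psi N e x)))\<bar> ^ 2 ^ N
    \<le> 4 ^ 2 ^ N * \<eta>"
proof -
  have mono: "edges N R \<subseteq> edges N (Suc R)" by (rule edges_mono) simp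
  have "\<bar>A (\<lambda>x. (\<Prod>e\<in>{e0}. \<nu> (psi N e x) - 1) * (\<Prod>e\<in>B. \<nu> (psi N e x)) * (\<Prod>e\<in>H. F (psi N e x)))\<bar> ^ 2 ^ (N - 0)
    \<le> 2 ^ (2 ^ (N - 0) - 1) * (2 ^ 2 ^ N * \<eta>)"
  proof (rule von_Neumann_iterate[OF e0(1)])
    show "{e0} \<union> B \<union> H \<subseteq> edges N (Suc R)" using e0 sub mono by auto
    show "\<exists>j\<ge>0. j < N \<and> e j \<noteq> e0 j" if "e \<in> H" for e
      using edges_eqI[of e N R e0 R] e0 sub that by blast
    show "e j < R" if "e \<in> {e0} \<union> B \<union> H" "j < N" for e j
      using that e0 sub by (auto intro: edges_lt)
  qed (use e0 disj in auto)
  also have "\<dots> \<le> 2 ^ 2 ^ N * (2 ^ 2 ^ N * \<eta>)"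
    using \<eta>_nonneg by (intro mult_right_mono power_increasing) auto
  also have "\<dots> = 4 ^ 2 ^ N * \<eta>"
    using power_mult_distrib[of "2::real" 2 "2 ^ N"] by simp
  finally show ?thesis by simp
qed

end

section \<open>Convexity: the weight of complete hypergraphs\<close>

text \<open>The coordinates \<open>u r\<close>, on which \<open>Q\<close> does not depend, act as
  independent copies of \<open>v\<close>. Averaging them out one by one turns each factor into the
  average \<open>q\<close> of \<open>Q\<close> over \<open>v\<close>, and convexity compares the
  mean of \<open>q ^ R\<close> with the power of the mean.\<close>

lemma avg_blowup:
  assumes I: "finite I" "v \<in> I" and len: "\<And>w. w \<in> I \<Longrightarrow> len w = L" "L > 0"
    and u: "\<And>r. r < R \<Longrightarrow> u r \<in> I" "inj_on u {..<R}" "\<And>r. r < R \<Longrightarrow> u r \<noteq> v"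
    and Q: "\<And>x. 0 \<le> Q x" "\<And>x r t. r < R \<Longrightarrow> Q (x(u r := t)) = Q x"
  shows "avg len I Q ^ R \<le> avg len I (\<lambda>x. \<Prod>r<R. Q (x(v := x (u r))))"
proof -
  define q where "q = avg1 L v Q"
  have q_nonneg: "0 \<le> q x" for x
    unfolding q_def avg1_def by (intro divide_nonneg_nonneg sum_nonneg Q(1)) auto
  have q_indep: "q (x(u r := t)) = q x" if "r < R" for x r t
    unfolding q_def avg1_def using Q(2)[OF that] u(3)[OF that] by (simp add: fun_upd_twist)
  have peel: "avg len I (\<lambda>x. (\<Prod>r<m. Q (x(v := x (u r)))) * q x ^ s) = avg len I (\<lambda>x. q x ^ (m + s))"
    if "m \<le> R" for m s
    using that
  proof (induction m arbitrary: s)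
    case 0
    then show ?case by simp
  next
    case (Suc m)
    then have m: "m < R" by simp
    let ?f = "\<lambda>x. (\<Prod>r<Suc m. Q (x(v := x (u r)))) * q x ^ s"
    have "avg1 L (u m) ?f = (\<lambda>x. (\<Prod>r<m. Q (x(v := x (u r)))) * q x ^ Suc s)"
    proof
      fix x
      have "Q ((x(u m := t))(v := (x(u m := t)) (u r))) = Q (x(v := x (u r)))" if "r < m" for r t
      proof -
        have "u r \<noteq> u m" using u(2) that m by (auto dest!: inj_onD)
        then show ?thesis using Q(2)[OF m, of "x(v := x (u r))" t] u(3)[OF m]
          by (simp add: fun_upd_twist)
      qed
      then have "(\<Prod>r<m. Q ((x(u m := t))(v := (x(u m := t)) (u r)))) = (\<Prod>r<m. Q (x(v := x (u r))))" for t
        by (intro prod.cong) auto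
      moreover have "Q ((x(u m := t))(v := (x(u m := t)) (u m))) = Q (x(v := t))" for t
        using Q(2)[OF m, of "x(v := t)" t] u(3)[OF m] by (simp add: fun_upd_twist)
      ultimately have f: "?f (x(u m := t)) = (\<Prod>r<m. Q (x(v := x (u r)))) * q x ^ s * Q (x(v := t))" for t
        by (simp only: prod.lessThan_Suc q_indep[OF m] mult_ac)
      have "avg1 L (u m) ?f x = (\<Prod>r<m. Q (x(v := x (u r)))) * q x ^ s * ((\<Sum>t<L. Q (x(v := t))) / L)"
        unfolding avg1_def f by (simp flip: sum_distrib_left)
      also have "(\<Sum>t<L. Q (x(v := t))) / L = q x"
        by (simp add: q_def avg1_def)
      finally show "avg1 L (u m) ?f x = (\<Prod>r<m. Q (x(v := x (u r)))) * q x ^ Suc s"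
        by (simp only: power_Suc mult_ac)
    qed
    then have "avg len I ?f = avg len I (\<lambda>x. (\<Prod>r<m. Q (x(v := x (u r)))) * q x ^ Suc s)"
      using avg_resample[of I "u m" len ?f] I u(1)[OF m] len by simp
    also have "\<dots> = avg len I (\<lambda>x. q x ^ (m + Suc s))"
      by (rule Suc.IH) (use Suc.prems in simp)
    finally show ?case by (simp only: add_Suc_right add_Suc)
  qed
  have "avg len I Q = avg len I q"
    using avg_resample[of I v len Q] I len by (simp add: q_def)
  then have "avg len I Q ^ R \<le> avg len I (\<lambda>x. q x ^ R)"
    using avg_power_ge[of I len q R] I len q_nonneg by simp
  then show ?thesis
    using peel[of R 0] by (simp only: power_0 mult_1_right add_0_right order_refl)
qed

context pseudorandom
begin

text \<open>The single edge through the spare vertices is blown up class by class. In class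
  \<open>i\<close> the vertex \<open>R\<close> is replaced by all \<open>R\<close> vertices below
  it, which raises the lower bound to the power \<open>R\<close> each time.\<close>

lemma box_lower_bound:
  assumes \<sigma>: "0 \<le> \<sigma>" "\<sigma> \<le> A (\<lambda>x. F (psi N (\<lambda>j\<in>{..<N}. R) x))"
  shows "\<sigma> ^ (R ^ N) \<le> A (\<lambda>x. \<Prod>e\<in>edges N R. F (psi N e x))"
proof -
  define K where "K i = PiE {..<N} (\<lambda>j. if j < i then {..<R} else {R})" for i
  have "\<sigma> ^ (R ^ i) \<le> A (\<lambda>x. \<Prod>e\<in>K i. F (psi N e x))" if "i \<le> N" for i
    using that
  proof (induction i)
    case 0
    have "K 0 = {\<lambda>j\<in>{..<N}. R}" by (simp add: K_def PiE_singleton flip: PiE_over_singleton_iff)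
    then show ?case using \<sigma> by (simp del: restrict_apply)
  next
    case (Suc i)
    then have i: "i < N" by simp
    let ?Q = "\<lambda>x. \<Prod>e\<in>K i. F (psi N e x)"
    have Ki: "e i = R" if "e \<in> K i" for e
      using PiE_mem[OF that[unfolded K_def], of i] i by auto
    have bij: "bij_betw (\<lambda>(r, e). e(i := r)) ({..<R} \<times> K i) (K (Suc i))"
    proof (rule bij_betw_byWitness[where f' = "\<lambda>e. (e i, e(i := R))"])
      have KI: "e \<in> K m \<longleftrightarrow> (\<forall>j<N. if j < m then e j < R else e j = R) \<and> (\<forall>j. \<not> j < N \<longrightarrow> e j = undefined)" for e m
        unfolding K_def PiE_iff extensional_def by force
      show "\<forall>a\<in>{..<R} \<times> K i. (\<lambda>e. (e i, e(i := R))) (case a of (r, e) \<Rightarrow> e(i := r)) = a"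
      proof (clarsimp)
        fix e assume "e \<in> K i"
        then show "e(i := R) = e" using Ki[of e] by (metis fun_upd_triv)
      qed
      show "(\<lambda>(r, e). e(i := r)) ` ({..<R} \<times> K i) \<subseteq> K (Suc i)"
      proof clarsimp
        fix r e assume "r < R" "e \<in> K i"
        then show "e(i := r) \<in> K (Suc i)" using i unfolding KI by (simp add: less_Suc_eq)
      qed
      show "(\<lambda>e. (e i, e(i := R))) ` K (Suc i) \<subseteq> {..<R} \<times> K i"
      proof clarsimp
        fix e assume e: "e \<in> K (Suc i)"
        then have "e i < R" using i unfolding KI by (metis lessI)
        moreover have "e(i := R) \<in> K i" using e i unfolding KI by (simp add: less_Suc_eq)
        ultimately show "e i < R \<and> e(i := R) \<in> K i" ..
      qed
      show "\<forall>a\<in>K (Suc i). (case (a i, a(i := R)) of (r, e) \<Rightarrow> e(i := r)) = a" by simp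
    qed
    have "\<sigma> ^ R ^ Suc i = (\<sigma> ^ R ^ i) ^ R"
      by (simp add: mult.commute flip: power_mult)
    also have "\<dots> \<le> A ?Q ^ R"
      using Suc \<sigma> by (intro power_mono) auto
    also have "\<dots> \<le> A (\<lambda>x. \<Prod>r<R. ?Q (x((i, R) := x (i, r))))"
    proof (rule avg_blowup[where L = L])
      show "?Q (x((i, r) := t)) = ?Q x" if "r < R" for x r t
        using that Ki by (intro prod.cong refl arg_cong[where f = F] psi_upd_other) auto
    qed (use i L_pos in \<open>auto simp: verts_def intro!: prod_nonneg F_nonneg inj_onI\<close>)
    also have "(\<lambda>x. \<Prod>r<R. ?Q (x((i, R) := x (i, r)))) = (\<lambda>x. \<Prod>e\<in>K (Suc i). F (psi N e x))"
    proof
      fix x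
      have "(\<Prod>e\<in>K (Suc i). F (psi N e x)) = (\<Prod>a\<in>{..<R} \<times> K i. F (psi N ((\<lambda>(r, e). e(i := r)) a) x))"
        by (rule prod.reindex_bij_betw[OF bij, symmetric])
      also have "\<dots> = (\<Prod>(r, e)\<in>{..<R} \<times> K i. F (psi N e (x((i, R) := x (i, r)))))"
        using psi_upd_edge[OF i] Ki by (intro prod.cong refl) auto
      also have "\<dots> = (\<Prod>r<R. ?Q (x((i, R) := x (i, r))))"
        by (rule prod.cartesian_product[symmetric])
      finally show "(\<Prod>r<R. ?Q (x((i, R) := x (i, r)))) = (\<Prod>e\<in>K (Suc i). F (psi N e x))" ..
    qed
    finally show ?case .
  qed
  moreover have "K N = edges N R"
    unfolding K_def edges_def by (intro PiE_cong) auto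
  ultimately show ?thesis by (metis order_refl)
qed

section \<open>Realising a prescribed hypergraph\<close>

text \<open>The factors \<open>\<nu>\<close> outside \<open>H\<close> are exchanged for
  \<open>1\<close> one at a time. Each difference carries \<open>\<nu> - 1\<close> at a single edge,
  so \<open>von_Neumann\<close> bounds it by \<open>\<tau>\<close>.\<close>

lemma replace_edges:
  assumes \<tau>: "0 \<le> \<tau>" "4 ^ 2 ^ N * \<eta> \<le> \<tau> ^ 2 ^ N"
    and H: "H \<subseteq> edges N R" and B: "B \<subseteq> edges N R - H"
  shows "A (\<lambda>x. (\<Prod>e\<in>B. \<nu> (psi N e x)) * (\<Prod>e\<in>H. F (psi N e x)))
    \<le> A (\<lambda>x. \<Prod>e\<in>H. F (psi N e x)) + real (card B) * \<tau>"
proof -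
  have "finite B" using B finite_subset[OF _ finite_edges] by blast
  then show ?thesis using B
  proof (induction B rule: finite_induct)
    case empty
    then show ?case by simp
  next
    case (insert e0 B)
    let ?f = "\<lambda>x. (\<Prod>e\<in>B. \<nu> (psi N e x)) * (\<Prod>e\<in>H. F (psi N e x))"
    let ?T = "A (\<lambda>x. (\<nu> (psi N e0 x) - 1) * (\<Prod>e\<in>B. \<nu> (psi N e x)) * (\<Prod>e\<in>H. F (psi N e x)))"
    have "\<bar>?T\<bar> ^ 2 ^ N \<le> 4 ^ 2 ^ N * \<eta>"
      by (rule von_Neumann) (use insert.prems insert.hyps H in auto)
    also note \<tau>(2)
    finally have "\<bar>?T\<bar> ^ 2 ^ N \<le> \<tau> ^ 2 ^ N" .
    then have "\<bar>?T\<bar> \<le> \<tau>"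
      by (rule power_mono_iff[THEN iffD1, rotated 3]) (use \<tau>(1) in auto)
    moreover have "A (\<lambda>x. (\<Prod>e\<in>insert e0 B. \<nu> (psi N e x)) * (\<Prod>e\<in>H. F (psi N e x))) = A ?f + ?T"
      unfolding avg_add[symmetric] using insert.hyps
      by (intro avg_cong) (simp add: algebra_simps)
    ultimately show ?case
      using insert by (simp add: distrib_right)
  qed
qed

text \<open>If every copy of \<open>H\<close> had a further edge satisfying \<open>P\<close>, then
  inserting \<open>F\<close> at that edge, where it equals \<open>1 / \<rho>\<close>, would bound
  the weight of \<open>H\<close> by \<open>\<rho>\<close> times correlations on one more edge, each
  at most \<open>2\<close>. This contradicts the lower bound left after the replacement.\<close>

lemma exists_pattern:
  assumes \<sigma>: "0 \<le> \<sigma>" "\<sigma> \<le> A (\<lambda>x. F (psi N (\<lambda>j\<in>{..<N}. R) x))"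
    and \<tau>: "0 \<le> \<tau>" "4 ^ 2 ^ N * \<eta> \<le> \<tau> ^ 2 ^ N"
    and \<rho>: "0 < \<rho>" "\<And>y. F y = of_bool (P y) / \<rho>"
    and gap: "real (R ^ N) * \<tau> + 2 * real (R ^ N) * \<rho> < \<sigma> ^ (R ^ N)"
    and H: "H \<subseteq> edges N R"
  shows "\<exists>x. \<forall>e\<in>edges N R. P (psi N e x) \<longleftrightarrow> e \<in> H"
proof (rule ccontr)
  assume none: "\<nexists>x. \<forall>e\<in>edges N R. P (psi N e x) \<longleftrightarrow> e \<in> H"
  have fin: "finite H" using H finite_subset[OF _ finite_edges] by blast
  let ?B = "edges N R - H"
  let ?FH = "\<lambda>x. \<Prod>e\<in>H. F (psi N e x)"
  have mono: "edges N R \<subseteq> edges N (Suc R)" by (rule edges_mono) simp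
  have cardB: "card ?B \<le> R ^ N"
    using card_mono[of "edges N R" ?B] by (simp add: card_edges)
  have "?FH x \<le> \<rho> * (\<Sum>e\<in>?B. F (psi N e x) * ?FH x)" for x
  proof (cases "\<forall>e\<in>H. P (psi N e x)")
    case True
    then obtain e0 where e0: "e0 \<in> ?B" "P (psi N e0 x)" using none H by blast
    have "?FH x = \<rho> * (F (psi N e0 x) * ?FH x)" using e0 \<rho> by simp
    also have "\<dots> \<le> \<rho> * (\<Sum>e\<in>?B. F (psi N e x) * ?FH x)"
      using e0 \<rho>(1) F_nonneg
      by (intro mult_left_mono member_le_sum mult_nonneg_nonneg prod_nonneg) auto
    finally show ?thesis .
  next
    case False
    then have "?FH x = 0" using fin \<rho>(2) by auto
    then show ?thesis by simp
  qed
  then have "A ?FH \<le> A (\<lambda>x. \<rho> * (\<Sum>e\<in>?B. F (psi N e x) * ?FH x))"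
    by (intro avg_mono)
  also have "\<dots> = \<rho> * (\<Sum>e\<in>?B. A (\<lambda>x. F (psi N e x) * ?FH x))"
    by (simp add: avg_cmult avg_sum)
  also have "\<dots> \<le> \<rho> * (\<Sum>e\<in>?B. 2)"
  proof (intro mult_left_mono sum_mono)
    fix e0 assume e0: "e0 \<in> ?B"
    have "A (\<lambda>x. F (psi N e0 x) * ?FH x) = A (\<lambda>x. \<Prod>e\<in>insert e0 H. F (psi N e x))"
      using e0 fin by simp
    also have "\<dots> \<le> A (\<lambda>x. \<Prod>e\<in>insert e0 H. \<nu> (psi N e x))"
      by (intro avg_mono prod_mono) (auto simp: F_nonneg F_le)
    also have "\<dots> \<le> 2" by (rule A_nu_le) (use e0 H mono in auto)
    finally show "A (\<lambda>x. F (psi N e0 x) * ?FH x) \<le> 2" .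
  qed (use \<rho>(1) in auto)
  also have "\<dots> \<le> 2 * real (R ^ N) * \<rho>"
    using cardB \<rho>(1) by simp
  finally have upper: "A ?FH \<le> 2 * real (R ^ N) * \<rho>" .
  have "\<sigma> ^ (R ^ N) \<le> A (\<lambda>x. \<Prod>e\<in>edges N R. F (psi N e x))"
    by (rule box_lower_bound[OF \<sigma>])
  also have "(\<lambda>x. \<Prod>e\<in>edges N R. F (psi N e x)) = (\<lambda>x. (\<Prod>e\<in>?B. F (psi N e x)) * ?FH x)"
    using H by (intro ext prod.subset_diff) auto
  also have "A \<dots> \<le> A (\<lambda>x. (\<Prod>e\<in>?B. \<nu> (psi N e x)) * ?FH x)"
    by (intro avg_mono mult_right_mono prod_mono prod_nonneg) (auto simp: F_nonneg F_le)
  also have "\<dots> \<le> A ?FH + real (card ?B) * \<tau>"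
    by (rule replace_edges[OF \<tau> H]) simp
  also have "\<dots> \<le> 2 * real (R ^ N) * \<rho> + real (R ^ N) * \<tau>"
    using upper cardB \<tau>(1) by (intro add_mono mult_right_mono) auto
  finally show False using gap by simp
qed

end

section \<open>Elementary estimates for primes\<close>

abbreviation primes_le :: "nat \<Rightarrow> nat set" where
  "primes_le n \<equiv> {p. prime p \<and> p \<le> n}"

lemma finite_primes_le [simp]: "finite (primes_le n)"
  by (rule finite_subset[of _ "{..n}"]) auto

text \<open>The reciprocals of \<open>m * (n choose m)\<close> form Leibniz's harmonic triangle, whose recurrence
  drives the induction.\<close>

lemma mult_binomial_dvd_Lcm:
  assumes "1 \<le> m" "m \<le> n"
  shows "m * (n choose m) dvd Lcm {1..n}"
proof -
  let ?L = "\<lambda>n. real (Lcm {1..n :: nat})"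
  have "?L n / (real m * real (n choose m)) \<in> \<int>" if "1 \<le> m" "m \<le> n" for m n
    using that
  proof (induction m arbitrary: n rule: nat_induct_at_least)
    case base
    have "n dvd Lcm {1..n}" using base by (intro dvd_Lcm) auto
    then obtain k where "Lcm {1..n} = n * k" by (rule dvdE)
    then show ?case using base by simp
  next
    case (Suc m n)
    then obtain n' where n: "n = Suc n'" by (cases n) auto
    have 1: "?L n / (real m * real (n choose m)) \<in> \<int>" using Suc by simp
    have 2: "?L n' / (real m * real (n' choose m)) \<in> \<int>" using Suc n by simp
    have "Lcm {1..n'} dvd Lcm {1..n}" by (intro Lcm_subset) (auto simp: n)
    then obtain k where "Lcm {1..n} = Lcm {1..n'} * k" by (rule dvdE)
    then have eq: "?L n / (real m * real (n' choose m)) = real k * (?L n' / (real m * real (n' choose m)))"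
      by simp
    have 3: "?L n / (real m * real (n' choose m)) \<in> \<int>"
      unfolding eq by (intro Ints_mult 2) auto
    define c where "c = real (n choose m)"
    have c: "c > 0" using Suc by (simp add: c_def)
    have nm: "real n - real m > 0" using Suc by simp
    have "Suc m * (n choose Suc m) = (n - m) * (n choose m)"
      by (metis binomial_absorb_comp binomial_absorption)
    then have "real (Suc m * (n choose Suc m)) = real ((n - m) * (n choose m))"
      by (rule arg_cong)
    moreover have nm': "real (n - m) = real n - real m"
      using Suc by (simp add: of_nat_diff)
    ultimately have e1: "real (Suc m) * real (n choose Suc m) = (real n - real m) * c"
      by (simp only: of_nat_mult c_def)
    have "(n - m) * (n choose m) = n * (n' choose m)"
      using binomial_absorb_comp[of n m] n by simp
    then have "real ((n - m) * (n choose m)) = real (n * (n' choose m))"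
      by (rule arg_cong)
    then have e2: "(real n - real m) * c = real n * real (n' choose m)"
      by (simp only: of_nat_mult c_def nm')
    have e3: "real (n' choose m) = (real n - real m) * c / real n"
      using e2 n by (simp add: field_simps)
    have "?L n / (real (Suc m) * real (n choose Suc m)) =
      ?L n / (real m * real (n' choose m)) - ?L n / (real m * real (n choose m))"
    proof -
      have gen: "d / (k * c) = d / (a * (k * c / (a + k))) - d / (a * c)"
        if "a > 0" "k > 0" for a k d :: real
        using that c by (simp add: field_simps)
      show ?thesis
        unfolding e1 e3 c_def[symmetric] using gen[of "real m" "real n - real m"] nm Suc.hyps by simp
    qed
    then show ?case using 1 3 by (metis Ints_diff)
  qed
  from this[OF assms] obtain k :: int where k: "?L n / (real m * real (n choose m)) = of_int k"
    by (auto elim: Ints_cases)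
  have pos: "real m * real (n choose m) > 0" using assms by simp
  have "k \<ge> 0" using k pos by (metis divide_nonneg_pos of_nat_0_le_iff of_int_0_le_iff)
  moreover have "?L n = of_int k * (real m * real (n choose m))"
    using k pos by (metis nonzero_eq_divide_eq less_irrefl)
  ultimately have "real (Lcm {1..n}) = real (m * (n choose m) * nat k)"
    by simp
  then have "Lcm {1..n} = m * (n choose m) * nat k" by (simp only: of_nat_eq_iff)
  then show ?thesis by simp
qed

text \<open>The multiplicity of \<open>p\<close> in a least common multiple is a maximum of
  multiplicities, hence attained by a member.\<close>

lemma prime_power_dvd_Lcm:
  fixes S :: "nat set"
  assumes "finite S" "prime p" "p ^ a dvd Lcm S" "a > 0"
  shows "\<exists>m\<in>S. p ^ a dvd m"
  using assms(1,3)
proof (induction S rule: finite_induct)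
  case empty
  then show ?case using assms(2,4) by (auto simp: prime_gt_0_nat dest: prime_gt_1_nat)
next
  case (insert m S)
  show ?case
  proof (cases "m = 0 \<or> Lcm S = 0")
    case True
    then show ?thesis
      using insert.hyps(1) by (auto simp: Lcm_0_iff_nat)
  next
    case False
    then have "multiplicity p (lcm m (Lcm S)) = max (multiplicity p m) (multiplicity p (Lcm S))"
      using assms(2) by (intro multiplicity_lcm) auto
    moreover have "a \<le> multiplicity p (lcm m (Lcm S))"
      using insert.prems False assms(2) by (intro multiplicity_geI) auto
    ultimately have "a \<le> multiplicity p m \<or> a \<le> multiplicity p (Lcm S)" by auto
    then show ?thesis using insert.IH multiplicity_dvd' by blast
  qed
qed

text \<open>The full power of each prime in \<open>Lcm {1..n}\<close> divides a single number up to
  \<open>n\<close>, so it is at most \<open>n\<close>.\<close>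

lemma Lcm_upto_le:
  assumes "n \<ge> 1"
  shows "Lcm {1..n} \<le> n ^ card (primes_le n)"
proof -
  let ?d = "Lcm {1..n}"
  have d: "?d \<noteq> 0" by (simp add: Lcm_0_iff_nat)
  have le: "p ^ multiplicity p ?d \<le> n" if "p \<in> prime_factors ?d" for p
  proof -
    have "prime p" "multiplicity p ?d > 0" using that by (auto simp: prime_factors_multiplicity)
    then obtain m where "m \<in> {1..n}" "p ^ multiplicity p ?d dvd m"
      using prime_power_dvd_Lcm[OF _ _ multiplicity_dvd, of "{1..n}" p] by auto
    then show ?thesis by (auto dest!: dvd_imp_le)
  qed
  have sub: "prime_factors ?d \<subseteq> primes_le n"
  proof
    fix p assume p: "p \<in> prime_factors ?d"
    then have pr: "prime p" "multiplicity p ?d > 0" by (auto simp: prime_factors_multiplicity)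
    then have "p \<le> p ^ multiplicity p ?d" by (intro self_le_power prime_ge_1_nat) auto
    then show "p \<in> primes_le n" using le[OF p] pr by simp
  qed
  have "?d = (\<Prod>p\<in>prime_factors ?d. p ^ multiplicity p ?d)"
    by (intro prime_factorization_nat) (use d in linarith)
  also have "\<dots> \<le> (\<Prod>p\<in>prime_factors ?d. n)"
    by (intro prod_mono) (use le in auto)
  also have "\<dots> = n ^ card (prime_factors ?d)" by simp
  also have "\<dots> \<le> n ^ card (primes_le n)"
    using assms sub by (intro power_increasing card_mono) auto
  finally show ?thesis .
qed

text \<open>The central binomial coefficient is large, but \<open>n\<close> times it divides
  \<open>Lcm {1..2 * n}\<close>. For \<open>2 * n = 2 ^ j\<close> both sides become powers of
  \<open>2\<close>, and comparing exponents avoids logarithms.\<close>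

lemma card_primes_le_ge:
  assumes "j \<ge> 1"
  shows "2 ^ j \<le> 1 + j * card (primes_le (2 ^ j))"
proof -
  obtain i where j: "j = Suc i" using assms by (cases j) auto
  define n where "n = (2::nat) ^ i"
  have n: "2 * n = 2 ^ j" "n \<ge> 1" by (simp_all add: n_def j)
  have "real (4 ^ n) \<le> real (2 * n * (2 * n choose n))"
    using central_binomial_lower_bound[of n] n(2) by (simp add: pos_divide_le_eq mult_ac)
  then have "4 ^ n \<le> 2 * (n * (2 * n choose n))" by (simp only: of_nat_le_iff mult.assoc)
  also have "n * (2 * n choose n) \<le> Lcm {1..2 * n}"
    using n mult_binomial_dvd_Lcm[of n "2 * n"] by (intro dvd_imp_le) (auto simp: Lcm_0_iff_nat neq0_conv[symmetric] simp del: neq0_conv)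
  also have "\<dots> \<le> (2 * n) ^ card (primes_le (2 * n))"
    using n by (intro Lcm_upto_le) auto
  finally have "(4::nat) ^ n \<le> 2 * (2 * n) ^ card (primes_le (2 * n))" by simp
  moreover have "(4::nat) ^ n = 2 ^ (2 * n)" by (simp add: power_mult)
  ultimately have "(2::nat) ^ 2 ^ j \<le> 2 ^ (1 + j * card (primes_le (2 ^ j)))"
    by (simp only: n(1) power_add power_mult power_one_right)
  then show ?thesis by (rule power_le_imp_le_exp[rotated]) simp
qed

section \<open>Upper bounds of Mertens type\<close>

text \<open>Euler's product: the factors \<open>1 / (1 - 1 / p)\<close> dominate finite geometric
  sums, whose product contains \<open>1 / n\<close> for all \<open>n\<close> from \<open>1\<close>
  to \<open>z\<close>; the harmonic sum in turn exceeds the logarithm.\<close>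

lemma prod_one_minus_inverse_primes_le:
  assumes "z \<ge> 1"
  shows "(\<Prod>p\<in>primes_le z. 1 - 1 / real p) * ln (real z) \<le> 1"
proof -
  let ?P = "primes_le z"
  have p2: "real p \<ge> 2" if "p \<in> ?P" for p using that by (auto dest: prime_ge_2_nat)
  \<comment> \<open>Exponents up to \<open>z\<close> capture every \<open>n \<le> z\<close>, because
    \<open>multiplicity p n < p ^ multiplicity p n \<le> n\<close>; so all sums stay finite.\<close>
  let ?F = "PiE ?P (\<lambda>_. {..z})"
  let ?v = "\<lambda>n. \<lambda>p\<in>?P. multiplicity p n"
  have fact: "n = (\<Prod>p\<in>?P. p ^ multiplicity p n)" if "n \<in> {1..z}" for n
  proof -
    have "n = (\<Prod>p\<in>prime_factors n. p ^ multiplicity p n)"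
      using prime_factorization_nat[of n] that by simp
    also have "\<dots> = (\<Prod>p\<in>?P. p ^ multiplicity p n)"
    proof (rule prod.mono_neutral_left)
      show "prime_factors n \<subseteq> ?P"
        using that by (auto simp: in_prime_factors_iff dest!: dvd_imp_le)
      show "\<forall>p\<in>?P - prime_factors n. p ^ multiplicity p n = 1"
        by (auto simp: prime_factors_multiplicity)
    qed auto
    finally show ?thesis .
  qed
  have inj: "inj_on ?v {1..z}"
  proof (rule inj_onI)
    fix a b assume ab: "a \<in> {1..z}" "b \<in> {1..z}" "?v a = ?v b"
    have "multiplicity p a = multiplicity p b" if "p \<in> ?P" for p
      using fun_cong[OF ab(3), of p] that by simp
    then show "a = b" using fact[OF ab(1)] fact[OF ab(2)] by simp
  qed
  have img: "?v ` {1..z} \<subseteq> ?F"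
  proof clarify
    fix n assume n: "n \<in> {1..z}"
    have "multiplicity p n \<le> z" if "prime p" for p
    proof -
      have "p ^ multiplicity p n \<le> n" using n by (intro dvd_imp_le multiplicity_dvd) auto
      moreover have "multiplicity p n < p ^ multiplicity p n"
        using that by (intro power_gt_expt) (auto dest: prime_ge_2_nat)
      ultimately show ?thesis using n by simp
    qed
    then show "?v n \<in> ?F" by auto
  qed
  have "ln (real z) \<le> ln (real z + 1)" using assms by simp
  also have "\<dots> \<le> harm z" by (rule ln_le_harm)
  also have "harm z = (\<Sum>n\<in>{1..z}. 1 / real n)" by (simp add: harm_def field_simps)
  also have "\<dots> = (\<Sum>n\<in>{1..z}. \<Prod>p\<in>?P. (1 / real p) ^ ?v n p)"
  proof (intro sum.cong refl)
    fix n assume "n \<in> {1..z}"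
    then have "real n = (\<Prod>p\<in>?P. real p ^ multiplicity p n)"
      using fact[of n] by (metis (mono_tags, lifting) of_nat_power of_nat_prod prod.cong)
    then have "1 / real n = (\<Prod>p\<in>?P. (1 / real p) ^ multiplicity p n)"
      by (simp add: power_one_over prod_dividef)
    also have "\<dots> = (\<Prod>p\<in>?P. (1 / real p) ^ ?v n p)" by (intro prod.cong) auto
    finally show "1 / real n = (\<Prod>p\<in>?P. (1 / real p) ^ ?v n p)" .
  qed
  also have "\<dots> = (\<Sum>f\<in>?v ` {1..z}. \<Prod>p\<in>?P. (1 / real p) ^ f p)"
    by (rule sum.reindex_cong[OF inj refl, symmetric]) simp
  also have "\<dots> \<le> (\<Sum>f\<in>?F. \<Prod>p\<in>?P. (1 / real p) ^ f p)"
    by (intro sum_mono2 img prod_nonneg) (auto intro!: finite_PiE)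
  also have "\<dots> = (\<Prod>p\<in>?P. \<Sum>i\<in>{..z}. (1 / real p) ^ i)"
    by (rule prod_sum_PiE[symmetric]) auto
  also have "\<dots> \<le> (\<Prod>p\<in>?P. 1 / (1 - 1 / real p))"
  proof (intro prod_mono conjI sum_nonneg)
    fix p assume "p \<in> ?P"
    from p2[OF this] have "1 / real p < 1" by simp
    then have "(\<Sum>i\<in>{..z}. (1 / real p) ^ i) = (1 - (1 / real p) ^ Suc z) / (1 - 1 / real p)"
      unfolding sum_gp0 by (simp only: less_irrefl if_False order.strict_implies_not_eq)
    also have "\<dots> \<le> 1 / (1 - 1 / real p)"
      using \<open>1 / real p < 1\<close> by (intro divide_right_mono) auto
    finally show "(\<Sum>i\<in>{..z}. (1 / real p) ^ i) \<le> 1 / (1 - 1 / real p)" .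
  qed auto
  also have "\<dots> = 1 / (\<Prod>p\<in>?P. 1 - 1 / real p)"
    by (simp add: prod_dividef)
  finally have "ln (real z) \<le> 1 / (\<Prod>p\<in>?P. 1 - 1 / real p)" .
  moreover have "(\<Prod>p\<in>?P. 1 - 1 / real p) > 0"
  proof (rule prod_pos)
    fix p assume "p \<in> ?P"
    from p2[OF this] show "0 < 1 - 1 / real p" by simp
  qed
  ultimately show ?thesis by (simp add: pos_le_divide_eq mult.commute)
qed

lemma prime_power_dvd_fact:
  fixes p :: nat
  assumes "p > 0"
  shows "p ^ k dvd (fact (p * k) :: nat)"
proof (induction k)
  case (Suc k)
  obtain q where q: "p * Suc k = Suc q" "p * k \<le> q"
    using assms by (cases "p * Suc k") auto
  have "p ^ k dvd fact q"
    using Suc fact_dvd[OF q(2), where 'a = nat] dvd_trans by blast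
  moreover have "p dvd Suc q" unfolding q(1)[symmetric] by simp
  ultimately have "p * p ^ k dvd Suc q * fact q" by (intro mult_dvd_mono)
  then show ?case unfolding q(1) by simp
qed simp

text \<open>The leading term \<open>n div p\<close> of Legendre's formula; powers of different
  primes are coprime.\<close>

lemma prod_prime_power_dvd_fact:
  assumes "finite P" "\<And>p. p \<in> P \<Longrightarrow> prime p"
  shows "(\<Prod>p\<in>P. p ^ (n div p)) dvd (fact n :: nat)"
  using assms
proof (induction P rule: finite_induct)
  case (insert p P)
  have "p ^ (n div p) dvd fact (p * (n div p))"
    using insert.prems[of p] by (intro prime_power_dvd_fact) (auto simp: prime_gt_0_nat)
  also have "(fact (p * (n div p)) :: nat) dvd fact n" by (intro fact_dvd) simp
  finally have "p ^ (n div p) dvd (fact n :: nat)" .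
  moreover have "coprime (p ^ (n div p)) (\<Prod>p\<in>P. p ^ (n div p))"
    using insert by (intro prod_coprime_right) (auto intro!: coprime_power_left_iff[THEN iffD2] coprime_power_right_iff[THEN iffD2] primes_coprime)
  ultimately show ?case using insert by (simp add: divides_mult)
qed simp

text \<open>Taking logarithms in the divisibility above and in \<open>fact n \<le> n ^ n\<close>
  gives one \<open>ln n\<close>. The other pays for rounding \<open>n / p\<close> down, which costs
  at most \<open>ln n\<close> for each of at most \<open>n\<close> primes.\<close>

lemma sum_ln_prime_over_prime_le:
  assumes "n \<ge> 1"
  shows "(\<Sum>p\<in>primes_le n. ln (real p) / real p) \<le> 2 * ln (real n)"
proof -
  let ?P = "primes_le n"
  have p1: "real p \<ge> 1" "p > 0" if "p \<in> ?P" for p using that by (auto dest: prime_ge_1_nat prime_gt_0_nat)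
  have n: "real n \<ge> 1" using assms by simp
  have "(\<Prod>p\<in>?P. p ^ (n div p)) \<le> fact n"
    by (intro dvd_imp_le prod_prime_power_dvd_fact) auto
  also have "fact n \<le> n ^ n" using fact_le_power[of n, where 'a = nat] by simp
  finally have "real (\<Prod>p\<in>?P. p ^ (n div p)) \<le> real (n ^ n)" by (simp only: of_nat_le_iff)
  then have "ln (\<Prod>p\<in>?P. real p ^ (n div p)) \<le> ln (real n ^ n)"
    using p1 n by (subst ln_le_cancel_iff) (auto intro!: prod_pos)
  also have "ln (real n ^ n) = real n * ln (real n)" using n by (simp add: ln_realpow)
  also have "ln (\<Prod>p\<in>?P. real p ^ (n div p)) = (\<Sum>p\<in>?P. real (n div p) * ln (real p))"
    using p1 by (subst ln_prod) (auto simp: ln_realpow intro!: sum.cong)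
  finally have 1: "(\<Sum>p\<in>?P. real (n div p) * ln (real p)) \<le> real n * ln (real n)" .
  have "real n * (\<Sum>p\<in>?P. ln (real p) / real p) = (\<Sum>p\<in>?P. real n / real p * ln (real p))"
    by (simp add: sum_distrib_left)
  also have "\<dots> \<le> (\<Sum>p\<in>?P. real (n div p) * ln (real p) + ln (real n))"
  proof (intro sum_mono)
    fix p assume p: "p \<in> ?P"
    have "real n / real p \<le> real (n div p) + 1"
    proof -
      have "n = p * (n div p) + n mod p" "n mod p < p"
        using p1(2)[OF p] by simp_all
      moreover have "(n div p + 1) * p = p * (n div p) + p" by simp
      ultimately have "n \<le> (n div p + 1) * p" by linarith
      then have "real n \<le> real ((n div p + 1) * p)" by (simp only: of_nat_le_iff)
      then show ?thesis using p1(2)[OF p] by (simp add: pos_divide_le_eq algebra_simps)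
    qed
    then have "real n / real p * ln (real p) \<le> (real (n div p) + 1) * ln (real p)"
      using p1[OF p] by (intro mult_right_mono) auto
    also have "\<dots> \<le> real (n div p) * ln (real p) + ln (real n)"
      using p1[OF p] p by (simp add: distrib_right)
    finally show "real n / real p * ln (real p) \<le> real (n div p) * ln (real p) + ln (real n)" .
  qed
  also have "\<dots> \<le> real n * ln (real n) + real (card ?P) * ln (real n)"
    using 1 by (simp add: sum.distrib)
  also have "card ?P \<le> card {1..n}"
    by (intro card_mono) (auto dest: prime_ge_1_nat)
  then have "card ?P \<le> n" by simp
  then have "real (card ?P) * ln (real n) \<le> real n * ln (real n)"
    using n by (intro mult_right_mono) auto
  finally have "real n * (\<Sum>p\<in>?P. ln (real p) / real p) \<le> real n * (2 * ln (real n))"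
    by simp
  then show ?thesis using n by (simp add: mult_le_cancel_left)
qed

text \<open>Passing from \<open>y\<close> to \<open>z = y\<^sup>2\<close> adds primes with
  \<open>ln p \<ge> ln y\<close>, whose reciprocals sum to at most
  \<open>2 * ln z / ln y = 4\<close>. This explains the doubly exponential scale.\<close>

lemma sum_inverse_primes_le:
  "(\<Sum>p\<in>primes_le (2 ^ 2 ^ h). 1 / real p) \<le> 4 * real h + 1"
proof (induction h)
  case 0
  have "primes_le 2 = {2}" by (auto dest: prime_ge_2_nat)
  then show ?case by simp
next
  case (Suc h)
  let ?y = "(2::nat) ^ 2 ^ h" and ?z = "(2::nat) ^ 2 ^ Suc h"
  let ?N = "primes_le ?z - primes_le ?y"
  have z: "?z = ?y\<^sup>2" by (simp add: power_mult[symmetric] mult.commute)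
  have y: "real ?y \<ge> 2" using self_le_power[of "2::nat" "2 ^ h"] by (simp add: order.trans[OF _ self_le_power])
  have yz: "?y \<le> ?z" by (intro power_increasing) auto
  have "ln (real ?y) * (\<Sum>p\<in>?N. 1 / real p) = (\<Sum>p\<in>?N. ln (real ?y) / real p)"
    by (simp add: sum_distrib_left)
  also have "\<dots> \<le> (\<Sum>p\<in>?N. ln (real p) / real p)"
  proof (intro sum_mono divide_right_mono)
    fix p assume "p \<in> ?N"
    then have "?y \<le> p" by auto
    then have "real ?y \<le> real p" by (simp only: of_nat_le_iff)
    then show "ln (real ?y) \<le> ln (real p)"
      using y by (intro ln_le_cancel_iff[THEN iffD2]) linarith+
  qed auto
  also have "\<dots> \<le> (\<Sum>p\<in>primes_le ?z. ln (real p) / real p)"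
    by (intro sum_mono2) (auto dest: prime_ge_1_nat)
  also have "\<dots> \<le> 2 * ln (real ?z)" by (intro sum_ln_prime_over_prime_le) auto
  also have "ln (real ?z) = 2 * ln (real ?y)" unfolding z using y by (simp add: ln_realpow)
  finally have "ln (real ?y) * (\<Sum>p\<in>?N. 1 / real p) \<le> ln (real ?y) * 4" by simp
  then have "(\<Sum>p\<in>?N. 1 / real p) \<le> 4"
    using y by (subst (asm) mult_le_cancel_left_pos) auto
  moreover have "(\<Sum>p\<in>primes_le ?z. 1 / real p) = (\<Sum>p\<in>?N. 1 / real p) + (\<Sum>p\<in>primes_le ?y. 1 / real p)"
    using yz by (intro sum.subset_diff) (auto intro: order.trans)
  ultimately show ?case using Suc by simp
qed

section \<open>Periodic functions on boxes\<close>

definition periodic :: "nat \<Rightarrow> 'v set \<Rightarrow> (('v \<Rightarrow> nat) \<Rightarrow> real) \<Rightarrow> bool" where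
  "periodic q I f \<longleftrightarrow> (\<forall>x y. (\<forall>v\<in>I. x v mod q = y v mod q) \<longrightarrow> f x = f y)"

lemma periodicD: "periodic q I f \<Longrightarrow> (\<And>v. v \<in> I \<Longrightarrow> x v mod q = y v mod q) \<Longrightarrow> f x = f y"
  by (auto simp: periodic_def)

lemma periodic_upd:
  "periodic q I f \<Longrightarrow> s mod q = t mod q \<Longrightarrow> f (x(v := s)) = f (x(v := t))"
  by (erule periodicD) simp

lemma periodic_dvd: "periodic q I f \<Longrightarrow> q dvd q' \<Longrightarrow> periodic q' I f"
  unfolding periodic_def by (metis mod_mod_cancel)

lemma periodic_prod:
  "(\<And>a. a \<in> A \<Longrightarrow> periodic q I (f a)) \<Longrightarrow> periodic q I (\<lambda>x. \<Prod>a\<in>A. f a x)"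
  unfolding periodic_def by (intro allI impI prod.cong refl) blast

lemma sum_periodic_split:
  fixes \<phi> :: "nat \<Rightarrow> real"
  assumes "\<And>t. \<phi> (t + q) = \<phi> t"
  shows "(\<Sum>t<q * k + r. \<phi> t) = real k * (\<Sum>t<q. \<phi> t) + (\<Sum>t<r. \<phi> t)"
proof -
  have shift: "\<phi> (t + q * k) = \<phi> t" for t k
    using assms by (induction k) (simp_all add: add.assoc[symmetric], metis add.commute add.assoc)
  have shift': "(\<Sum>t<q * k + r. \<phi> t) = (\<Sum>t<q * k. \<phi> t) + (\<Sum>t<r. \<phi> t)" for k r
  proof (induction r)
    case (Suc r)
    then show ?case using shift[of r k] by (simp add: add.commute)
  qed simp
  have "(\<Sum>t<q * k. \<phi> t) = real k * (\<Sum>t<q. \<phi> t)"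
  proof (induction k)
    case (Suc k)
    then show ?case using shift'[of k q] by (simp add: algebra_simps)
  qed simp
  then show ?thesis using shift' by simp
qed

text \<open>Only the incomplete last period causes an error. The bound keeps \<open>L mod q\<close>
  rather than \<open>q\<close> so that it vanishes when \<open>q\<close> divides
  \<open>L\<close>.\<close>

lemma average_periodic:
  fixes \<phi> :: "nat \<Rightarrow> real"
  assumes \<phi>: "\<And>t. \<phi> (t + q) = \<phi> t" "\<And>t. \<bar>\<phi> t\<bar> \<le> 1" and pos: "q > 0" "L > 0"
  shows "\<bar>(\<Sum>t<L. \<phi> t) / L - (\<Sum>t<q. \<phi> t) / q\<bar> \<le> 2 * real (L mod q) / real L"
proof -
  define S where "S = (\<Sum>t<q. \<phi> t)"
  define T where "T = (\<Sum>t<L mod q. \<phi> t)"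
  have S: "\<bar>S\<bar> \<le> q" and T: "\<bar>T\<bar> \<le> L mod q"
    unfolding S_def T_def using \<phi>(2) by (auto intro!: order.trans[OF sum_abs] sum_bounded_above[THEN order.trans])
  have L: "real L = real q * real (L div q) + real (L mod q)"
    by (metis mult_div_mod_eq of_nat_add of_nat_mult)
  have "(\<Sum>t<L. \<phi> t) = real (L div q) * S + T"
    using sum_periodic_split[of \<phi> q "L div q" "L mod q"] \<phi>(1) by (simp add: S_def T_def)
  then have "(\<Sum>t<L. \<phi> t) / L - S / q = T / L - (real (L mod q) / L) * (S / q)"
  proof -
    have gen: "(k * S + T) / l - S / q' = T / l - (m / l) * (S / q')"
      if "l = q' * k + m" "q' > 0" "l > 0" for k l m q' :: real
    proof -
      have k: "k = (l - m) / q'" using that by (simp add: field_simps)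
      show ?thesis unfolding k using that(2,3) by (simp add: field_simps)
    qed
    assume "(\<Sum>t<L. \<phi> t) = real (L div q) * S + T"
    then show ?thesis using gen[OF L] pos by simp
  qed
  moreover have "\<bar>T / L\<bar> \<le> (L mod q) / L"
    using T by (simp add: divide_right_mono)
  moreover have "\<bar>(real (L mod q) / L) * (S / q)\<bar> \<le> (L mod q) / L * 1"
    unfolding abs_mult using S pos by (intro mult_mono) auto
  moreover have "2 * real (L mod q) / real L = (L mod q) / L + (L mod q) / L" by simp
  ultimately show ?thesis unfolding S_def[symmetric] by linarith
qed

lemma avg_periodic_box:
  assumes I: "finite I" and f: "periodic q I f" "\<And>x. \<bar>f x\<bar> \<le> 1" and pos: "q > 0" "L > 0"
  shows "\<bar>avg (\<lambda>_. L) I f - avg (\<lambda>_. q) I f\<bar> \<le> real (card I) * (2 * real (L mod q) / real L)"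
proof (rule avg_hybrid[OF I])
  fix v x
  have "f (x(v := t + q)) = f (x(v := t))" for t
    by (rule periodic_upd[OF f(1)]) simp
  then show "\<bar>avg1 L v f x - avg1 q v f x\<bar> \<le> 2 * real (L mod q) / real L"
    unfolding avg1_def by (intro average_periodic) (use f(2) pos in auto)
qed (use pos in auto)

lemma sum_crt:
  fixes \<phi> \<theta> :: "nat \<Rightarrow> real"
  assumes \<phi>: "\<And>s t. s mod a = t mod a \<Longrightarrow> \<phi> s = \<phi> t" and \<theta>: "\<And>s t. s mod b = t mod b \<Longrightarrow> \<theta> s = \<theta> t"
    and ab: "coprime a b" "a > 0" "b > 0"
  shows "(\<Sum>t<a * b. \<phi> t * \<theta> t) = (\<Sum>t<a. \<phi> t) * (\<Sum>t<b. \<theta> t)"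
proof -
  let ?h = "\<lambda>t. (t mod a, t mod b)"
  have inj: "inj_on ?h {..<a * b}"
  proof (rule inj_onI)
    fix s t assume st: "s \<in> {..<a * b}" "t \<in> {..<a * b}" "?h s = ?h t"
    then have "[s = t] (mod a * b)"
      using ab(1) by (intro coprime_cong_mult_nat) (auto simp: cong_def)
    then show "s = t" using st by (simp add: cong_def)
  qed
  have "?h ` {..<a * b} = {..<a} \<times> {..<b}"
    using ab by (intro card_subset_eq) (auto simp: card_image[OF inj])
  with inj have bij: "bij_betw ?h {..<a * b} ({..<a} \<times> {..<b})"
    by (simp add: bij_betw_def)
  have "(\<Sum>t<a * b. \<phi> t * \<theta> t) = (\<Sum>t<a * b. case ?h t of (s, u) \<Rightarrow> \<phi> s * \<theta> u)"
    using \<phi>[of "_ mod a"] \<theta>[of "_ mod b"] by (intro sum.cong) auto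
  also have "\<dots> = (\<Sum>(s, u)\<in>{..<a} \<times> {..<b}. \<phi> s * \<theta> u)"
    by (rule sum.reindex_bij_betw[OF bij])
  also have "\<dots> = (\<Sum>t<a. \<phi> t) * (\<Sum>t<b. \<theta> t)"
    by (simp add: sum_product sum.cartesian_product)
  finally show ?thesis .
qed

lemma avg_crt:
  assumes "finite I" and "periodic a I f" "periodic b I g" and ab: "coprime a b" "a > 0" "b > 0"
  shows "avg (\<lambda>_. a * b) I (\<lambda>x. f x * g x) = avg (\<lambda>_. a) I f * avg (\<lambda>_. b) I g"
  using assms(1-3)
proof (induction I arbitrary: f g rule: finite_induct)
  case empty
  then show ?case by simp
next
  case (insert v I)
  have sec: "periodic q I (avg1 q v h)" if h: "periodic q (insert v I) h" for q h
    unfolding periodic_def avg1_def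
    by (intro allI impI arg_cong2[where f = "(/)"] sum.cong refl periodicD[OF h]) auto
  have "avg1 (a * b) v (\<lambda>x. f x * g x) = (\<lambda>x. avg1 a v f x * avg1 b v g x)"
  proof
    fix x
    have "(\<Sum>t<a * b. f (x(v := t)) * g (x(v := t))) = (\<Sum>t<a. f (x(v := t))) * (\<Sum>t<b. g (x(v := t)))"
      using ab insert.prems by (intro sum_crt) (auto intro: periodic_upd)
    then show "avg1 (a * b) v (\<lambda>x. f x * g x) x = avg1 a v f x * avg1 b v g x"
      by (simp add: avg1_def)
  qed
  then show ?case
    using insert.hyps insert.IH[OF sec sec] insert.prems by (simp add: avg_insert)
qed

text \<open>By the Chinese remainder theorem, residues modulo different primes are independent on a
  full period.\<close>

lemma avg_prod_primes:
  assumes I: "finite I" and P: "finite P" "\<And>p. p \<in> P \<Longrightarrow> prime p"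
    and h: "\<And>p. p \<in> P \<Longrightarrow> periodic p I (h p)"
  shows "avg (\<lambda>_. \<Prod>P) I (\<lambda>x. \<Prod>p\<in>P. h p x) = (\<Prod>p\<in>P. avg (\<lambda>_. p) I (h p))"
  using P h
proof (induction P rule: finite_induct)
  case empty
  then show ?case using avg_const[OF I, of "\<lambda>_. 1" 1] by simp
next
  case (insert p P)
  have "periodic (\<Prod>P) I (\<lambda>x. \<Prod>p\<in>P. h p x)"
  proof (rule periodic_prod)
    fix q assume "q \<in> P"
    then show "periodic (\<Prod>P) I (h q)"
      using insert.hyps(1) insert.prems(2)[of q] by (auto intro: periodic_dvd)
  qed
  moreover have "coprime p (\<Prod>P)"
    using insert by (intro prod_coprime_right) (auto intro!: primes_coprime)
  moreover have "p > 0" "\<Prod>P > 0"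
    using insert.prems(1) by (auto intro!: prod_pos simp: prime_gt_0_nat)
  ultimately show ?case
    using avg_crt[OF I insert.prems(2)[of p], of "\<Prod>P" "\<lambda>x. \<Prod>p\<in>P. h p x"] insert by simp
qed

section \<open>Brun's pure sieve\<close>

text \<open>Inclusion-exclusion for having no prime factor in \<open>P\<close>, truncated after
  \<open>r\<close> primes. A set \<open>D\<close> stands for the squarefree number
  \<open>\<Prod>D\<close>, with Moebius value \<open>(-1) ^ card D\<close>.\<close>

definition sieve :: "nat set \<Rightarrow> nat \<Rightarrow> nat \<Rightarrow> real" where
  "sieve P r c = (\<Sum>D | D \<subseteq> P \<and> card D \<le> r. (-1) ^ card D * of_bool (\<forall>p\<in>D. p dvd c))"

lemma sum_alternating_binomial:
  "(\<Sum>j\<le>r. (-1) ^ j * real (Suc m choose j)) = (-1) ^ r * real (m choose r)"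
proof (induction r)
  case (Suc r)
  then show ?case by (simp add: algebra_simps)
qed simp

lemma sieve_eq:
  fixes c :: nat
  assumes "finite P"
  defines "\<Omega> \<equiv> {p \<in> P. p dvd c}"
  shows "sieve P r c = (\<Sum>j\<le>r. (-1) ^ j * real (card \<Omega> choose j))"
proof -
  have fin: "finite \<Omega>" using assms by (simp add: \<Omega>_def)
  have "sieve P r c = (\<Sum>D | D \<subseteq> \<Omega> \<and> card D \<le> r. (-1) ^ card D)"
    unfolding sieve_def using assms(1)
    by (intro sum.mono_neutral_cong_right) (auto simp: \<Omega>_def)
  also have "\<dots> = (\<Sum>j\<le>r. \<Sum>D | D \<in> {D. D \<subseteq> \<Omega> \<and> card D \<le> r} \<and> card D = j. (-1) ^ card D)"
    using fin by (subst sum.group) (auto intro: finite_subset[of _ "Pow \<Omega>"])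
  also have "\<dots> = (\<Sum>j\<le>r. (-1) ^ j * real (card \<Omega> choose j))"
  proof (intro sum.cong refl)
    fix j assume "j \<in> {..r}"
    then have "{D. D \<in> {D. D \<subseteq> \<Omega> \<and> card D \<le> r} \<and> card D = j} = {D. D \<subseteq> \<Omega> \<and> card D = j}" by auto
    then show "(\<Sum>D | D \<in> {D. D \<subseteq> \<Omega> \<and> card D \<le> r} \<and> card D = j. (-1) ^ card D) =
        (-1) ^ j * real (card \<Omega> choose j)"
      using n_subsets[OF fin, of j] by simp
  qed
  finally show ?thesis .
qed

text \<open>For even \<open>r\<close> and \<open>\<omega> > 0\<close> the truncated sum is
  \<open>(\<omega> - 1) choose r\<close>, which yields a majorant. If this is nonzero then
  \<open>r < \<omega>\<close>, and \<open>2 ^ \<omega> = 4 ^ \<omega> * (1 / 2) ^ \<omega>\<close>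
  shows a saving exponential in \<open>r\<close>. The weight \<open>4 ^ \<omega>\<close> is a
  product over the primes of \<open>P\<close>, so its averages will factor.\<close>

lemma sieve_bounds:
  fixes c :: nat
  assumes "finite P" "even r"
  defines "\<omega> \<equiv> card {p \<in> P. p dvd c}" and "b \<equiv> of_bool (\<forall>p\<in>P. \<not> p dvd c)"
  shows "b \<le> sieve P r c" "sieve P r c \<le> 4 ^ \<omega>" "\<bar>sieve P r c - b\<bar> \<le> 4 ^ \<omega> * (1 / 2) ^ r"
proof -
  have *: "sieve P r c = (if \<omega> = 0 then 1 else real ((\<omega> - 1) choose r))"
  proof (cases \<omega>)
    case 0
    have "(\<Sum>j\<le>r. (-1) ^ j * real (0 choose j)) = (\<Sum>j\<le>r. if j = 0 then 1 else 0)"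
      by (intro sum.cong) auto
    then show ?thesis using sieve_eq[OF assms(1), of r c] 0 by (simp add: \<omega>_def[symmetric])
  next
    case (Suc m)
    then show ?thesis
      using sieve_eq[OF assms(1), of r c] sum_alternating_binomial[of m r] assms(2)
      by (simp add: \<omega>_def[symmetric] del: binomial_Suc_Suc)
  qed
  have b: "b = (if \<omega> = 0 then 1 else 0)"
    using assms(1) by (auto simp: b_def \<omega>_def card_eq_0_iff)
  have le: "real (m choose r) \<le> 2 ^ m" for m
    using binomial_le_pow2[of m r] by (metis of_nat_le_iff of_nat_numeral of_nat_power)
  show "b \<le> sieve P r c" unfolding * b by simp
  have "(2::real) ^ (\<omega> - 1) \<le> 4 ^ \<omega>"
    by (intro order.trans[OF power_increasing[of "\<omega> - 1" \<omega>] power_mono]) auto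
  then have "real ((\<omega> - 1) choose r) \<le> 4 ^ \<omega>"
    using le[of "\<omega> - 1"] by (rule order.trans[rotated])
  moreover have "1 \<le> (4::real) ^ \<omega>" by simp
  ultimately show "sieve P r c \<le> 4 ^ \<omega>"
    unfolding * by presburger
  show "\<bar>sieve P r c - b\<bar> \<le> 4 ^ \<omega> * (1 / 2) ^ r"
  proof (cases "\<omega> - 1 < r \<or> \<omega> = 0")
    case True
    then show ?thesis unfolding * b by (auto simp: binomial_eq_0)
  next
    case False
    then have "r \<le> \<omega>" by auto
    have "real ((\<omega> - 1) choose r) \<le> 2 ^ (\<omega> - 1)" by (rule le)
    also have "\<dots> \<le> 2 ^ \<omega>" by (intro power_increasing) auto
    also have "\<dots> \<le> 4 ^ \<omega> * (1 / 2) ^ \<omega>" by (simp flip: power_mult_distrib)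
    also have "\<dots> \<le> 4 ^ \<omega> * (1 / 2) ^ r"
      using \<open>r \<le> \<omega>\<close> by (intro mult_left_mono power_decreasing) auto
    finally show ?thesis unfolding * b using False by simp
  qed
qed

text \<open>Factors are exchanged one at a time. Every term keeps the whole product of
  \<open>B\<close>, which can later be rearranged prime by prime.\<close>

lemma prod_diff_bound:
  fixes a b B :: "'a \<Rightarrow> real"
  assumes "finite E" "\<delta> \<ge> 0"
    "\<And>e. e \<in> E \<Longrightarrow> 0 \<le> a e \<and> a e \<le> B e" "\<And>e. e \<in> E \<Longrightarrow> 0 \<le> b e \<and> b e \<le> B e"
    "\<And>e. e \<in> E \<Longrightarrow> \<bar>a e - b e\<bar> \<le> B e * \<delta>"
  shows "\<bar>prod a E - prod b E\<bar> \<le> real (card E) * \<delta> * prod B E"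
  using assms
proof (induction E rule: finite_induct)
  case (insert e E)
  have "prod a (insert e E) - prod b (insert e E) =
      (a e - b e) * prod a E + b e * (prod a E - prod b E)"
    using insert.hyps by (simp add: algebra_simps)
  also have "\<bar>\<dots>\<bar> \<le> \<bar>a e - b e\<bar> * prod a E + b e * \<bar>prod a E - prod b E\<bar>"
    using insert.prems by (intro order.trans[OF abs_triangle_ineq] add_mono) (auto simp: abs_mult prod_nonneg)
  also have "\<dots> \<le> (B e * \<delta>) * prod B E + B e * (real (card E) * \<delta> * prod B E)"
    using insert.prems insert.IH order.trans[of 0 "a e" "B e"]
    by (intro add_mono mult_mono prod_mono mult_nonneg_nonneg) (auto intro!: prod_nonneg)
  also have "\<dots> = real (card (insert e E)) * \<delta> * prod B (insert e E)"
    using insert.hyps by (simp add: algebra_simps)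
  finally show ?case .
qed simp

section \<open>Linear forms in rough numbers\<close>

text \<open>\<open>W\<close> is invertible modulo \<open>p\<close>, so \<open>a + W * s\<close>
  meets each residue exactly once.\<close>

lemma sum_dvd_residues:
  fixes p W a :: nat
  assumes "prime p" "coprime p W"
  shows "(\<Sum>s<p. of_bool (p dvd a + W * s)) = (1 :: real)"
proof -
  have p: "p > 0" using assms(1) by (rule prime_gt_0_nat)
  let ?h = "\<lambda>s. (a + W * s) mod p"
  have inj: "inj_on ?h {..<p}"
  proof (rule inj_onI)
    fix s s' assume s: "s \<in> {..<p}" "s' \<in> {..<p}" "?h s = ?h s'"
    then have "[a + W * s = a + W * s'] (mod p)" by (simp add: cong_def)
    then have "[W * s = W * s'] (mod p)" by (simp only: cong_add_lcancel_nat)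
    then have "[s = s'] (mod p)"
      using assms(2) by (simp add: cong_mult_lcancel_nat coprime_commute)
    then show "s = s'" using s by (simp add: cong_def)
  qed
  have "?h ` {..<p} = {..<p}"
    using p by (intro card_subset_eq) (auto simp: card_image[OF inj])
  with inj have bij: "bij_betw ?h {..<p} {..<p}" by (simp add: bij_betw_def)
  have "(\<Sum>s<p. of_bool (p dvd a + W * s)) = (\<Sum>s<p. (of_bool (?h s = 0) :: real))"
    by (simp add: dvd_eq_mod_eq_0)
  also have "\<dots> = (\<Sum>u<p. of_bool (u = 0))"
    by (rule sum.reindex_bij_betw[OF bij])
  also have "\<dots> = (\<Sum>u\<in>{0 :: nat}. 1)"
    using p by (intro sum.mono_neutral_cong_right) auto
  finally show ?thesis by simp
qed

lemma psi_split: "i < N \<Longrightarrow> psi N e (x((i, e i) := s)) = s + (\<Sum>j\<in>{..<N} - {i}. x (j, e j))"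
  unfolding psi_def by (subst sum.remove[of _ i]) (auto intro!: sum.cong)

text \<open>For fixed other coordinates, exactly one residue at the vertex \<open>(i, e i)\<close>
  makes the form divisible by \<open>p\<close>. Since \<open>g\<close> ignores this vertex,
  divisibility is independent of \<open>g\<close>.\<close>

lemma avg_dvd_mult:
  assumes "prime p" "coprime p W" "i < N" "e \<in> edges N R"
    and g: "\<And>x s. g (x((i, e i) := s)) = g x"
  shows "avg (\<lambda>_. p) (verts N R) (\<lambda>x. g x * of_bool (p dvd t + W * psi N e x)) =
    avg (\<lambda>_. p) (verts N R) g / p"
proof -
  have p: "p > 0" using assms(1) by (rule prime_gt_0_nat)
  let ?f = "\<lambda>x. g x * of_bool (p dvd t + W * psi N e x)"
  have v: "(i, e i) \<in> verts N R" using assms(3,4) by (auto simp: verts_def edges_lt)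
  have "avg1 p (i, e i) ?f x = 1 / p * g x" for x
  proof -
    have "(\<Sum>s<p. ?f (x((i, e i) := s))) =
      g x * (\<Sum>s<p. of_bool (p dvd (t + W * (\<Sum>j\<in>{..<N} - {i}. x (j, e j))) + W * s))"
      by (subst sum_distrib_left, intro sum.cong refl) (simp add: g psi_split[OF assms(3)] distrib_left add_ac)
    then show ?thesis using sum_dvd_residues[OF assms(1,2)] by (simp add: avg1_def)
  qed
  then have "avg1 p (i, e i) ?f = (\<lambda>x. 1 / p * g x)" by blast
  then have "avg (\<lambda>_. p) (verts N R) ?f = avg (\<lambda>_. p) (verts N R) (\<lambda>x. 1 / p * g x)"
    using avg_resample[of "verts N R" "(i, e i)" "\<lambda>_. p" ?f] v p by simp
  then show ?thesis by (simp only: avg_cmult) simp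
qed

lemma power_one_minus_bounds:
  fixes u :: real
  assumes "0 \<le> u" "u \<le> 1"
  shows "1 - real k * u \<le> (1 - u) ^ k" "(1 - u) ^ k \<le> 1 - real k * u + (real k * u)\<^sup>2"
proof -
  show "1 - real k * u \<le> (1 - u) ^ k"
    using Bernoulli_inequality[of "- u" k] assms by simp
  show "(1 - u) ^ k \<le> 1 - real k * u + (real k * u)\<^sup>2"
  proof (induction k)
    case (Suc k)
    have "(1 - u) ^ Suc k \<le> (1 - u) * (1 - real k * u + (real k * u)\<^sup>2)"
      using Suc assms by (simp add: mult_left_mono)
    also have "\<dots> = 1 - real (Suc k) * u + (real k * u\<^sup>2 + (real k * u)\<^sup>2) - u * (real k * u)\<^sup>2"
      by (simp add: algebra_simps power2_eq_square)
    also have "\<dots> \<le> 1 - real (Suc k) * u + (real (Suc k) * u)\<^sup>2"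
      using assms by (simp add: algebra_simps power2_eq_square)
    finally show ?case .
  qed simp
qed

text \<open>Bonferroni inequalities for indicators. If some indicator is \<open>1\<close>, the
  product vanishes and, with \<open>m\<close> the sum of all, the upper bound equals
  \<open>1 - m + m * (m - 1) = (m - 1)\<^sup>2\<close>.\<close>

lemma prod_one_minus_bounds:
  fixes X :: "'a \<Rightarrow> real"
  assumes "finite E" "\<And>e. e \<in> E \<Longrightarrow> X e = 0 \<or> X e = 1"
  shows "1 - (\<Sum>e\<in>E. X e) \<le> (\<Prod>e\<in>E. 1 - X e)"
    "(\<Prod>e\<in>E. 1 - X e) \<le> 1 - (\<Sum>e\<in>E. X e) + (\<Sum>e\<in>E. \<Sum>e'\<in>E - {e}. X e * X e')"
    "(\<Prod>e\<in>E. if X e = 1 then 4 else 1) \<le> 1 + 4 ^ card E * (\<Sum>e\<in>E. X e)"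
proof -
  have nonneg: "0 \<le> X e" if "e \<in> E" for e using assms(2)[OF that] by auto
  show "1 - (\<Sum>e\<in>E. X e) \<le> (\<Prod>e\<in>E. 1 - X e)"
  proof (cases "\<exists>e\<in>E. X e = 1")
    case True
    then obtain e where e: "e \<in> E" "X e = 1" by blast
    then have "X e \<le> (\<Sum>e\<in>E. X e)"
      using nonneg assms(1) by (intro member_le_sum) auto
    moreover have "(\<Prod>e\<in>E. 1 - X e) = 0" using e assms(1) by auto
    ultimately show ?thesis using e by simp
  next
    case False
    then have "X e = 0" if "e \<in> E" for e using assms(2) that by blast
    then show ?thesis by simp
  qed
  show "(\<Prod>e\<in>E. 1 - X e) \<le> 1 - (\<Sum>e\<in>E. X e) + (\<Sum>e\<in>E. \<Sum>e'\<in>E - {e}. X e * X e')"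
  proof (cases "\<exists>e\<in>E. X e = 1")
    case True
    then have 0: "(\<Prod>e\<in>E. 1 - X e) = 0" using assms(1) by auto
    define m where "m = (\<Sum>e\<in>E. X e)"
    have "(\<Sum>e\<in>E. \<Sum>e'\<in>E - {e}. X e * X e') = (\<Sum>e\<in>E. X e * (m - X e))"
      using assms(1) by (intro sum.cong refl) (simp add: m_def sum_diff1 flip: sum_distrib_left)
    also have "\<dots> = (\<Sum>e\<in>E. m * X e - X e)"
      using assms(2) by (intro sum.cong refl) (auto simp: algebra_simps)
    also have "\<dots> = m * m - m" by (simp add: sum_subtractf m_def flip: sum_distrib_left)
    finally have "1 - m + (\<Sum>e\<in>E. \<Sum>e'\<in>E - {e}. X e * X e') = (m - 1)\<^sup>2"
      by (simp add: power2_eq_square algebra_simps)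
    then show ?thesis unfolding 0 m_def[symmetric] by simp
  next
    case False
    then have "X e = 0" if "e \<in> E" for e using assms(2) that by blast
    then show ?thesis by simp
  qed
  show "(\<Prod>e\<in>E. if X e = 1 then 4 else 1) \<le> 1 + 4 ^ card E * (\<Sum>e\<in>E. X e)"
  proof (cases "\<exists>e\<in>E. X e = 1")
    case True
    then obtain e where e: "e \<in> E" "X e = 1" by blast
    have "(\<Prod>e\<in>E. if X e = 1 then 4 else 1) \<le> (\<Prod>e\<in>E. 4::real)"
      by (intro prod_mono) auto
    also have "\<dots> = 4 ^ card E * 1" by simp
    also have "\<dots> \<le> 4 ^ card E * (\<Sum>e\<in>E. X e)"
      using member_le_sum[OF e(1), of X] nonneg assms(1) e(2) by (intro mult_left_mono) auto
    finally show ?thesis by simp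
  next
    case False
    then have "X e = 0" if "e \<in> E" for e using assms(2) that by blast
    then show ?thesis by simp
  qed
qed

section \<open>Local densities and the sieve on a box\<close>

locale rough_forms =
  fixes N R W t w z r :: nat and P :: "nat set"
  assumes N: "N \<ge> 1" and w: "w \<ge> 1" and r: "even r" and P_fin: "finite P"
    and P: "\<And>p. p \<in> P \<Longrightarrow> prime p \<and> coprime p W \<and> w < p \<and> p \<le> z"
begin

abbreviation X :: "nat \<Rightarrow> (nat \<Rightarrow> nat) \<Rightarrow> (nat \<times> nat \<Rightarrow> nat) \<Rightarrow> real" where
  "X p e x \<equiv> of_bool (p dvd t + W * psi N e x)"

abbreviation I :: "(nat \<times> nat) set" where "I \<equiv> verts N R"

lemma P_pos: "p \<in> P \<Longrightarrow> p > 0"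
  using P by (auto intro: prime_gt_0_nat)

lemma X_periodic:
  assumes "e \<in> edges N R"
  shows "periodic p I (X p e)"
  unfolding periodic_def
proof (intro allI impI)
  fix x y :: "nat \<times> nat \<Rightarrow> nat" assume "\<forall>v\<in>I. x v mod p = y v mod p"
  then have "[psi N e x = psi N e y] (mod p)"
    unfolding psi_def using assms by (intro cong_sum) (auto simp: verts_def cong_def edges_lt)
  then have "[t + W * psi N e x = t + W * psi N e y] (mod p)"
    by (intro cong_add cong_mult cong_refl)
  then show "X p e x = X p e y" by (simp add: cong_dvd_iff)
qed

lemma avg_X:
  assumes "p \<in> P" "e \<in> edges N R"
  shows "avg (\<lambda>_. p) I (X p e) = 1 / p"
  using avg_dvd_mult[of p W 0 N e R "\<lambda>_. 1" t] P[OF assms(1)] N assms P_pos[OF assms(1)]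
  by (simp add: avg_const)

text \<open>The edges differ in some class, and the vertex of \<open>e'\<close> there does not occur
  in \<open>e\<close>.\<close>

lemma avg_X_pair:
  assumes "p \<in> P" "e \<in> edges N R" "e' \<in> edges N R" "e \<noteq> e'"
  shows "avg (\<lambda>_. p) I (\<lambda>x. X p e x * X p e' x) = 1 / p * (1 / p)"
proof -
  obtain i where i: "i < N" "e i \<noteq> e' i" using edges_eqI assms by blast
  have "avg (\<lambda>_. p) I (\<lambda>x. X p e x * X p e' x) = avg (\<lambda>_. p) I (X p e) / p"
    using P[OF assms(1)] i assms by (intro avg_dvd_mult) (auto simp: psi_upd_other)
  then show ?thesis using avg_X assms by simp
qed

text \<open>By the first two moments of the divisibility events, the true density lies between
  \<open>1 - k / p\<close> and \<open>1 - k / p + (k / p)\<^sup>2\<close>, as does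
  \<open>(1 - 1 / p) ^ k\<close>.\<close>

lemma local_density:
  assumes "p \<in> P" and E: "E \<subseteq> edges N R"
  shows "\<bar>avg (\<lambda>_. p) I (\<lambda>x. \<Prod>e\<in>E. 1 - X p e x) - (1 - 1 / p) ^ card E\<bar> \<le> (real (card E) / p)\<^sup>2"
    "avg (\<lambda>_. p) I (\<lambda>x. \<Prod>e\<in>E. if X p e x = 1 then 4 else 1) \<le> 1 + 4 ^ card E * real (card E) * (1 / p)"
proof -
  let ?A = "avg (\<lambda>_. p) I" and ?k = "real (card E)"
  have fin: "finite E" using E finite_subset[OF _ finite_edges] by blast
  have p: "p > 0" using P_pos assms by simp
  have u: "0 \<le> 1 / real p" "1 / real p \<le> 1" using p by simp_all
  have c: "?A (\<lambda>_. c) = c" for c using p by (simp add: avg_const)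
  have S1: "?A (\<lambda>x. \<Sum>e\<in>E. X p e x) = ?k * (1 / p)"
    unfolding avg_sum using avg_X[OF assms(1)] E by (simp add: subset_iff)
  have "?A (\<lambda>x. \<Sum>e\<in>E. \<Sum>e'\<in>E - {e}. X p e x * X p e' x) = (\<Sum>e\<in>E. \<Sum>e'\<in>E - {e}. 1 / p * (1 / p))"
    unfolding avg_sum using avg_X_pair[OF assms(1)] E by (intro sum.cong refl) (auto simp: subset_iff)
  also have "\<dots> \<le> (\<Sum>e\<in>E. \<Sum>e'\<in>E. 1 / p * (1 / p))"
    using fin by (intro sum_mono sum_mono2) auto
  also have "\<dots> = (?k / p)\<^sup>2" by (simp add: power2_eq_square)
  finally have S2: "?A (\<lambda>x. \<Sum>e\<in>E. \<Sum>e'\<in>E - {e}. X p e x * X p e' x) \<le> (?k / p)\<^sup>2" .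
  have "1 - ?k * (1 / p) = ?A (\<lambda>x. 1 - (\<Sum>e\<in>E. X p e x))"
    unfolding avg_diff S1 c ..
  also have "\<dots> \<le> ?A (\<lambda>x. \<Prod>e\<in>E. 1 - X p e x)"
    by (intro avg_mono prod_one_minus_bounds(1) fin) auto
  finally have lo: "1 - ?k * (1 / p) \<le> ?A (\<lambda>x. \<Prod>e\<in>E. 1 - X p e x)" .
  have "?A (\<lambda>x. \<Prod>e\<in>E. 1 - X p e x) \<le>
      ?A (\<lambda>x. 1 - (\<Sum>e\<in>E. X p e x) + (\<Sum>e\<in>E. \<Sum>e'\<in>E - {e}. X p e x * X p e' x))"
    by (intro avg_mono prod_one_minus_bounds(2) fin) auto
  also have "\<dots> \<le> 1 - ?k * (1 / p) + (?k / p)\<^sup>2"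
    unfolding avg_add avg_diff S1 c using S2 by simp
  finally have hi: "?A (\<lambda>x. \<Prod>e\<in>E. 1 - X p e x) \<le> 1 - ?k * (1 / p) + (?k / p)\<^sup>2" .
  show "\<bar>?A (\<lambda>x. \<Prod>e\<in>E. 1 - X p e x) - (1 - 1 / p) ^ card E\<bar> \<le> (?k / p)\<^sup>2"
    using lo hi power_one_minus_bounds[OF u, of "card E"] by (simp add: abs_le_iff)
  have "?A (\<lambda>x. \<Prod>e\<in>E. if X p e x = 1 then 4 else 1) \<le> ?A (\<lambda>x. 1 + 4 ^ card E * (\<Sum>e\<in>E. X p e x))"
    by (intro avg_mono prod_one_minus_bounds(3) fin) auto
  also have "\<dots> = 1 + 4 ^ card E * ?k * (1 / p)"
    unfolding avg_add avg_cmult S1 c by simp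
  finally show "?A (\<lambda>x. \<Prod>e\<in>E. if X p e x = 1 then 4 else 1) \<le> 1 + 4 ^ card E * ?k * (1 / p)" .
qed

definition \<rho> :: real where "\<rho> = (\<Prod>p\<in>P. 1 - 1 / real p)"

lemma \<rho>_pos: "\<rho> > 0"
  unfolding \<rho>_def
proof (rule prod_pos)
  fix p assume "p \<in> P"
  then have "p \<ge> 2" using P by (auto intro: prime_ge_2_nat)
  then show "0 < 1 - 1 / real p" by simp
qed

text \<open>Comparison with the telescoping terms \<open>1 / m - 1 / (m + 1)\<close>.\<close>

lemma sum_inverse_squares_le: "(\<Sum>p\<in>P. (1 / real p)\<^sup>2) \<le> 1 / w"
proof -
  have "(\<Sum>p\<in>{w<..w + m}. (1 / real p)\<^sup>2) \<le> 1 / w - 1 / (w + m)" for m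
  proof (induction m)
    case (Suc m)
    have pos: "real (w + m) > 0" using w by simp
    have "(1 / real (w + Suc m))\<^sup>2 \<le> 1 / (real (w + m) * real (w + Suc m))"
      unfolding power2_eq_square using pos by (simp add: frac_le mult_right_mono)
    also have "\<dots> = 1 / real (w + m) - 1 / real (w + Suc m)"
      using pos by (simp add: field_simps)
    finally have "(1 / real (w + Suc m))\<^sup>2 \<le> 1 / real (w + m) - 1 / real (w + Suc m)" .
    moreover have "{w<..w + Suc m} = insert (w + Suc m) {w<..w + m}" by auto
    ultimately show ?case using Suc by simp
  qed simp
  from this[of z] have "(\<Sum>p\<in>{w<..w + z}. (1 / real p)\<^sup>2) \<le> 1 / w"
    by (rule order.trans) simp
  moreover have "(\<Sum>p\<in>P. (1 / real p)\<^sup>2) \<le> (\<Sum>p\<in>{w<..w + z}. (1 / real p)\<^sup>2)"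
  proof (intro sum_mono2)
    show "P \<subseteq> {w<..w + z}"
      using P by (meson greaterThanAtMost_iff subsetI trans_le_add2)
  qed auto
  ultimately show ?thesis by linarith
qed

text \<open>The relative error at \<open>p\<close> is at most
  \<open>2 * k\<^sup>2 / p\<^sup>2\<close>, and only primes beyond \<open>w\<close> occur, so the
  errors multiply up to at most \<open>exp (2 * k\<^sup>2 / w)\<close>. The condition
  \<open>2 * k \<le> w\<close> keeps \<open>(1 - 1 / p) ^ k\<close> above
  \<open>1 / 2\<close>.\<close>

lemma rough_count:
  assumes E: "E \<subseteq> edges N R" and large: "2 * card E \<le> w"
  shows "\<bar>(\<Prod>p\<in>P. avg (\<lambda>_. p) I (\<lambda>x. \<Prod>e\<in>E. 1 - X p e x)) / \<rho> ^ card E - 1\<bar>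
    \<le> exp (2 * real (card E) ^ 2 / w) - 1"
proof -
  let ?k = "card E" and ?\<beta> = "\<lambda>p. avg (\<lambda>_. p) I (\<lambda>x. \<Prod>e\<in>E. 1 - X p e x)"
  define d where "d p = ?\<beta> p / (1 - 1 / p) ^ ?k - 1" for p
  have d: "\<bar>d p\<bar> \<le> 2 * (real ?k)\<^sup>2 * (1 / real p)\<^sup>2" if p: "p \<in> P" for p
  proof -
    have p': "p > 0" "w < p" using P[OF p] by auto
    have half: "1 / 2 \<le> (1 - 1 / real p) ^ ?k"
    proof -
      have "real ?k * (1 / real p) \<le> 1 / 2" using p' large by (simp add: field_simps)
      moreover have "1 - real ?k * (1 / real p) \<le> (1 - 1 / real p) ^ ?k"
        using p' by (intro power_one_minus_bounds(1)) auto
      ultimately show ?thesis by linarith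
    qed
    have "\<bar>d p\<bar> = \<bar>?\<beta> p - (1 - 1 / p) ^ ?k\<bar> / (1 - 1 / p) ^ ?k"
    proof -
      have pos: "0 < (1 - 1 / real p) ^ ?k" using half by linarith
      have gen: "b / a - 1 = (b - a) / a" if "a > 0" for a b :: real
        using that by (simp add: diff_divide_distrib)
      have "d p = (?\<beta> p - (1 - 1 / p) ^ ?k) / (1 - 1 / p) ^ ?k"
        unfolding d_def by (rule gen[OF pos])
      with pos show ?thesis by (simp only: abs_divide abs_of_pos)
    qed
    also have "\<dots> \<le> (real ?k / p)\<^sup>2 / (1 / 2)"
      using half by (intro frac_le local_density(1)[OF p E]) auto
    finally show ?thesis by (simp add: power_divide mult.commute)
  qed
  have "(\<Prod>p\<in>P. ?\<beta> p) / \<rho> ^ ?k = (\<Prod>p\<in>P. 1 + d p)"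
    unfolding \<rho>_def by (simp add: d_def prod_dividef prod_power_distrib)
  then have "\<bar>(\<Prod>p\<in>P. ?\<beta> p) / \<rho> ^ ?k - 1\<bar> \<le> (\<Prod>p\<in>P. 1 + \<bar>d p\<bar>) - 1"
    using norm_prod_minus1_le_prod_minus1[of d P] by simp
  also have "(\<Prod>p\<in>P. 1 + \<bar>d p\<bar>) \<le> (\<Prod>p\<in>P. exp (2 * (real ?k)\<^sup>2 * (1 / real p)\<^sup>2))"
  proof (intro prod_mono conjI)
    fix p assume "p \<in> P"
    from d[OF this] show "1 + \<bar>d p\<bar> \<le> exp (2 * (real ?k)\<^sup>2 * (1 / real p)\<^sup>2)"
      using exp_ge_add_one_self[of "2 * (real ?k)\<^sup>2 * (1 / real p)\<^sup>2"] by linarith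
  qed simp
  also have "\<dots> = exp (2 * (real ?k)\<^sup>2 * (\<Sum>p\<in>P. (1 / real p)\<^sup>2))"
    using P_fin by (simp add: exp_sum sum_distrib_left)
  also have "\<dots> \<le> exp (2 * (real ?k)\<^sup>2 * (1 / w))"
    using sum_inverse_squares_le by (simp add: mult_left_mono del: power_one_over times_divide_eq_right)
  finally show ?thesis by simp
qed

text \<open>On the full period \<open>\<Prod>P\<close> the averages of the rough indicator and of
  the weight \<open>4 ^ \<omega>\<close> factor over primes. The truncation gain
  \<open>(1 / 2) ^ r\<close> thus competes with an exponential of the sum of the reciprocals, not
  with the worst case of \<open>\<omega>\<close>.\<close>

lemma sieve_vs_rough:
  assumes E: "E \<subseteq> edges N R"
  shows "\<bar>avg (\<lambda>_. \<Prod>P) I (\<lambda>x. \<Prod>e\<in>E. sieve P r (t + W * psi N e x)) -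
      (\<Prod>p\<in>P. avg (\<lambda>_. p) I (\<lambda>x. \<Prod>e\<in>E. 1 - X p e x))\<bar>
    \<le> real (card E) * (1 / 2) ^ r * exp (4 ^ card E * real (card E) * (\<Sum>p\<in>P. 1 / p))"
proof -
  let ?k = "card E" and ?M = "\<Prod>P"
  have fin: "finite E" using E finite_subset[OF _ finite_edges] by blast
  have M: "?M > 0" using P_pos by (auto intro!: prod_pos)
  have pr: "prime p" if "p \<in> P" for p using P that by blast
  let ?b = "\<lambda>e x. \<Prod>p\<in>P. 1 - X p e x"
  let ?B = "\<lambda>e x. \<Prod>p\<in>P. if X p e x = 1 then 4 else (1::real)"
  have b: "of_bool (\<forall>p\<in>P. \<not> p dvd t + W * psi N e x) = ?b e x" for e x
    using P_fin by (auto simp: of_bool_def)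
  have B: "4 ^ card {p \<in> P. p dvd t + W * psi N e x} = ?B e x" for e x
    using P_fin by (simp add: prod.If_cases Int_def conj_commute)
  have bound: "\<bar>(\<Prod>e\<in>E. sieve P r (t + W * psi N e x)) - (\<Prod>e\<in>E. ?b e x)\<bar>
      \<le> real ?k * (1 / 2) ^ r * (\<Prod>e\<in>E. ?B e x)" for x
  proof (rule prod_diff_bound[OF fin])
    fix e
    note sb = sieve_bounds[OF P_fin r, of "t + W * psi N e x", unfolded b B]
    have "0 \<le> ?b e x" by (intro prod_nonneg) auto
    then show "0 \<le> sieve P r (t + W * psi N e x) \<and> sieve P r (t + W * psi N e x) \<le> ?B e x"
      "0 \<le> ?b e x \<and> ?b e x \<le> ?B e x"
      using sb by linarith+
    show "\<bar>sieve P r (t + W * psi N e x) - ?b e x\<bar> \<le> ?B e x * (1 / 2) ^ r" by (rule sb(3))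
  qed simp
  have per: "periodic p I (\<lambda>x. \<Prod>e\<in>E. h (X p e x))" if "p \<in> P" for p and h :: "real \<Rightarrow> real"
  proof (rule periodic_prod)
    fix e assume "e \<in> E"
    then have "periodic p I (X p e)" using E by (intro X_periodic) auto
    then show "periodic p I (\<lambda>x. h (X p e x))" unfolding periodic_def by metis
  qed
  have "(\<Prod>p\<in>P. avg (\<lambda>_. p) I (\<lambda>x. \<Prod>e\<in>E. 1 - X p e x)) = avg (\<lambda>_. ?M) I (\<lambda>x. \<Prod>p\<in>P. \<Prod>e\<in>E. 1 - X p e x)"
    using per[of _ "\<lambda>u. 1 - u"] pr P_fin by (intro avg_prod_primes[symmetric]) auto
  also have "\<dots> = avg (\<lambda>_. ?M) I (\<lambda>x. \<Prod>e\<in>E. ?b e x)"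
    by (intro avg_cong prod.swap)
  finally have eq1: "(\<Prod>p\<in>P. avg (\<lambda>_. p) I (\<lambda>x. \<Prod>e\<in>E. 1 - X p e x)) = avg (\<lambda>_. ?M) I (\<lambda>x. \<Prod>e\<in>E. ?b e x)" .
  have "avg (\<lambda>_. ?M) I (\<lambda>x. \<Prod>e\<in>E. ?B e x) = avg (\<lambda>_. ?M) I (\<lambda>x. \<Prod>p\<in>P. \<Prod>e\<in>E. if X p e x = 1 then 4 else 1)"
    by (intro avg_cong prod.swap)
  also have "\<dots> = (\<Prod>p\<in>P. avg (\<lambda>_. p) I (\<lambda>x. \<Prod>e\<in>E. if X p e x = 1 then 4 else 1))"
    using per[of _ "\<lambda>u. if u = 1 then 4 else 1"] pr P_fin by (intro avg_prod_primes) auto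
  also have "\<dots> \<le> (\<Prod>p\<in>P. exp (4 ^ ?k * real ?k * (1 / p)))"
  proof (intro prod_mono conjI)
    fix p assume p: "p \<in> P"
    show "avg (\<lambda>_. p) I (\<lambda>x. \<Prod>e\<in>E. if X p e x = 1 then 4 else 1) \<le> exp (4 ^ ?k * real ?k * (1 / p))"
      using local_density(2)[OF p E] exp_ge_add_one_self[of "4 ^ ?k * real ?k * (1 / p)"] by linarith
  qed (auto intro!: avg_nonneg prod_nonneg)
  also have "\<dots> = exp (4 ^ ?k * real ?k * (\<Sum>p\<in>P. 1 / p))"
    using P_fin by (simp add: exp_sum sum_distrib_left)
  finally have le: "avg (\<lambda>_. ?M) I (\<lambda>x. \<Prod>e\<in>E. ?B e x) \<le> exp (4 ^ ?k * real ?k * (\<Sum>p\<in>P. 1 / p))" .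
  have "\<bar>avg (\<lambda>_. ?M) I (\<lambda>x. \<Prod>e\<in>E. sieve P r (t + W * psi N e x)) - avg (\<lambda>_. ?M) I (\<lambda>x. \<Prod>e\<in>E. ?b e x)\<bar>
    \<le> avg (\<lambda>_. ?M) I (\<lambda>x. real ?k * (1 / 2) ^ r * (\<Prod>e\<in>E. ?B e x))"
    unfolding avg_diff[symmetric] by (intro order.trans[OF avg_abs_le] avg_mono bound)
  also have "\<dots> \<le> real ?k * (1 / 2) ^ r * exp (4 ^ ?k * real ?k * (\<Sum>p\<in>P. 1 / p))"
    unfolding avg_cmult by (intro mult_left_mono le) auto
  finally show ?thesis unfolding eq1 .
qed

text \<open>\<open>D\<close> is recovered from \<open>\<Prod>D\<close> by unique factorisation, and
  \<open>\<Prod>D \<le> z ^ r\<close>.\<close>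

lemma card_sieve_index:
  assumes "z \<ge> 1"
  shows "finite {D. D \<subseteq> P \<and> card D \<le> r}" "card {D. D \<subseteq> P \<and> card D \<le> r} \<le> z ^ r"
proof -
  let ?S = "{D. D \<subseteq> P \<and> card D \<le> r}"
  show fin: "finite ?S"
    using P_fin by (intro finite_subset[of ?S "Pow P"]) auto
  have elem: "D = {p \<in> P. p dvd \<Prod>D}" if "D \<in> ?S" for D
  proof -
    have D: "finite D" "D \<subseteq> P" using that P_fin finite_subset by blast+
    have "p \<in> D" if p: "p \<in> P" "p dvd \<Prod>D" for p
    proof -
      obtain q where "q \<in> D" "p dvd q"
        using prime_dvd_prod_iff[OF D(1), of p "\<lambda>q. q"] P[OF p(1)] p(2) by auto
      then show ?thesis using P p(1) D(2) primes_dvd_imp_eq by blast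
    qed
    then show ?thesis using D by auto
  qed
  have "inj_on \<Prod> ?S"
  proof (rule inj_onI)
    fix D D' assume D: "D \<in> ?S" "D' \<in> ?S" "\<Prod>D = \<Prod>D'"
    have "D = {p \<in> P. p dvd \<Prod>D}" by (rule elem[OF D(1)])
    also have "\<dots> = {p \<in> P. p dvd \<Prod>D'}" by (simp only: D(3))
    also have "\<dots> = D'" by (rule elem[OF D(2), symmetric])
    finally show "D = D'" .
  qed
  moreover have "\<Prod> ` ?S \<subseteq> {1..z ^ r}"
  proof clarify
    fix D assume D: "D \<subseteq> P" "card D \<le> r"
    have "\<Prod>D \<le> (\<Prod>p\<in>D. z)"
      using D P by (intro prod_mono) auto
    also have "\<dots> \<le> z ^ r" using assms D by (simp add: power_increasing)
    finally have "\<Prod>D \<le> z ^ r" .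
    moreover have "\<Prod>D > 0" using D P_pos by (intro prod_pos) auto
    ultimately show "\<Prod>D \<in> {1..z ^ r}" by simp
  qed
  ultimately show "card ?S \<le> z ^ r"
    using card_inj_on_le[of \<Prod> ?S "{1..z ^ r}"] by simp
qed

text \<open>Expanding the product gives at most \<open>z ^ (r * k)\<close> terms, each with a period
  of at most \<open>z ^ (r * k)\<close>; hence the exponent \<open>2 * r * k\<close>. Truncation
  thus makes boxes far shorter than \<open>\<Prod>P\<close> usable.\<close>

lemma sieve_box:
  assumes E: "E \<subseteq> edges N R" and z: "z \<ge> 1" and L: "L > 0"
  shows "\<bar>avg (\<lambda>_. L) I (\<lambda>x. \<Prod>e\<in>E. sieve P r (t + W * psi N e x)) -
      avg (\<lambda>_. \<Prod>P) I (\<lambda>x. \<Prod>e\<in>E. sieve P r (t + W * psi N e x))\<bar>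
    \<le> 2 * real (card I) * real z ^ (2 * r * card E) / L"
proof -
  let ?k = "card E" and ?M = "\<Prod>P" and ?S = "{D. D \<subseteq> P \<and> card D \<le> r}"
  let ?\<Delta> = "PiE E (\<lambda>_. ?S)"
  have fin: "finite E" using E finite_subset[OF _ finite_edges] by blast
  have M: "?M > 0" using P_pos by (auto intro!: prod_pos)
  define ind where "ind \<delta> x = (\<Prod>e\<in>E. \<Prod>p\<in>\<delta> e. X p e x)" for \<delta> x
  define sg where "sg \<delta> = (\<Prod>e\<in>E. (-1) ^ card (\<delta> e) :: real)" for \<delta> :: "(nat \<Rightarrow> nat) \<Rightarrow> nat set"
  have expand: "(\<Prod>e\<in>E. sieve P r (t + W * psi N e x)) = (\<Sum>\<delta>\<in>?\<Delta>. sg \<delta> * ind \<delta> x)" for x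
  proof -
    have "(\<Prod>e\<in>E. sieve P r (t + W * psi N e x)) =
      (\<Prod>e\<in>E. \<Sum>D\<in>?S. (-1) ^ card D * (\<Prod>p\<in>D. X p e x))"
      unfolding sieve_def
    proof (intro prod.cong sum.cong refl arg_cong2[where f = "(*)"])
      fix e D assume "D \<in> ?S"
      then have "finite D" using P_fin finite_subset by blast
      then show "of_bool (\<forall>p\<in>D. p dvd t + W * psi N e x) = (\<Prod>p\<in>D. X p e x)"
        by (auto simp: of_bool_def)
    qed
    also have "\<dots> = (\<Sum>\<delta>\<in>?\<Delta>. \<Prod>e\<in>E. (-1) ^ card (\<delta> e) * (\<Prod>p\<in>\<delta> e. X p e x))"
      by (rule prod_sum_PiE) (use fin card_sieve_index(1)[OF z] in auto)
    finally show ?thesis by (simp add: sg_def ind_def prod.distrib)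
  qed
  have term_bound: "\<bar>avg (\<lambda>_. L) I (ind \<delta>) - avg (\<lambda>_. ?M) I (ind \<delta>)\<bar> \<le>
      2 * real (card I) * real z ^ (r * ?k) / L" if \<delta>: "\<delta> \<in> ?\<Delta>" for \<delta>
  proof -
    have \<delta>e: "\<delta> e \<subseteq> P" "card (\<delta> e) \<le> r" "finite (\<delta> e)" if "e \<in> E" for e
      using PiE_mem[OF \<delta> that] P_fin finite_subset by auto
    define U where "U = (\<Union>e\<in>E. \<delta> e)"
    define q where "q = \<Prod>U"
    have U: "U \<subseteq> P" "finite U" using \<delta>e P_fin by (auto simp: U_def fin)
    have "card U \<le> (\<Sum>e\<in>E. card (\<delta> e))"
      unfolding U_def by (rule card_UN_le[OF fin])
    also have "\<dots> \<le> r * ?k" using sum_bounded_above[of E "\<lambda>e. card (\<delta> e)" r] \<delta>e by (simp add: mult.commute)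
    finally have "card U \<le> r * ?k" .
    have "q \<le> (\<Prod>p\<in>U. z)"
      unfolding q_def using U P by (intro prod_mono) auto
    also have "\<dots> \<le> z ^ (r * ?k)" using z \<open>card U \<le> r * ?k\<close> by (simp add: power_increasing)
    finally have q_le: "q \<le> z ^ (r * ?k)" .
    have q: "q > 0" unfolding q_def using U P_pos by (intro prod_pos) auto
    have per: "periodic q I (ind \<delta>)"
      unfolding ind_def
    proof (intro periodic_prod)
      fix e p assume "e \<in> E" "p \<in> \<delta> e"
      moreover from this have "p dvd q" using U(2) by (auto simp: q_def U_def)
      ultimately show "periodic q I (X p e)"
        using X_periodic[of e p] E by (auto intro: periodic_dvd)
    qed
    have bound: "\<bar>ind \<delta> x\<bar> \<le> 1" for x
      unfolding ind_def abs_prod by (intro prod_le_1) (auto intro!: prod_nonneg prod_le_1)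
    \<comment> \<open>A box whose side is a multiple of \<open>q\<close> has exactly the average
      over one period.\<close>
    have "q dvd ?M" unfolding q_def using U P_fin by (intro prod_dvd_prod_subset) auto
    then have "avg (\<lambda>_. ?M) I (ind \<delta>) = avg (\<lambda>_. q) I (ind \<delta>)"
      using avg_periodic_box[OF _ per bound q M] by simp
    then have "\<bar>avg (\<lambda>_. L) I (ind \<delta>) - avg (\<lambda>_. ?M) I (ind \<delta>)\<bar> \<le> real (card I) * (2 * real (L mod q) / real L)"
      using avg_periodic_box[OF _ per bound q L] by simp
    also have "\<dots> \<le> real (card I) * (2 * real z ^ (r * ?k) / real L)"
    proof (intro mult_left_mono divide_right_mono)
      have "L mod q \<le> z ^ (r * ?k)" using q q_le by (meson less_imp_le mod_less_divisor order.trans)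
      then have "real (L mod q) \<le> real (z ^ (r * ?k))" by (simp only: of_nat_le_iff)
      then show "real (L mod q) \<le> real z ^ (r * ?k)" by simp
    qed auto
    finally show ?thesis by (simp add: mult_ac)
  qed
  have sg: "\<bar>sg \<delta>\<bar> = 1" for \<delta> by (simp add: sg_def abs_prod power_abs)
  have eq: "avg (\<lambda>_. L) I (\<lambda>x. \<Prod>e\<in>E. sieve P r (t + W * psi N e x)) -
      avg (\<lambda>_. ?M) I (\<lambda>x. \<Prod>e\<in>E. sieve P r (t + W * psi N e x)) =
    (\<Sum>\<delta>\<in>?\<Delta>. sg \<delta> * (avg (\<lambda>_. L) I (ind \<delta>) - avg (\<lambda>_. ?M) I (ind \<delta>)))"
    unfolding expand avg_sum avg_cmult by (simp add: right_diff_distrib sum_subtractf)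
  have "\<bar>\<Sum>\<delta>\<in>?\<Delta>. sg \<delta> * (avg (\<lambda>_. L) I (ind \<delta>) - avg (\<lambda>_. ?M) I (ind \<delta>))\<bar> \<le>
    (\<Sum>\<delta>\<in>?\<Delta>. 2 * real (card I) * real z ^ (r * ?k) / L)"
    using term_bound by (intro order.trans[OF sum_abs] sum_mono) (simp add: abs_mult sg)
  also have "\<dots> = real (card ?\<Delta>) * (2 * real (card I) * real z ^ (r * ?k) / L)"
    by (rule sum_constant)
  also have "\<dots> \<le> real z ^ (r * ?k) * (2 * real (card I) * real z ^ (r * ?k) / L)"
  proof (rule mult_right_mono)
    have "card ?\<Delta> = card ?S ^ ?k"
      unfolding card_PiE[OF fin] by (rule prod_constant)
    also have "\<dots> \<le> (z ^ r) ^ ?k"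
      by (rule power_mono[OF card_sieve_index(2)[OF z]]) (rule le0)
    finally have "real (card ?\<Delta>) \<le> real ((z ^ r) ^ ?k)" by (simp only: of_nat_le_iff)
    then show "real (card ?\<Delta>) \<le> real z ^ (r * ?k)" by (simp only: of_nat_power power_mult)
  qed (intro divide_nonneg_nonneg mult_nonneg_nonneg zero_le_power of_nat_0_le_iff zero_le_numeral)
  also have "\<dots> = 2 * real (card I) * (real z ^ (r * ?k) * real z ^ (r * ?k)) / L"
    by simp
  also have "real z ^ (r * ?k) * real z ^ (r * ?k) = real z ^ (2 * r * ?k)"
    by (simp only: power_add[symmetric] mult_2 distrib_right)
  finally show ?thesis unfolding eq .
qed

theorem linear_forms_bound:
  assumes E: "E \<subseteq> edges N R" and large: "2 * card E \<le> w" and z: "z \<ge> 1" and L: "L > 0"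
  shows "\<bar>avg (\<lambda>_. L) I (\<lambda>x. \<Prod>e\<in>E. sieve P r (t + W * psi N e x) / \<rho>) - 1\<bar> \<le>
    (exp (2 * real (card E) ^ 2 / w) - 1) +
    (real (card E) * (1 / 2) ^ r * exp (4 ^ card E * real (card E) * (\<Sum>p\<in>P. 1 / p)) +
     2 * real (card I) * real z ^ (2 * r * card E) / L) / \<rho> ^ card E"
proof -
  let ?k = "card E"
  let ?a = "avg (\<lambda>_. L) I (\<lambda>x. \<Prod>e\<in>E. sieve P r (t + W * psi N e x))"
  let ?b = "\<Prod>p\<in>P. avg (\<lambda>_. p) I (\<lambda>x. \<Prod>e\<in>E. 1 - X p e x)"
  have pos: "\<rho> ^ ?k > 0" using \<rho>_pos by simp
  have "(\<lambda>x. \<Prod>e\<in>E. sieve P r (t + W * psi N e x) / \<rho>) =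
      (\<lambda>x. (1 / \<rho> ^ ?k) * (\<Prod>e\<in>E. sieve P r (t + W * psi N e x)))"
    by (simp add: prod_dividef)
  then have eq: "avg (\<lambda>_. L) I (\<lambda>x. \<Prod>e\<in>E. sieve P r (t + W * psi N e x) / \<rho>) - 1 =
      (?b / \<rho> ^ ?k - 1) + (?a - ?b) / \<rho> ^ ?k"
    by (simp only: avg_cmult) (simp add: diff_divide_distrib)
  have "\<bar>(?b / \<rho> ^ ?k - 1) + (?a - ?b) / \<rho> ^ ?k\<bar> \<le> \<bar>?b / \<rho> ^ ?k - 1\<bar> + \<bar>?a - ?b\<bar> / \<rho> ^ ?k"
    using pos abs_triangle_ineq[of "?b / \<rho> ^ ?k - 1" "(?a - ?b) / \<rho> ^ ?k"] by (simp only: abs_divide abs_of_pos)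
  also have "\<dots> \<le> (exp (2 * real ?k ^ 2 / w) - 1) +
    (real ?k * (1 / 2) ^ r * exp (4 ^ ?k * real ?k * (\<Sum>p\<in>P. 1 / p)) +
     2 * real (card I) * real z ^ (2 * r * ?k) / L) / \<rho> ^ ?k"
    using pos sieve_vs_rough[OF E] sieve_box[OF E z L]
    by (intro add_mono rough_count[OF E large] divide_right_mono) linarith+
  finally show ?thesis unfolding eq .
qed

end

section \<open>Choice of the parameters\<close>

lemma card_coprime_le:
  assumes "W > 0"
  shows "real (card {s \<in> {1..X}. coprime s W}) \<le> (real X / real W + 1) * real (totient W)"
proof -
  let ?\<phi> = "\<lambda>s. of_bool (coprime (Suc s) W) :: real"
  have per: "?\<phi> (s + W) = ?\<phi> s" for s
  proof -
    have "coprime (Suc s + W) W \<longleftrightarrow> coprime (Suc s) W"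
      by (simp only: coprime_iff_gcd_eq_1 gcd_add1)
    then show ?thesis by simp
  qed
  have count: "real (card {s \<in> {1..n}. coprime s W}) = (\<Sum>s<n. ?\<phi> s)" for n
  proof -
    have "real (card {s \<in> {1..n}. coprime s W}) = (\<Sum>s\<in>{1..n}. of_bool (coprime s W))"
      by (simp add: Int_def)
    also have "\<dots> = (\<Sum>s<n. ?\<phi> s)"
      using sum.atLeast1_atMost_eq[of "\<lambda>s. of_bool (coprime s W) :: real" n] by simp
    finally show ?thesis .
  qed
  have tot: "(\<Sum>s<W. ?\<phi> s) = real (totient W)"
    unfolding count[symmetric] totient_def totatives_def
    by (intro arg_cong[where f = real] arg_cong[where f = card]) auto
  have "(\<Sum>s<X. ?\<phi> s) \<le> (\<Sum>s<W * (X div W + 1) + 0. ?\<phi> s)"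
  proof (intro sum_mono2)
    have "X < W * (X div W + 1)"
      using assms by (metis dividend_less_times_div mult_Suc_right Suc_eq_plus1 add.commute)
    then show "{..<X} \<subseteq> {..<W * (X div W + 1) + 0}" by auto
  qed auto
  also have "\<dots> = real (X div W + 1) * real (totient W)"
    using sum_periodic_split[of ?\<phi> W "X div W + 1" 0] per tot by simp
  also have "\<dots> \<le> (real X / real W + 1) * real (totient W)"
  proof (rule mult_right_mono)
    have "real (X div W * W) \<le> real X" by (simp only: of_nat_le_iff div_times_less_eq_dividend)
    then show "real (X div W + 1) \<le> real X / real W + 1"
      using assms by (simp add: pos_le_divide_eq)
  qed simp
  finally show ?thesis unfolding count .
qed

text \<open>For each \<open>x\<close>, with \<open>s = W * psi N e x\<close>, every prime in
  \<open>(z + s, X]\<close> comes from a shift \<open>t\<close>, so the shifts together see at least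
  \<open>\<Delta>\<close> primes and one of them sees its share. Primes above
  \<open>z \<ge> w\<close> are coprime to \<open>W\<close>, which divides \<open>s\<close>; so the
  shifts can be taken coprime to \<open>W\<close>, and their number drops by the factor
  \<open>totient W / W\<close>. Later \<open>t > z\<close> makes all primes of the progression pass
  the sieve.\<close>

lemma exists_shift:
  fixes w z L X N R :: nat
  defines "W \<equiv> fact w"
  assumes wz: "w \<le> z" and L: "L > 0" and X: "W \<le> X" and e: "e \<in> edges N R"
    and \<Delta>: "0 < \<Delta>" "\<Delta> \<le> real (card (primes_le X)) - real z - real (W * (N * L))"
  shows "\<exists>t>z. \<Delta> / (2 * real X * (\<Prod>p\<in>primes_le w. 1 - 1 / real p)) \<le>
    avg (\<lambda>_. L) (verts N R) (\<lambda>x. of_bool (prime (t + W * psi N e x)))"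
proof -
  have W: "W > 0" by (simp add: W_def)
  define T where "T = {s \<in> {1..X}. z < s \<and> coprime s W}"
  have T_fin: "finite T" by (simp add: T_def)
  let ?V = "PiE (verts N R) (\<lambda>_. {..<L})"
  let ?A = "\<lambda>t. avg (\<lambda>_. L) (verts N R) (\<lambda>x. of_bool (prime (t + W * psi N e x)))"
  have "\<Delta> \<le> (\<Sum>t\<in>T. of_bool (prime (t + W * psi N e x)))" if x: "x \<in> ?V" for x
  proof -
    let ?s = "W * psi N e x"
    have "psi N e x \<le> (\<Sum>i<N. L)"
      unfolding psi_def
    proof (intro sum_mono)
      fix i assume "i \<in> {..<N}"
      then have "(i, e i) \<in> verts N R" using edges_lt[OF e] by (auto simp: verts_def)
      then show "x (i, e i) \<le> L" using x by (auto dest!: PiE_mem)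
    qed
    then have s_le: "?s \<le> W * (N * L)" by simp
    let ?Q = "{p. prime p \<and> z + ?s < p \<and> p \<le> X}"
    have "primes_le X \<subseteq> ?Q \<union> {1..z + ?s}"
      by (auto dest: prime_ge_1_nat)
    then have "card (primes_le X) \<le> card (?Q \<union> {1..z + ?s})"
      by (intro card_mono) (auto intro: finite_subset[of _ "{..X}"])
    also have "\<dots> \<le> card ?Q + (z + ?s)"
      using card_Un_le[of ?Q "{1..z + ?s}"] by simp
    finally have "real (card (primes_le X)) \<le> real (card ?Q + (z + ?s))"
      by (simp only: of_nat_le_iff)
    moreover have "real ?s \<le> real (W * (N * L))" using s_le by (simp only: of_nat_le_iff)
    ultimately have "\<Delta> \<le> real (card ?Q)"
      using \<Delta>(2) unfolding of_nat_add by linarith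
    also have "card ?Q \<le> card {t \<in> T. prime (t + ?s)}"
    proof (rule card_inj_on_le[of "\<lambda>p. p - ?s"])
      show "inj_on (\<lambda>p. p - ?s) ?Q"
        by (rule inj_on_diff_nat) auto
      show "(\<lambda>p. p - ?s) ` ?Q \<subseteq> {t \<in> T. prime (t + ?s)}"
      proof clarify
        fix p assume p: "prime p" "z + ?s < p" "p \<le> X"
        have "coprime p W"
          using p wz unfolding W_def
          by (intro prime_imp_coprime) (auto simp: prime_dvd_fact_iff)
        moreover have "p = (p - ?s) + psi N e x * W" using p by simp
        ultimately have "coprime (p - ?s) W"
          by (metis coprime_iff_gcd_eq_1 gcd.commute gcd_add_mult add.commute)
        then show "p - ?s \<in> T \<and> prime (p - ?s + ?s)"
          using p by (auto simp: T_def)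
      qed
    qed (use T_fin in auto)
    also have "real (card {t \<in> T. prime (t + ?s)}) = (\<Sum>t\<in>T. of_bool (prime (t + ?s)))"
      using T_fin by (simp add: Int_def)
    finally show ?thesis by simp
  qed
  then have "avg (\<lambda>_. L) (verts N R) (\<lambda>_. \<Delta>) \<le>
      avg (\<lambda>_. L) (verts N R) (\<lambda>x. \<Sum>t\<in>T. of_bool (prime (t + W * psi N e x)))"
    by (intro avg_mono)
  then have sum: "\<Delta> \<le> (\<Sum>t\<in>T. ?A t)"
    using L by (simp add: avg_const avg_sum)
  define D where "D = 2 * real X * (\<Prod>p\<in>primes_le w. 1 - 1 / real p)"
  have "real (card T) \<le> real (card {s \<in> {1..X}. coprime s W})"
    unfolding T_def of_nat_le_iff by (intro card_mono) auto
  also have "\<dots> \<le> (real X / real W + 1) * real (totient W)"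
    by (rule card_coprime_le[OF W])
  \<comment> \<open>\<open>W \<le> X\<close> absorbs the incomplete period.\<close>
  also have "\<dots> \<le> (2 * (real X / real W)) * real (totient W)"
    using X W by (intro mult_right_mono) (auto simp: field_simps)
  also have "real (totient W) = real W * (\<Prod>p\<in>primes_le w. 1 - 1 / real p)"
  proof -
    have "prime_factors W = primes_le w"
      by (auto simp: W_def in_prime_factors_iff prime_dvd_fact_iff)
    then show ?thesis using totient_formula2[of W] by simp
  qed
  finally have cardT: "real (card T) \<le> D"
    using W by (simp add: D_def)
  have "T \<noteq> {}" using sum \<Delta>(1) by auto
  then have D: "D > 0" using cardT T_fin by (meson card_gt_0_iff less_le_trans of_nat_0_less_iff)
  have "\<exists>t\<in>T. \<Delta> / D \<le> ?A t"
  proof (rule ccontr)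
    assume "\<not> (\<exists>t\<in>T. \<Delta> / D \<le> ?A t)"
    then have "(\<Sum>t\<in>T. ?A t) < (\<Sum>t\<in>T. \<Delta> / D)"
      using \<open>T \<noteq> {}\<close> T_fin by (intro sum_strict_mono) auto
    also have "\<dots> = real (card T) * (\<Delta> / D)" by simp
    also have "\<dots> \<le> D * (\<Delta> / D)"
      using cardT D \<Delta>(1) by (intro mult_right_mono) auto
    also have "\<dots> = \<Delta>" using D by simp
    finally show False using sum by simp
  qed
  then show ?thesis unfolding D_def T_def by auto
qed

text \<open>Extending the product to all \<open>m\<close> from \<open>2\<close> to \<open>w\<close>
  only decreases it, and then it telescopes.\<close>

lemma prod_primes_le_ge:
  assumes "w \<ge> 1"
  shows "1 / real w \<le> (\<Prod>p\<in>primes_le w. 1 - 1 / real p)"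
proof -
  have "(\<Prod>m\<in>{2..w}. 1 - 1 / real m) = 1 / real w"
    using assms
  proof (induction w rule: nat_induct_at_least)
    case (Suc w)
    then show ?case by (simp add: field_simps)
  qed simp
  moreover have "(\<Prod>m\<in>{2..w}. 1 - 1 / real m) \<le> (\<Prod>p\<in>primes_le w. 1 - 1 / real p)"
  proof -
    have "(\<Prod>m\<in>{2..w}. 1 - 1 / real m) =
        (\<Prod>m\<in>{2..w} - primes_le w. 1 - 1 / real m) * (\<Prod>p\<in>primes_le w. 1 - 1 / real p)"
      by (intro prod.subset_diff) (auto dest: prime_ge_2_nat)
    also have "\<dots> \<le> 1 * (\<Prod>p\<in>primes_le w. 1 - 1 / real p)"
      by (intro mult_right_mono prod_le_1 prod_nonneg) (auto dest: prime_ge_1_nat)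
    finally show ?thesis by simp
  qed
  ultimately show ?thesis by simp
qed

text \<open>Factor by factor from \<open>exp (- 2 * u) \<le> 1 - u\<close> for
  \<open>u \<le> 1 / 2\<close>.\<close>

lemma exp_minus_sum_le_prod:
  assumes "finite P" "\<And>p. p \<in> P \<Longrightarrow> p \<ge> (2 :: nat)"
  shows "exp (- 2 * (\<Sum>p\<in>P. 1 / real p)) \<le> (\<Prod>p\<in>P. 1 - 1 / real p)"
proof -
  have "exp (- 2 * (\<Sum>p\<in>P. 1 / real p)) = (\<Prod>p\<in>P. exp (- 2 * (1 / real p)))"
    using assms(1) by (simp add: sum_distrib_left exp_sum flip: sum_negf)
  also have "\<dots> \<le> (\<Prod>p\<in>P. 1 - 1 / real p)"
  proof (intro prod_mono conjI)
    fix p assume "p \<in> P"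
    then have p: "0 < 1 / real p" "1 / real p \<le> 1 / 2" using assms(2)[of p] by (auto simp: field_simps)
    have "1 / (1 - 1 / real p) = 1 + (1 / real p) / (1 - 1 / real p)"
      using p by (simp add: field_simps)
    also have "\<dots> \<le> 1 + (1 / real p) / (1 / 2)"
      using p by (intro add_left_mono frac_le) auto
    also have "\<dots> \<le> exp (2 * (1 / real p))"
      using exp_ge_add_one_self[of "2 * (1 / real p)"] by simp
    finally have "1 / exp (2 * (1 / real p)) \<le> 1 - 1 / real p"
      using p by (simp add: field_simps)
    then show "exp (- 2 * (1 / real p)) \<le> 1 - 1 / real p"
      by (simp add: exp_minus inverse_eq_divide)
  qed simp
  finally show ?thesis .
qed

text \<open>The conditions \<open>g1\<close> to \<open>g6\<close> on \<open>g\<close> below are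
  written in this shape, with exponents \<open>0\<close> and \<open>1\<close> where necessary, so
  that they hold together for large \<open>g\<close>.\<close>

lemma eventually_poly_less_exp:
  "\<forall>\<^sub>F g :: nat in sequentially. c * real g ^ B < 2 ^ g"
proof -
  have "(\<lambda>g. c * (real g ^ B / 2 ^ g)) \<longlonglongrightarrow> c * 0"
    by (intro tendsto_mult_left) real_asymp
  then have "\<forall>\<^sub>F g :: nat in sequentially. c * (real g ^ B / 2 ^ g) < 1"
    by (intro order_tendstoD(2)[where a = 1]) auto
  then show ?thesis by eventually_elim (simp add: field_simps)
qed

text \<open>
  The primes are taken up to \<open>X = 2 ^ j\<close>.  The truncation level \<open>r = C1 * g\<close> makes \<open>(1 / 2) ^ r\<close> absorb
  the factor \<open>exp (D * g)\<close> that arises from \<open>(\<Sum>p\<in>P. 1 / p) \<le> 9 * g\<close>, and \<open>L\<close> exceeds the number of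
  terms of a product of truncated sieves times their moduli.
\<close>

locale parameters =
  fixes N R g K M D C1 C5 w y z r L j W :: nat and C4 :: real and P :: "nat set"
  defines "K \<equiv> Suc R ^ N" and "M \<equiv> R ^ N" and "D \<equiv> 9 * (4 ^ K * K + 2 * K)"
    and "C1 \<equiv> 2 * D + 2" and "C5 \<equiv> 2 * C1 * K + 4" and "C4 \<equiv> 4 * real K ^ 2 + real K + 2 * real (N * Suc R)"
    and "w \<equiv> 2 ^ g" and "y \<equiv> 4 ^ g" and "z \<equiv> 2 ^ y" and "r \<equiv> C1 * g"
    and "L \<equiv> z ^ (2 * r * K + 1)" and "j \<equiv> y * (2 * r * K + 4)" and "W \<equiv> fact w"
    and "P \<equiv> {p. prime p \<and> w < p \<and> p \<le> z}"
  assumes NR: "N \<ge> 1" "R \<ge> 1" and g: "g \<ge> 1"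
    and g1: "2 * real K ^ 2 * real g ^ 0 < 2 ^ g"
    and g2: "real (36 * K + 1) * real g ^ 1 < 2 ^ g"
    and g3: "real (2 * (N + 2) * C5) * real g ^ 1 < 2 ^ g"
    and g4: "C4 * real g ^ 0 < 2 ^ g"
    and g5: "(8 * real M * (8 * real C5) ^ M) * real g ^ M < 2 ^ g"
    and g6: "(4 ^ 2 ^ N * C4 * (4 * real M) ^ 2 ^ N * (8 * real C5) ^ (M * 2 ^ N)) * real g ^ (M * 2 ^ N) < 2 ^ g"
begin

lemma K_ge: "K \<ge> 1" by (simp add: K_def)

lemma w_pos: "w \<ge> 1" by (simp add: w_def)

lemma y_eq: "y = 2 ^ g * 2 ^ g"
  by (simp add: y_def flip: power_mult_distrib)

lemma z_eq: "z = 2 ^ 2 ^ (2 * g)"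
  by (simp add: z_def y_def power_mult)

lemma y_lt_z: "y < z" by (simp add: z_def)

lemma z_pos: "z \<ge> 1" by (simp add: z_def)

lemma L_pos: "L > 0" by (simp add: L_def z_def)

lemma W_le_z: "W \<le> z"
proof -
  have "W \<le> w ^ w"
    using fact_le_power[of w, where 'a = nat] by (simp add: W_def)
  also have "\<dots> = 2 ^ (g * 2 ^ g)" by (simp add: w_def power_mult)
  also have "\<dots> \<le> 2 ^ y"
    unfolding y_eq by (intro power_increasing mult_right_mono) (auto intro: less_imp_le)
  finally show ?thesis by (simp add: z_def)
qed

lemma w_le_z: "w \<le> z"
proof -
  have "w \<le> fact w" by (rule fact_ge_self)
  then show ?thesis using W_le_z by (simp add: W_def)
qed

lemma P_fin: "finite P"
  by (rule finite_subset[of _ "primes_le z"]) (auto simp: P_def)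

lemma P_coprime: "p \<in> P \<Longrightarrow> prime p \<and> coprime p W \<and> w < p \<and> p \<le> z"
  unfolding P_def W_def by (auto intro!: prime_imp_coprime simp: prime_dvd_fact_iff)

lemma is_rough_forms: "rough_forms N W w z r P"
proof
  show "even r" by (simp add: r_def C1_def)
qed (use NR w_pos P_fin P_coprime in auto)

sublocale rf: rough_forms N "Suc R" W t w z r P for t
  by (rule is_rough_forms)

text \<open>\<open>h = 2 * g\<close> in \<open>sum_inverse_primes_le\<close> gives
  \<open>8 * g + 1\<close>; this is the \<open>9\<close> in \<open>D\<close>.\<close>

lemma sum_P: "(\<Sum>p\<in>P. 1 / real p) \<le> 9 * real g"
proof -
  have "(\<Sum>p\<in>P. 1 / real p) \<le> (\<Sum>p\<in>primes_le z. 1 / real p)"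
    by (intro sum_mono2) (auto simp: P_def)
  also have "\<dots> \<le> 4 * real (2 * g) + 1"
    unfolding z_eq by (rule sum_inverse_primes_le)
  finally show ?thesis using g by simp
qed

lemma ln_z: "real y / 2 \<le> ln (real z)"
proof -
  have "ln (real z) = real y * ln 2" by (simp add: z_def ln_realpow)
  moreover have "1 / 2 \<le> ln (2::real)" using ln2_ge_two_thirds by simp
  then have "real y * (1 / 2) \<le> real y * ln 2" by (intro mult_left_mono) auto
  ultimately show ?thesis by simp
qed

lemma prod_primes_le_z: "(\<Prod>p\<in>primes_le z. 1 - 1 / real p) = rf.\<rho> * (\<Prod>p\<in>primes_le w. 1 - 1 / real p)"
proof -
  have "P = primes_le z - primes_le w" by (auto simp: P_def)
  then show ?thesis
    unfolding rf.\<rho>_def using w_le_z by (simp only:) (intro prod.subset_diff, auto)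
qed

lemma prod_primes_le_w_pos: "0 < (\<Prod>p\<in>primes_le w. 1 - 1 / real p)"
  using prod_primes_le_ge[OF w_pos] w_pos by (smt (verit) divide_pos_pos of_nat_0_less_iff less_le_trans zero_less_one)

text \<open>The two products together run over all primes up to \<open>z\<close>, so they are at
  most \<open>1 / ln z\<close>.\<close>

lemma prod_z_le: "rf.\<rho> * (\<Prod>p\<in>primes_le w. 1 - 1 / real p) * real y \<le> 2"
proof -
  have "(\<Prod>p\<in>primes_le z. 1 - 1 / real p) * (real y / 2) \<le> (\<Prod>p\<in>primes_le z. 1 - 1 / real p) * ln (real z)"
    using prod_primes_le_w_pos rf.\<rho>_pos
    by (intro mult_left_mono ln_z) (simp add: prod_primes_le_z)
  also have "\<dots> \<le> 1" by (rule prod_one_minus_inverse_primes_le[OF z_pos])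
  finally show ?thesis by (simp add: prod_primes_le_z)
qed

text \<open>Dividing out the primes up to \<open>w\<close> costs at most a factor
  \<open>w = 2 ^ g\<close>, while \<open>y = 4 ^ g\<close>; the choice \<open>y = w\<^sup>2\<close>
  leaves \<open>2 ^ g\<close>.\<close>

lemma \<rho>_le: "rf.\<rho> \<le> 2 / 2 ^ g"
proof -
  have "rf.\<rho> * (1 / real w) * real y \<le> rf.\<rho> * (\<Prod>p\<in>primes_le w. 1 - 1 / real p) * real y"
    using rf.\<rho>_pos prod_primes_le_ge[OF w_pos] by (intro mult_right_mono mult_left_mono) auto
  also note prod_z_le
  finally have "rf.\<rho> * 2 ^ g \<le> 2" by (simp add: w_def y_eq)
  then show ?thesis by (simp add: field_simps)
qed

lemma exp_le_pow: "exp (real n) \<le> 4 ^ n"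
proof -
  have "exp (real n) = exp 1 ^ n" by (simp flip: exp_of_nat_mult)
  also have "\<dots> \<le> 4 ^ n" using exp_le by (intro power_mono) auto
  finally show ?thesis .
qed

text \<open>The summands of \<open>C4\<close> belong to the errors of the local factors, of the
  truncation and of the incomplete periods. The last two are divided by a power of
  \<open>\<rho>\<close>, which costs \<open>exp (2 * K * S)\<close> with \<open>S\<close> the sum of
  the reciprocals; for the truncation the exponents add up to at most \<open>D * g\<close>.\<close>

lemma linear_forms:
  assumes E: "E \<subseteq> edges N (Suc R)"
  shows "\<bar>avg (\<lambda>_. L) (verts N (Suc R)) (\<lambda>x. \<Prod>e\<in>E. sieve P r (t + W * psi N e x) / rf.\<rho>) - 1\<bar> \<le> C4 / 2 ^ g"
proof -
  let ?k = "card E" and ?S = "\<Sum>p\<in>P. 1 / real p"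
  have S_nonneg: "0 \<le> ?S" by (intro sum_nonneg) auto
  have k: "?k \<le> K"
    using card_mono[OF finite_edges E] by (simp add: card_edges K_def)
  have K1: "2 * real K ^ 2 / 2 ^ g \<le> 1" using g1 by (simp add: field_simps)
  have large: "2 * ?k \<le> w"
  proof -
    have "real (2 * K) \<le> 2 * real K ^ 2" using K_ge by (simp add: power2_eq_square)
    also have "\<dots> \<le> real w" using g1 by (simp add: w_def)
    finally have "2 * K \<le> w" by (simp only: of_nat_le_iff)
    then show ?thesis using k by simp
  qed
  have t1: "exp (2 * real ?k ^ 2 / w) - 1 \<le> 4 * real K ^ 2 / 2 ^ g"
  proof -
    have "2 * real ?k ^ 2 / w \<le> 2 * real K ^ 2 / 2 ^ g"
      using k by (simp add: w_def divide_right_mono power_mono)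
    then have "exp (2 * real ?k ^ 2 / w) \<le> exp (2 * real K ^ 2 / 2 ^ g)" by simp
    also have "\<dots> \<le> 1 + 2 * real K ^ 2 / 2 ^ g + (2 * real K ^ 2 / 2 ^ g)\<^sup>2"
      by (rule exp_bound) (use K1 in auto)
    also have "(2 * real K ^ 2 / 2 ^ g)\<^sup>2 \<le> 2 * real K ^ 2 / 2 ^ g"
    proof -
      have "u\<^sup>2 \<le> u" if "0 \<le> u" "u \<le> 1" for u :: real
        using that by (simp add: power2_eq_square mult_left_le_one_le)
      then show ?thesis using K1 by simp
    qed
    finally show ?thesis by simp
  qed
  have rho: "1 / rf.\<rho> ^ ?k \<le> exp (2 * real K * ?S)"
  proof -
    have "exp (- 2 * ?S) \<le> rf.\<rho>"
      unfolding rf.\<rho>_def by (intro exp_minus_sum_le_prod P_fin) (auto simp: P_def dest: prime_ge_2_nat)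
    then have "exp (- 2 * ?S) ^ ?k \<le> rf.\<rho> ^ ?k" by (intro power_mono) auto
    then have "1 / rf.\<rho> ^ ?k \<le> 1 / exp (- 2 * ?S) ^ ?k"
      using rf.\<rho>_pos by (intro divide_left_mono) auto
    also have "\<dots> = exp (2 * real ?k * ?S)"
      by (simp add: exp_minus power_inverse exp_of_nat_mult[symmetric] field_simps)
    also have "\<dots> \<le> exp (2 * real K * ?S)"
      using k S_nonneg by (simp add: mult_right_mono)
    finally show ?thesis .
  qed
  let ?b = "real ?k * (1 / 2) ^ r * exp (4 ^ ?k * real ?k * ?S)"
  let ?c = "2 * real (card (verts N (Suc R))) * real z ^ (2 * r * ?k) / L"
  have t2: "?b * exp (2 * real K * ?S) \<le> real K / 2 ^ g"
  proof -
    have "?b * exp (2 * real K * ?S) \<le> real K * (1 / 2) ^ r * exp (4 ^ K * real K * ?S) * exp (2 * real K * ?S)"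
      using k S_nonneg by (intro mult_right_mono mult_mono) (auto intro!: mult_mono power_increasing mult_right_mono)
    also have "\<dots> = real K * (1 / 2) ^ r * exp ((4 ^ K * real K + 2 * real K) * ?S)"
      by (simp add: distrib_right exp_add)
    also have "\<dots> \<le> real K * (1 / 2) ^ r * exp (real (D * g))"
      using mult_left_mono[OF sum_P, of "4 ^ K * real K + 2 * real K"]
      by (intro mult_left_mono) (auto simp: D_def algebra_simps)
    also have "\<dots> \<le> real K * (1 / 2) ^ r * 4 ^ (D * g)"
      by (intro mult_left_mono exp_le_pow) auto
    \<comment> \<open>\<open>C1 = 2 * D + 2\<close> makes \<open>(1 / 2) ^ r\<close> cancel
      \<open>4 ^ (D * g)\<close> and leave \<open>(1 / 2) ^ (2 * g)\<close>.\<close>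
    also have "\<dots> = real K * ((1 / 2) ^ (2 * D * g) * 4 ^ (D * g)) * (1 / 2) ^ (2 * g)"
      by (simp add: r_def C1_def distrib_right power_add)
    also have "(1 / 2) ^ (2 * D * g) * 4 ^ (D * g) = (1::real)"
    proof -
      have "(1 / 2 :: real) ^ (2 * D * g) = (1 / 4) ^ (D * g)"
        by (simp only: mult.assoc power_mult) (simp add: power2_eq_square)
      then show ?thesis by (simp flip: power_mult_distrib)
    qed
    also have "real K * 1 * (1 / 2) ^ (2 * g) \<le> real K * 1 * (1 / 2) ^ g"
      by (intro mult_left_mono power_decreasing) auto
    finally show ?thesis by (simp add: power_one_over)
  qed
  \<comment> \<open>The additional factor \<open>z\<close> in \<open>L\<close> survives the
    cancellation of the periods and outweighs \<open>exp (18 * K * g)\<close>.\<close>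
  have t3: "?c * exp (2 * real K * ?S) \<le> 2 * real (N * Suc R) / 2 ^ g"
  proof -
    have "real z ^ (2 * r * ?k) \<le> real z ^ (2 * r * K)"
      using k z_pos by (intro power_increasing) auto
    then have "?c \<le> 2 * real (N * Suc R) * real z ^ (2 * r * K) / L"
      by (simp add: verts_def divide_right_mono mult_left_mono)
    also have "\<dots> = 2 * real (N * Suc R) * (1 / real z)"
      using z_pos by (simp add: L_def)
    finally have "?c * exp (2 * real K * ?S) \<le> 2 * real (N * Suc R) * (1 / real z) * exp (real (18 * K * g))"
      using mult_left_mono[OF sum_P, of "2 * real K"]
      by (intro mult_mono) (auto simp: mult_ac)
    also have "\<dots> \<le> 2 * real (N * Suc R) * (1 / real z) * 4 ^ (18 * K * g)"
      by (intro mult_left_mono exp_le_pow) auto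
    also have "\<dots> = 2 * real (N * Suc R) * (4 ^ (18 * K * g) / real z)" by simp
    also have "\<dots> \<le> 2 * real (N * Suc R) * (1 / 2 ^ g)"
    proof (rule mult_left_mono)
      have "real (36 * K * g + g) \<le> real (2 ^ g)" using g2 by (simp add: algebra_simps)
      then have "36 * K * g + g \<le> 2 ^ g" by (simp only: of_nat_le_iff)
      also have "\<dots> \<le> y" by (simp add: y_eq)
      finally have "(2::real) ^ (36 * K * g + g) \<le> 2 ^ y" by (intro power_increasing) auto
      moreover have "(4::real) ^ (18 * K * g) = 2 ^ (36 * K * g)"
        using power_mult[of "2::real" 2 "18 * K * g"] by (simp add: mult.assoc)
      ultimately show "4 ^ (18 * K * g) / real z \<le> 1 / 2 ^ g"
        by (simp add: z_def power_add field_simps)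
    qed simp
    finally show ?thesis by simp
  qed
  have "(?b + ?c) / rf.\<rho> ^ ?k = (?b + ?c) * (1 / rf.\<rho> ^ ?k)" by simp
  also have "\<dots> \<le> (?b + ?c) * exp (2 * real K * ?S)"
    by (intro mult_left_mono rho) auto
  also have "\<dots> \<le> real K / 2 ^ g + 2 * real (N * Suc R) / 2 ^ g"
    unfolding distrib_right by (intro add_mono t2 t3)
  finally have "exp (2 * real ?k ^ 2 / w) - 1 + (?b + ?c) / rf.\<rho> ^ ?k \<le> C4 / 2 ^ g"
    using t1 by (simp add: C4_def add_divide_distrib)
  then show ?thesis
    using rf.linear_forms_bound[OF E large z_pos L_pos, where t = t] by linarith
qed

section \<open>The relative density of the primes\<close>

lemma C5_g: "2 * r * K + 4 \<le> C5 * g"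
  using g by (simp add: r_def C5_def algebra_simps)

lemma j_pos: "j \<ge> 1"
  by (simp add: j_def y_def)

text \<open>Here \<open>2 ^ j = z ^ (2 * r * K + 4)\<close>. As \<open>W \<le> z\<close>, the extent
  of the forms is at most \<open>N * q\<close> with \<open>q = z ^ (2 * r * K + 2)\<close>, and the
  spare \<open>z * z\<close> pays for \<open>2 * j * (N + 2)\<close>. So small primes and boundary
  effects use up at most half of Chebyshev's bound.\<close>

lemma j_bound: "2 * j * (1 + z + W * (N * L)) \<le> 2 ^ j"
proof -
  define q where "q = z ^ (2 * r * K + 2)"
  have "real (2 * (N + 2) * C5 * g) \<le> real (2 ^ g)" using g3 by simp
  then have "2 * (N + 2) * (C5 * g) \<le> 2 ^ g" by (simp only: of_nat_le_iff mult.assoc)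
  then have "2 * (N + 2) * (2 * r * K + 4) \<le> 2 ^ g"
    using C5_g by (meson mult_le_mono2 order.trans)
  also have "\<dots> \<le> y" by (simp add: y_eq)
  finally have "2 * (N + 2) * (2 * r * K + 4) \<le> z" using y_lt_z by simp
  then have "2 * (N + 2) * (2 * r * K + 4) * y \<le> z * z"
    using y_lt_z by (intro mult_le_mono) auto
  then have 1: "2 * j * (N + 2) \<le> z * z" by (simp add: j_def mult_ac)
  have "z \<le> q" "1 \<le> q" unfolding q_def using z_pos by (auto intro: self_le_power simp del: power_add_numeral2 power_Suc)
  moreover have "W * (N * L) \<le> N * q"
  proof -
    have "W * L \<le> z * L" using W_le_z by (rule mult_le_mono1)
    also have "z * L = q" by (simp add: L_def q_def)
    finally show ?thesis by (metis mult.left_commute mult_le_mono2)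
  qed
  moreover have "(N + 2) * q = q + q + N * q" by (simp add: algebra_simps)
  ultimately have 2: "1 + z + W * (N * L) \<le> (N + 2) * q" by linarith
  have "2 * j * (1 + z + W * (N * L)) \<le> 2 * j * ((N + 2) * q)"
    using 2 by (rule mult_le_mono2)
  also have "\<dots> = (2 * j * (N + 2)) * q" by (simp only: mult.assoc)
  also have "\<dots> \<le> (z * z) * q" using 1 by (rule mult_le_mono1)
  also have "\<dots> = z ^ (2 * r * K + 4)" by (simp add: q_def power_add power2_eq_square power4_eq_xxxx)
  also have "\<dots> = 2 ^ j" by (simp add: z_def j_def power_mult)
  finally show ?thesis .
qed

text \<open>The remaining half is \<open>2 ^ j / (2 * j)\<close>. After normalisation by
  \<open>prod_z_le\<close> the density is at least \<open>y / (8 * j)\<close>, and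
  \<open>j / y = 2 * r * K + 4\<close> is linear in \<open>g\<close>: this is the slowly decreasing
  \<open>\<sigma>\<close>.\<close>

lemma good_shift:
  assumes e: "e \<in> edges N (Suc R)"
  shows "\<exists>t>z. 1 / (8 * real C5 * real g) \<le>
    avg (\<lambda>_. L) (verts N (Suc R)) (\<lambda>x. of_bool (prime (t + W * psi N e x)) / rf.\<rho>)"
proof -
  let ?X = "(2::nat) ^ j" and ?\<Delta> = "real (2 ^ j) / (2 * real j)"
  have j: "real j > 0" using j_pos by simp
  have "real (2 * j * (1 + z + W * (N * L))) \<le> real (2 ^ j)"
    using j_bound by (simp only: of_nat_le_iff)
  then have 1: "real 1 + real z + real (W * (N * L)) \<le> ?\<Delta>"
    using j by (simp add: pos_le_divide_eq algebra_simps)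
  have "real (2 ^ j) \<le> real (1 + j * card (primes_le (2 ^ j)))"
    using card_primes_le_ge[OF j_pos] by (simp only: of_nat_le_iff)
  then have "real (2 ^ j) / real j \<le> real (card (primes_le (2 ^ j))) + 1 / real j"
    using j by (simp add: pos_divide_le_eq algebra_simps)
  moreover have "1 / real j \<le> 1" using j_pos by simp
  moreover have "real (2 ^ j) / real j = ?\<Delta> + ?\<Delta>" by simp
  ultimately have \<Delta>: "?\<Delta> \<le> real (card (primes_le ?X)) - real z - real (W * (N * L))"
    using 1 by linarith
  have "W \<le> 2 ^ j"
  proof -
    have "W \<le> 2 ^ y" using W_le_z by (simp add: z_def)
    also have "\<dots> \<le> 2 ^ j" by (intro power_increasing) (auto simp: j_def)
    finally show ?thesis .
  qed
  then obtain t where t: "t > z" "?\<Delta> / (2 * real ?X * (\<Prod>p\<in>primes_le w. 1 - 1 / real p)) \<le>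
      avg (\<lambda>_. L) (verts N (Suc R)) (\<lambda>x. of_bool (prime (t + W * psi N e x)))"
    using exists_shift[OF w_le_z L_pos _ e, of ?X ?\<Delta>] \<Delta> j unfolding W_def by auto
  let ?\<pi> = "\<Prod>p\<in>primes_le w. 1 - 1 / real p"
  have \<pi>: "?\<pi> > 0" by (rule prod_primes_le_w_pos)
  have y: "real y > 0" by (simp add: y_def)
  have "1 / (8 * real C5 * real g) \<le> 1 / (8 * real (2 * r * K + 4))"
  proof (rule frac_le)
    have "real (2 * r * K + 4) \<le> real (C5 * g)" using C5_g by (simp only: of_nat_le_iff)
    then show "8 * real (2 * r * K + 4) \<le> 8 * real C5 * real g" by simp
  qed (simp_all add: add_nonneg_pos)
  also have "\<dots> = real y / (8 * real j)" using y by (simp add: j_def)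
  also have "\<dots> \<le> 1 / (4 * real j * (rf.\<rho> * ?\<pi>))"
    using prod_z_le rf.\<rho>_pos \<pi> j by (simp add: field_simps)
  also have "\<dots> = (?\<Delta> / (2 * real ?X * ?\<pi>)) / rf.\<rho>"
    using \<pi> j rf.\<rho>_pos by (simp add: field_simps)
  also have "\<dots> \<le> avg (\<lambda>_. L) (verts N (Suc R)) (\<lambda>x. of_bool (prime (t + W * psi N e x))) / rf.\<rho>"
    using t(2) rf.\<rho>_pos by (intro divide_right_mono) auto
  also have "\<dots> = avg (\<lambda>_. L) (verts N (Suc R)) (\<lambda>x. of_bool (prime (t + W * psi N e x)) / rf.\<rho>)"
    using avg_cmult[of "\<lambda>_. L" "verts N (Suc R)" "1 / rf.\<rho>"] by simp
  finally show ?thesis using t(1) by blast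
qed

lemma pattern:
  assumes H: "H \<subseteq> edges N R"
  shows "\<exists>t x. \<forall>e\<in>edges N R. prime (t + W * psi N e x) \<longleftrightarrow> e \<in> H"
proof -
  let ?e = "\<lambda>i\<in>{..<N}. R"
  have "?e \<in> edges N (Suc R)" by (auto simp: edges_def)
  from good_shift[OF this] obtain t where t: "t > z"
    "1 / (8 * real C5 * real g) \<le> avg (\<lambda>_. L) (verts N (Suc R)) (\<lambda>x. of_bool (prime (t + W * psi N ?e x)) / rf.\<rho>)"
    by blast
  define \<nu> where "\<nu> s = sieve P r (t + W * s) / rf.\<rho>" for s
  define F where "F s = of_bool (prime (t + W * s)) / rf.\<rho>" for s
  define \<sigma> where "\<sigma> = 1 / (8 * real C5 * real g)"
  \<comment> \<open>Replacing edges then loses at most \<open>M * \<tau> = \<sigma> ^ M / 4\<close>,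
    and by \<open>g5\<close> additional prime edges lose less than \<open>\<sigma> ^ M / 2\<close>.
    Condition \<open>g6\<close> says that \<open>\<eta>\<close> is small enough for this
    \<open>\<tau>\<close>.\<close>
  define \<tau> where "\<tau> = \<sigma> ^ M / (4 * real M)"
  have C4_pos: "C4 > 0" using K_ge by (simp add: C4_def add_pos_nonneg)
  have M: "real M > 0" using NR by (simp add: M_def)
  have "C5 > 0" by (simp add: C5_def)
  then have "real C5 > 0" by (simp only: of_nat_0_less_iff)
  then have Cg: "real C5 * real g > 0" using g by simp
  have \<sigma>_pos: "\<sigma> > 0" using Cg by (simp add: \<sigma>_def mult.assoc)
  have ps: "pseudorandom N R L \<nu> F (C4 / 2 ^ g)"
  proof
    show "L > 0" by (rule L_pos)
    show "0 \<le> F s" for s using rf.\<rho>_pos by (simp add: F_def)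
    show "F s \<le> \<nu> s" for s
    proof -
      have "of_bool (prime (t + W * s)) \<le> (of_bool (\<forall>p\<in>P. \<not> p dvd t + W * s) :: real)"
      proof (cases "prime (t + W * s)")
        case True
        \<comment> \<open>A prime \<open>t + W * s\<close> with a divisor in \<open>P\<close> would
          equal it, but it exceeds \<open>z\<close> because \<open>t > z\<close>.\<close>
        have "\<not> p dvd t + W * s" if "p \<in> P" for p
        proof
          assume "p dvd t + W * s"
          then have "p = t + W * s" using True that primes_dvd_imp_eq by (auto simp: P_def)
          then show False using that t(1) by (auto simp: P_def)
        qed
        then show ?thesis by simp
      qed simp
      also have "\<dots> \<le> sieve P r (t + W * s)"
        by (rule sieve_bounds(1)[OF P_fin]) (simp add: r_def C1_def)
      finally show ?thesis
        unfolding F_def \<nu>_def using rf.\<rho>_pos by (intro divide_right_mono) auto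
    qed
    show "C4 / 2 ^ g \<le> 1" using g4 by (simp add: field_simps)
    show "\<bar>avg (\<lambda>_. L) (verts N (Suc R)) (\<lambda>x. \<Prod>e\<in>E. \<nu> (psi N e x)) - 1\<bar> \<le> C4 / 2 ^ g"
      if "E \<subseteq> edges N (Suc R)" for E
      unfolding \<nu>_def by (rule linear_forms[OF that])
  qed
  have \<sigma>M: "\<sigma> ^ M = 1 / ((8 * real C5) ^ M * real g ^ M)"
    by (simp add: \<sigma>_def power_divide power_mult_distrib)
  have "4 ^ 2 ^ N * (C4 / 2 ^ g) \<le> \<tau> ^ 2 ^ N"
  proof -
    define A where "A = (4 * real M) ^ 2 ^ N * (8 * real C5) ^ (M * 2 ^ N) * real g ^ (M * 2 ^ N)"
    have A: "A > 0" using M Cg unfolding A_def by (auto simp: zero_less_mult_iff)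
    have \<tau>: "\<tau> ^ 2 ^ N = 1 / A"
      unfolding \<tau>_def \<sigma>M A_def by (simp add: power_divide power_mult_distrib power_mult mult_ac)
    have "4 ^ 2 ^ N * C4 * A \<le> 2 ^ g" using g6 by (simp add: A_def mult_ac)
    then show ?thesis unfolding \<tau> using A by (simp add: field_simps)
  qed
  moreover have "real (R ^ N) * \<tau> + 2 * real (R ^ N) * rf.\<rho> < \<sigma> ^ (R ^ N)"
  proof -
    have "2 * real M * rf.\<rho> \<le> 2 * real M * (2 / 2 ^ g)"
      using \<rho>_le by (intro mult_left_mono) auto
    also have "\<dots> < \<sigma> ^ M / 2"
    proof -
      have "(8 * real C5) ^ M * real g ^ M > 0" using Cg by (auto simp: zero_less_mult_iff)
      then show ?thesis using g5 unfolding \<sigma>M by (simp add: field_simps)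
    qed
    finally have "2 * real M * rf.\<rho> < \<sigma> ^ M / 2" .
    moreover have "real M * \<tau> = \<sigma> ^ M / 4" using M by (simp add: \<tau>_def)
    moreover have "\<sigma> ^ M > 0" using \<sigma>_pos by simp
    ultimately show ?thesis unfolding M_def[symmetric] by linarith
  qed
  ultimately have "\<exists>x. \<forall>e\<in>edges N R. prime (t + W * psi N e x) \<longleftrightarrow> e \<in> H"
    using \<sigma>_pos t(2) M rf.\<rho>_pos H
    by (intro pseudorandom.exists_pattern[OF ps, of \<sigma> \<tau> rf.\<rho> "\<lambda>s. prime (t + W * s)"])
      (auto simp: F_def \<sigma>_def \<tau>_def simp del: restrict_apply)
  then show ?thesis by blast
qed

end

theorem prime_patterns:
  assumes "N \<ge> 1" "R \<ge> 1" "H \<subseteq> edges N R"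
  shows "\<exists>t W x. \<forall>e\<in>edges N R. prime (t + W * psi N e x) \<longleftrightarrow> e \<in> H"
proof -
  define K M where "K = Suc R ^ N" and "M = R ^ N"
  define D where "D = 9 * (4 ^ K * K + 2 * K)"
  define C1 where "C1 = 2 * D + 2"
  define C5 where "C5 = 2 * C1 * K + 4"
  define C4 where "C4 = 4 * real K ^ 2 + real K + 2 * real (N * Suc R)"
  \<comment> \<open>Folding the constants shows that the coefficients of the conditions do not
    involve \<open>g\<close>.\<close>
  have "\<forall>\<^sub>F g in sequentially. parameters N R g"
    unfolding parameters_def
    unfolding K_def[symmetric] M_def[symmetric]
    unfolding D_def[symmetric] 
    unfolding C1_def[symmetric]
    unfolding C5_def[symmetric] C4_def[symmetric]
    by (intro eventually_conj eventually_poly_less_exp eventually_ge_at_top always_eventually allI assms)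
  then obtain g where "parameters N R g"
    using eventually_happens'[OF sequentially_bot] by blast
  then show ?thesis
    using parameters.pattern[of N R g H] assms(3) by blast
qed

section \<open>The independence properties\<close>

fun sum_tm :: "nat \<Rightarrow> fsym tm" where
  "sum_tm 0 = Var 0"
| "sum_tm (Suc m) = Fun Plus [sum_tm m, Var (Suc m)]"

lemma tm_in_sum_tm: "fun_arity L Plus = Some 2 \<Longrightarrow> tm_in L (sum_tm m)"
  by (induction m) (auto simp: numeral_2_eq_2)

lemma tm_vars_sum_tm: "tm_vars (sum_tm m) = {..m}"
  by (induction m) (auto simp: atMost_Suc)

lemma tm_val_sum_tm: "tm_val Z_struct e (sum_tm m) = (\<Sum>i\<le>m. e i)"
  by (induction m) (auto simp: Z_struct_def)

lemma int_in_pm_primes: "int m \<in> pm_primes \<longleftrightarrow> prime m"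
  using prime_ge_0_int[of "- int m"] by (auto simp: pm_primes_def)

lemma is_model_Th_Z_struct: "is_model L (Th L Z_struct) Z_struct"
  by (simp add: is_model_def is_struct_def Th_def Z_struct_def)

text \<open>Class \<open>0\<close> gets a vertex for each subset \<open>s\<close>, the other
  \<open>n\<close> classes the indices below \<open>k\<close>, and the hypergraph to be realised is
  the incidence of \<open>js\<close> in \<open>s\<close>. The shift \<open>t\<close> is put into the
  elements \<open>b\<close> of class \<open>0\<close>, so that it occurs once in every sum.\<close>

lemma sum_shatters_box:
  "\<exists>(a :: nat \<Rightarrow> nat \<Rightarrow> int). \<forall>s \<subseteq> {js. length js = n \<and> set js \<subseteq> {..<k}}.
    \<exists>b. \<forall>js. length js = n \<and> set js \<subseteq> {..<k} \<longrightarrow>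
      (b + (\<Sum>i<n. a i (js ! i)) \<in> pm_primes \<longleftrightarrow> js \<in> s)"
proof -
  define J where "J = {js :: nat list. length js = n \<and> set js \<subseteq> {..<k}}"
  have "finite J"
    unfolding J_def using finite_lists_length_eq[of "{..<k}" n] by (simp add: conj_commute)
  then have fin: "finite (Pow J)" by simp
  then obtain idx where idx: "bij_betw idx (Pow J) {0..<card (Pow J)}"
    using ex_bij_betw_finite_nat by blast
  have inj: "s = s'" if "s \<subseteq> J" "s' \<subseteq> J" "idx s = idx s'" for s s'
    using idx that by (auto simp: bij_betw_def dest: inj_onD)
  \<comment> \<open>One bound for the indices in all classes; it is positive even for
    \<open>k = 0\<close>, because \<open>Pow J\<close> contains the empty set.\<close>
  define R where "R = max k (card (Pow J))"
  have "card (Pow J) > 0" using fin by (auto simp: card_gt_0_iff)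
  then have R: "R \<ge> 1" by (simp add: R_def)
  define edge where "edge s js = (\<lambda>i\<in>{..<Suc n}. if i = 0 then idx s else js ! (i - 1))" for s js
  have edge_in: "edge s js \<in> edges (Suc n) R" if "s \<subseteq> J" "js \<in> J" for s js
  proof -
    have "idx s < R"
      using bij_betwE[OF idx] that(1) by (auto simp: R_def less_max_iff_disj)
    moreover have "js ! i < R" if "i < n" for i
    proof -
      have "js ! i \<in> set js" using \<open>js \<in> J\<close> that by (simp add: J_def)
      then show ?thesis using \<open>js \<in> J\<close> by (auto simp: J_def R_def)
    qed
    ultimately show ?thesis by (auto simp: edge_def edges_def)
  qed
  define H where "H = {edge s js |s js. s \<subseteq> J \<and> js \<in> s}"
  have edge_H: "edge s js \<in> H \<longleftrightarrow> js \<in> s" if "s \<subseteq> J" "js \<in> J" for s js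
  proof
    assume "edge s js \<in> H"
    then obtain s' js' where s': "s' \<subseteq> J" "js' \<in> s'" "edge s js = edge s' js'"
      by (auto simp: H_def)
    have "js ! i = js' ! i" if "i < n" for i
      using fun_cong[OF s'(3), of "Suc i"] that by (simp add: edge_def)
    moreover have "length js = n" "length js' = n" using that(2) s'(1,2) by (auto simp: J_def)
    ultimately have "js = js'" by (intro nth_equalityI) auto
    moreover have "s = s'"
      using fun_cong[OF s'(3), of 0] that(1) s'(1) by (intro inj) (auto simp: edge_def)
    ultimately show "js \<in> s" using s'(2) by simp
  qed (use that in \<open>auto simp: H_def\<close>)
  have "H \<subseteq> edges (Suc n) R" using edge_in by (auto simp: H_def)
  then have "\<exists>t W x. \<forall>e\<in>edges (Suc n) R. prime (t + W * psi (Suc n) e x) \<longleftrightarrow> e \<in> H"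
    by (intro prime_patterns R) auto
  then obtain t W x
    where x: "\<forall>e\<in>edges (Suc n) R. prime (t + W * psi (Suc n) e x) \<longleftrightarrow> e \<in> H"
    by blast
  define a where "a i j = int (W * x (Suc i, j))" for i j
  have "int (t + W * x (0, idx s)) + (\<Sum>i<n. a i (js ! i)) \<in> pm_primes \<longleftrightarrow> js \<in> s"
    if "s \<subseteq> J" "js \<in> J" for s js
  proof -
    have "psi (Suc n) (edge s js) x = x (0, idx s) + (\<Sum>i<n. x (Suc i, js ! i))"
      unfolding psi_def sum.lessThan_Suc_shift by (simp add: edge_def)
    then have "int (t + W * x (0, idx s)) + (\<Sum>i<n. a i (js ! i)) = int (t + W * psi (Suc n) (edge s js) x)"
      by (simp add: a_def distrib_left sum_distrib_left)
    then have "int (t + W * x (0, idx s)) + (\<Sum>i<n. a i (js ! i)) \<in> pm_primes \<longleftrightarrow>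
        prime (t + W * psi (Suc n) (edge s js) x)"
      by (simp only: int_in_pm_primes)
    then show ?thesis using x edge_in[OF that] edge_H[OF that] by blast
  qed
  then show ?thesis unfolding J_def by blast
qed

lemma n_indep_property_Th_Z_struct:
  fixes L :: "(fsym, rsym) lang"
  assumes "fun_arity L Plus = Some 2" "rel_arity L Pr = Some 1"
  shows "n_indep_property n L (Th L Z_struct)"
  unfolding n_indep_property_def
proof (intro exI[of _ "Rel Pr [sum_tm n]"] exI[of _ "\<lambda>_. 1"] conjI allI)
  show "fm_in L (Rel Pr [sum_tm n])" using assms tm_in_sum_tm by simp
  show "free_vars (Rel Pr [sum_tm n] :: (fsym, rsym) fm) \<subseteq> {..<1 + (\<Sum>i<n. 1)}"
    by (auto simp: tm_vars_sum_tm)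
  fix k
  obtain a :: "nat \<Rightarrow> nat \<Rightarrow> int" where a: "\<forall>s \<subseteq> {js. length js = n \<and> set js \<subseteq> {..<k}}.
    \<exists>b. \<forall>js. length js = n \<and> set js \<subseteq> {..<k} \<longrightarrow>
      (b + (\<Sum>i<n. a i (js ! i)) \<in> pm_primes \<longleftrightarrow> js \<in> s)"
    by (rule exE[OF sum_shatters_box])
  have sat: "sat Z_struct ((!) (b # concat (map (\<lambda>i. [a i (js ! i)]) [0..<n]))) (Rel Pr [sum_tm n]) \<longleftrightarrow>
    b + (\<Sum>i<n. a i (js ! i)) \<in> pm_primes" for b js
  proof -
    have "(\<Sum>i\<le>n. (b # map (\<lambda>i. a i (js ! i)) [0..<n]) ! i) = b + (\<Sum>i<n. a i (js ! i))"
      unfolding lessThan_Suc_atMost[symmetric] sum.lessThan_Suc_shift by simp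
    then show ?thesis
      by (simp add: tm_val_sum_tm concat_map_singleton) (simp add: Z_struct_def)
  qed
  show "\<exists>(M :: (fsym, rsym, int) fo_struct) a.
         is_model L (Th L Z_struct) M \<and>
         (\<forall>i<n. \<forall>j<k. length (a i j) = 1 \<and> set (a i j) \<subseteq> universe M) \<and>
         (\<forall>s \<subseteq> {js. length js = n \<and> set js \<subseteq> {..<k}}.
            \<exists>b\<in>universe M. \<forall>js. length js = n \<and> set js \<subseteq> {..<k} \<longrightarrow>
              (sat M ((!) (b # concat (map (\<lambda>i. a i (js ! i)) [0..<n]))) (Rel Pr [sum_tm n]) \<longleftrightarrow> js \<in> s))"
  \<comment> \<open>The integers themselves realise the pattern for every \<open>k\<close>, each
    \<open>y\<close> being a single variable.\<close>
  proof (intro exI[of _ Z_struct] exI[of _ "\<lambda>i j. [a i j]"] conjI)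
    show "is_model L (Th L Z_struct) Z_struct" by (rule is_model_Th_Z_struct)
    have "universe Z_struct = UNIV" by (simp add: Z_struct_def)
    then show "\<forall>i<n. \<forall>j<k. length [a i j] = 1 \<and> set [a i j] \<subseteq> universe Z_struct"
      "\<forall>s \<subseteq> {js. length js = n \<and> set js \<subseteq> {..<k}}.
            \<exists>b\<in>universe Z_struct. \<forall>js. length js = n \<and> set js \<subseteq> {..<k} \<longrightarrow>
              (sat Z_struct ((!) (b # concat (map (\<lambda>i. [a i (js ! i)]) [0..<n]))) (Rel Pr [sum_tm n]) \<longleftrightarrow> js \<in> s)"
      using a unfolding sat by simp_all
  qed
qed

theorem theorem3p4:
  "indep_property L_plus_Pr T_plus_Pr
   \<and> (\<forall>n\<ge>1. n_indep_property n L_plus_Pr T_plus_Pr)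
   \<and> indep_property L_plus_Pr_star T_plus_Pr_star
   \<and> (\<forall>n\<ge>1. n_indep_property n L_plus_Pr_star T_plus_Pr_star)"
proof -
  have "n_indep_property n L_plus_Pr T_plus_Pr" for n
    unfolding T_plus_Pr_def
    by (rule n_indep_property_Th_Z_struct) (simp_all add: L_plus_Pr_def)
  moreover have "n_indep_property n L_plus_Pr_star T_plus_Pr_star" for n
    unfolding T_plus_Pr_star_def
    by (rule n_indep_property_Th_Z_struct) (simp_all add: L_plus_Pr_star_def)
  ultimately show ?thesis by (simp add: indep_property_def)
qed

end
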